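(* Let $\Sigma_h$ and $V_h$ be the conforming finite element spaces described in the context, with $B^*\Sigma_h\subseteq V_h$. Assume: (A1) there is a subspace $\tilde\Sigma\subset\Sigma$, equipped with a norm $\|\cdot\|_{\tilde\Sigma}$ (encoding extra regularity compared to $\Sigma$), such that for every $\psi_h\in V_h$ there exists $\Phi\in\tilde\Sigma$ with $B^*\Phi=\psi_h$; (A2) there exists a (Fortin) operator $\Pi_h:\tilde\Sigma\to\Sigma_h$ such that $Q_hB^*\Phi=B^*\Pi_h\Phi$ for all $\Phi\in\tilde\Sigma$, where $Q_h$ is the $L^2$ projection from $V$ onto $V_h$, i.e. $(B^*\Phi,\psi_h)_V=(B^*\Pi_h\Phi,\psi_h)_V$ for all $\psi_h\in V_h$; and $\|\Pi_h\Phi\|_\Sigma\le C\|\Phi\|_{\tilde\Sigma}$ for all $\Phi\in\tilde\Sigma$ with a constant $C$. Then the discrete mixed problem is well-posed: for every $F\in V$ there exists a unique $(\Phi_h,\phi_h)\in\Sigma_h\times V_h$ such that $$(\Phi_h,\Psi_h)_{\mathcal C^{-1}}+(B^*\Psi_h,\phi_h)_V=0\quad\text{for all }\Psi_h\in\Sigma_h,\qquad (B^*\Phi_h,\psi_h)_V=-(F,\psi_h)_V\quad\text{for all }\psi_h\in V_h,$$ and $(\Phi_h,\phi_h)$ depends continuously on $F$.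
   Context: Geometry. $S$ and $\tilde S$ are the midsurfaces of two flat plates in $\mathbb R^3$, each lying in its own plane and each regarded as a bounded two-dimensional Lipschitz domain whose boundary consists of finitely many edges (straight, so that the domains can be triangulated). They meet along a common straight segment $\Gamma=\partial S\cap\partial\tilde S$. One has $\partial S=\partial S_0\cup\partial S_1\cup\Gamma$ (non-overlapping parts, $\partial S_0$ of nonzero length: clamped part; $\partial S_1$: free part) and $\partial\tilde S=\partial\tilde S_1\cup\Gamma$ ($\partial \tilde S_1$: free part). A tilde denotes the quantity or operator for $\tilde S$ analogous to that for $S$ (except in the symbol $\tilde\Sigma$, a subspace of $\Sigma$). $\boldsymbol n,\boldsymbol t$ are the unit outer normal and unit tangent of $\partial S$ in the plane of $S$ (consistently oriented), and $\boldsymbol l=\boldsymbol n\times\boldsymbol t$; likewise $\tilde{\boldsymbol n},\tilde{\boldsymbol t},\tilde{\boldsymbol l}=\tilde{\boldsymbol n}\times\tilde{\boldsymbol t}$ for $\tilde S$, with $\tilde{\boldsymbol t}=-\boldsymbol t$ on $\Gamma$. The angle $\theta\in(0,\pi)$ between the plates satisfies, on $\Gamma$, $\tilde{\boldsymbol n}=\boldsymbol n\cos\theta-\boldsymbol l\sin\theta$ and $\tilde{\boldsymbol l}=-\boldsymbol n\sin\theta-\boldsymbol l\cos\theta$. Spaces. $\mathbb S$ is the space of symmetric real $2\times2$ matrices. $V=L^2(S;\mathbb R^2)\times L^2(S)\times L^2(\tilde S;\mathbb R^2)\times L^2(\tilde S)$ with its $L^2$ inner product $(\cdot,\cdot)_V$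 and norm; its elements are written $\psi=(\boldsymbol v,v_3;\tilde{\boldsymbol v},\tilde v_3)$. $H=H^1(S;\mathbb R^2)\times H^2(S)\times H^1(\tilde S;\mathbb R^2)\times H^2(\tilde S)$. $W$ is the set of $\psi\in H$ with: $\boldsymbol v=0$, $v_3=0$, $\partial_n v_3=0$ on $\partial S_0$; and on $\Gamma$: $\partial_n v_3=-\tilde\partial_{\tilde n}\tilde v_3$, $v_1=\tilde v_1\cos\theta-\tilde v_3\sin\theta$, $v_2=-\tilde v_2$, $v_3=-\tilde v_1\sin\theta-\tilde v_3\cos\theta$, where on $\Gamma$ $v_1=\boldsymbol v\cdot\boldsymbol n$, $v_2=\boldsymbol v\cdot\boldsymbol t$, $\tilde v_1=\tilde{\boldsymbol v}\cdot\tilde{\boldsymbol n}$, $\tilde v_2=\tilde{\boldsymbol v}\cdot\tilde{\boldsymbol t}$. $V_{\mathrm s}=L^2(S;\mathbb S)\times L^2(S;\mathbb S)\times L^2(\tilde S;\mathbb S)\times L^2(\tilde S;\mathbb S)$ with its $L^2$ inner product (Frobenius product of matrices) and norm; elements are written $\Psi=(\boldsymbol\tau,\boldsymbol\kappa;\tilde{\boldsymbol\tau},\tilde{\boldsymbol\kappa})$ or $\Phi=(\boldsymbol N,\boldsymbol M;\tilde{\boldsymbol N},\tilde{\boldsymbol M})$. $H_{\mathrm s}$ is the set of $\Psi\in V_{\mathrm s}$ with $\operatorname{Div}\boldsymbol\tau\in L^2(S;\mathbb R^2)$, $\operatorname{div}\operatorname{Div}\boldsymbol\kappa\in L^2(S)$,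 and similarly on $\tilde S$ ($\operatorname{Div}$ is the row-wise divergence, in the distributional sense). Operators. $\nabla_{\mathrm s}\boldsymbol v=\frac12(\nabla\boldsymbol v+(\nabla\boldsymbol v)^T)$; for $\psi\in W$, $B\psi=(-\nabla_{\mathrm s}\boldsymbol v,\nabla^2v_3;-\tilde\nabla_{\mathrm s}\tilde{\boldsymbol v},\tilde\nabla^2\tilde v_3)\in V_{\mathrm s}$. $B$ is viewed as a densely defined operator $W\subset V\to V_{\mathrm s}$, with adjoint $B^*:\Sigma\subset V_{\mathrm s}\to V$, where $$\Sigma=\{\Phi\in H_{\mathrm s}:\ \exists c>0\text{ such that }|(B\psi,\Phi)_{V_{\mathrm s}}|\le c\|\psi\|_V\ \forall\psi\in W\},$$ $B^*\Phi=(\operatorname{Div}\boldsymbol N,\operatorname{div}\operatorname{Div}\boldsymbol M;\tilde{\operatorname{Div}}\tilde{\boldsymbol N},\tilde{\operatorname{div}}\tilde{\operatorname{Div}}\tilde{\boldsymbol M})$, $\|\Phi\|_\Sigma=(\|\Phi\|_{V_{\mathrm s}}^2+\|B^*\Phi\|_V^2)^{1/2}$. Material law. $E>0$ (Young's modulus), $e>0$ (thickness), $\nu\in(-1,1)$ (Poisson ratio). For $\boldsymbol A\in\mathbb S$, $\mathcal C_1\boldsymbol A=\frac{Ee}{1-\nu^2}((1-\nu)\boldsymbol A+\nu\operatorname{tr}(\boldsymbol A)\mathbf I)$, $\mathcal C_2\boldsymbol A=\frac{Ee^3}{12(1-\nu^2)}((1-\nu)\boldsymbol A+\nu\operatorname{tr}(\boldsymbol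 A)\mathbf I)$, and $(\Phi,\Psi)_{\mathcal C^{-1}}=(\mathcal C_1^{-1}\boldsymbol N,\boldsymbol\tau)_S+(\mathcal C_2^{-1}\boldsymbol M,\boldsymbol\kappa)_S+(\mathcal C_1^{-1}\tilde{\boldsymbol N},\tilde{\boldsymbol\tau})_{\tilde S}+(\mathcal C_2^{-1}\tilde{\boldsymbol M},\tilde{\boldsymbol\kappa})_{\tilde S}$. Discrete spaces. $\mathcal T_h$ and $\tilde{\mathcal T}_h$ are shape regular triangulations of $S$ and $\tilde S$, compatible on $\Gamma$; $h$ is the maximal element diameter; $k_1,k_2,k_3,k_4$ are integers; $P_k$ denotes polynomials of total degree at most $k$. $\Sigma_h\subset\Sigma$ (conformity) is a linear space of $\Psi_h=(\boldsymbol\tau_h,\boldsymbol\kappa_h;\tilde{\boldsymbol\tau}_h,\tilde{\boldsymbol\kappa}_h)\in H_{\mathrm s}$ with $\boldsymbol\tau_h|_K\in P_{k_1}(K;\mathbb S)$, $\boldsymbol\kappa_h|_K\in P_{k_2}(K;\mathbb S)$ for all $K\in\mathcal T_h$, $\tilde{\boldsymbol\tau}_h|_{\tilde K}\in P_{k_1}(\tilde K;\mathbb S)$, $\tilde{\boldsymbol\kappa}_h|_{\tilde K}\in P_{k_2}(\tilde K;\mathbb S)$ for all $\tilde K\in\tilde{\mathcal T}_h$, which satisfy the following conditions, written for $(\boldsymbol N,\boldsymbol M;\tilde{\boldsymbol N},\tilde{\boldsymbol M})=\Psi_h$: $\boldsymbol N\boldsymbol n=0$, $T=0$, $M_{nn}=0$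 on $\partial S_1$, $[\![M_{nt}]\!]_x=0$ at all corners $x$ between two adjacent edges of $\partial S_1$ (not meeting at angle $\pi$), and the analogous conditions on $\partial\tilde S_1$; on $\Gamma$, $\tilde M_{\tilde n\tilde n}=M_{nn}$, $\tilde N_{\tilde n\tilde n}=-N_{nn}\cos\theta+T\sin\theta$, $\tilde N_{\tilde n\tilde t}=N_{nt}$, $\tilde T=N_{nn}\sin\theta+T\cos\theta$; and $[\![M_{nt}]\!]_x\sin\theta=0$, $[\![\tilde M_{\tilde n\tilde t}]\!]_x-[\![M_{nt}]\!]_x\cos\theta=0$ at the two end points $x$ of $\Gamma$. Here $N_{nn}=(\boldsymbol N\boldsymbol n)\cdot\boldsymbol n$, $N_{nt}=(\boldsymbol N\boldsymbol n)\cdot\boldsymbol t$, $M_{nn}=(\boldsymbol M\boldsymbol n)\cdot\boldsymbol n$, $M_{nt}=(\boldsymbol M\boldsymbol n)\cdot\boldsymbol t$, $T=(\operatorname{Div}\boldsymbol M)\cdot\boldsymbol n+\partial_t((\boldsymbol M\boldsymbol n)\cdot\boldsymbol t)$, and $[\![M_{nt}]\!]_x=(\boldsymbol M\boldsymbol n_1)\cdot\boldsymbol t_1(x)-(\boldsymbol M\boldsymbol n_2)\cdot\boldsymbol t_2(x)$ for the two edges $e_1,e_2$ of the boundary meeting at $x$ (order determined by the orientation of the tangent), with the same definitions with tildes on $\tilde S$. $V_h$ is the set of $\psi_h=(\boldsymbol v_h,v_{3h};\tilde{\boldsymbol v}_h,\tilde v_{3h})\in V$ with $\boldsymbol v_h|_K\in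 P_{k_3}(K;\mathbb R^2)$, $v_{3h}|_K\in P_{k_4}(K)$ for all $K\in\mathcal T_h$ and $\tilde{\boldsymbol v}_h|_{\tilde K}\in P_{k_3}(\tilde K;\mathbb R^2)$, $\tilde v_{3h}|_{\tilde K}\in P_{k_4}(\tilde K)$ for all $\tilde K\in\tilde{\mathcal T}_h$. *)

theory Defs
  imports "HOL-Analysis.Analysis"
begin

section \<open>Lebesgue and Sobolev spaces in the plane\<close>

type_synonym pt = "real^2"

text \<open>
  Elements of \<open>L\<^sup>2\<close> are functions, not equivalence classes; equality in \<open>L\<^sup>2\<close> is
  equality almost everywhere and is always written out as such.
\<close>

definition L2 :: "'a::euclidean_space set \<Rightarrow> ('a \<Rightarrow> 'b::euclidean_space) set" where
  "L2 D = {f \<in> borel_measurable (lebesgue_on D). integrable (lebesgue_on D) (\<lambda>x. (norm (f x))\<^sup>2)}"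

text \<open>On \<^typ>\<open>real^2^2\<close> the operation \<open>\<bullet>\<close> is the Frobenius product.\<close>

definition L2_inner :: "'a::euclidean_space set \<Rightarrow> ('a \<Rightarrow> 'b::euclidean_space) \<Rightarrow> ('a \<Rightarrow> 'b) \<Rightarrow> real" where
  "L2_inner D f g = integral\<^sup>L (lebesgue_on D) (\<lambda>x. f x \<bullet> g x)"

definition grad :: "(pt \<Rightarrow> real) \<Rightarrow> pt \<Rightarrow> real^2" where
  "grad f x = (\<chi> i. frechet_derivative f (at x) (axis i 1))"

definition hessian :: "(pt \<Rightarrow> real) \<Rightarrow> pt \<Rightarrow> real^2^2" where
  "hessian f x = (\<chi> i j. grad (\<lambda>y. grad f y $ i) x $ j)"

definition Div :: "(pt \<Rightarrow> real^2^2) \<Rightarrow> pt \<Rightarrow> real^2" where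
  "Div A x = (\<chi> i. \<Sum>j\<in>UNIV. grad (\<lambda>y. A y $ i $ j) x $ j)"

text \<open>\<open>C\<^sup>\<infinity>\<close>: here \<open>d i j\<close> is the partial derivative of order \<open>(i, j)\<close>.\<close>

definition smooth :: "(pt \<Rightarrow> real) \<Rightarrow> bool" where
  "smooth f \<longleftrightarrow> (\<exists>d :: nat \<Rightarrow> nat \<Rightarrow> pt \<Rightarrow> real. d 0 0 = f \<and>
     (\<forall>i j x. (d i j has_derivative (\<lambda>h. h $ 1 * d (Suc i) j x + h $ 2 * d i (Suc j) x)) (at x)))"

definition test_functions :: "pt set \<Rightarrow> (pt \<Rightarrow> real) set" where
  "test_functions D = {u. smooth u \<and> compact (closure {x. u x \<noteq> 0}) \<and> closure {x. u x \<noteq> 0} \<subseteq> D}"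

definition has_weak_grad :: "pt set \<Rightarrow> (pt \<Rightarrow> real) \<Rightarrow> (pt \<Rightarrow> real^2) \<Rightarrow> bool" where
  "has_weak_grad D f g \<longleftrightarrow> (\<forall>u\<in>test_functions D.
     integral\<^sup>L (lebesgue_on D) (\<lambda>x. f x *\<^sub>R grad u x) = - integral\<^sup>L (lebesgue_on D) (\<lambda>x. u x *\<^sub>R g x))"

definition weak_grad :: "pt set \<Rightarrow> (pt \<Rightarrow> real) \<Rightarrow> pt \<Rightarrow> real^2" where
  "weak_grad D f = (SOME g. g \<in> L2 D \<and> has_weak_grad D f g)"

definition H1 :: "pt set \<Rightarrow> (pt \<Rightarrow> real) set" where
  "H1 D = {f \<in> L2 D. \<exists>g\<in>L2 D. has_weak_grad D f g}"

definition H2 :: "pt set \<Rightarrow> (pt \<Rightarrow> real) set" where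
  "H2 D = {f \<in> H1 D. \<forall>i. (\<lambda>x. weak_grad D f x $ i) \<in> H1 D}"

definition weak_hessian :: "pt set \<Rightarrow> (pt \<Rightarrow> real) \<Rightarrow> pt \<Rightarrow> real^2^2" where
  "weak_hessian D f x = (\<chi> i j. weak_grad D (\<lambda>y. weak_grad D f y $ i) x $ j)"

definition weak_sym_grad :: "pt set \<Rightarrow> (pt \<Rightarrow> real^2) \<Rightarrow> pt \<Rightarrow> real^2^2" where
  "weak_sym_grad D v x =
     (\<chi> i j. (weak_grad D (\<lambda>y. v y $ i) x $ j + weak_grad D (\<lambda>y. v y $ j) x $ i) / 2)"

definition has_weak_Div :: "pt set \<Rightarrow> (pt \<Rightarrow> real^2^2) \<Rightarrow> (pt \<Rightarrow> real^2) \<Rightarrow> bool" where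
  "has_weak_Div D A g \<longleftrightarrow> (\<forall>u\<in>test_functions D.
     integral\<^sup>L (lebesgue_on D) (\<lambda>x. A x *v grad u x) = - integral\<^sup>L (lebesgue_on D) (\<lambda>x. u x *\<^sub>R g x))"

definition weak_Div :: "pt set \<Rightarrow> (pt \<Rightarrow> real^2^2) \<Rightarrow> pt \<Rightarrow> real^2" where
  "weak_Div D A = (SOME g. g \<in> L2 D \<and> has_weak_Div D A g)"

text \<open>
  The second order distribution \<open>div Div A\<close> is tested as a whole: \<open>Div A\<close> alone need not be in \<open>L\<^sup>2\<close>.
\<close>

definition has_weak_divDiv :: "pt set \<Rightarrow> (pt \<Rightarrow> real^2^2) \<Rightarrow> (pt \<Rightarrow> real) \<Rightarrow> bool" where
  "has_weak_divDiv D A g \<longleftrightarrow> (\<forall>u\<in>test_functions D.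
     integral\<^sup>L (lebesgue_on D) (\<lambda>x. A x \<bullet> hessian u x) = integral\<^sup>L (lebesgue_on D) (\<lambda>x. u x * g x))"

definition weak_divDiv :: "pt set \<Rightarrow> (pt \<Rightarrow> real^2^2) \<Rightarrow> pt \<Rightarrow> real" where
  "weak_divDiv D A = (SOME g. g \<in> L2 D \<and> has_weak_divDiv D A g)"

text \<open>
  The trace of an \<open>H\<^sup>1\<close> function on the segment from \<open>a\<close> to \<open>b\<close>, as a function of the
  parameter \<open>s \<in> [0, 1]\<close> of \<open>a + s (b - a)\<close>: the \<open>L\<^sup>2\<close> limit of the restrictions of smooth
  functions that converge in \<open>H\<^sup>1\<close>.
\<close>

definition has_trace :: "pt set \<Rightarrow> pt \<times> pt \<Rightarrow> (pt \<Rightarrow> real) \<Rightarrow> (real \<Rightarrow> real) \<Rightarrow> bool" where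
  "has_trace D = (\<lambda>(a, b) f g. g \<in> L2 {0..1} \<and> (\<exists>u :: nat \<Rightarrow> pt \<Rightarrow> real.
     (\<forall>k. smooth (u k)) \<and>
     (\<lambda>k. L2_inner D (\<lambda>x. u k x - f x) (\<lambda>x. u k x - f x)) \<longlonglongrightarrow> 0 \<and>
     (\<lambda>k. L2_inner D (\<lambda>x. grad (u k) x - weak_grad D f x) (\<lambda>x. grad (u k) x - weak_grad D f x)) \<longlonglongrightarrow> 0 \<and>
     (\<lambda>k. L2_inner {0..1} (\<lambda>s. u k (a + s *\<^sub>R (b - a)) - g s) (\<lambda>s. u k (a + s *\<^sub>R (b - a)) - g s)) \<longlonglongrightarrow> 0))"

definition trace_on :: "pt set \<Rightarrow> pt \<times> pt \<Rightarrow> (pt \<Rightarrow> real) \<Rightarrow> real \<Rightarrow> real" where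
  "trace_on D e f = (SOME g. has_trace D e f g)"


section \<open>Geometry of the folded plate\<close>

text \<open>Counterclockwise rotation by a right angle.\<close>

definition rot90 :: "real^2 \<Rightarrow> real^2" where
  "rot90 d = vector [- d $ 2, d $ 1]"

definition lipschitz_domain :: "pt set \<Rightarrow> bool" where
  "lipschitz_domain D \<longleftrightarrow> open D \<and> connected D \<and> bounded D \<and> D \<noteq> {} \<and>
     (\<forall>x\<in>frontier D. \<exists>d r \<rho> L. \<exists>g :: real \<Rightarrow> real.
        norm d = 1 \<and> 0 < r \<and> 0 < \<rho> \<and> L-lipschitz_on UNIV g \<and> g 0 = 0 \<and>
        (\<forall>s\<in>{-r<..<r}. \<forall>z\<in>{-\<rho><..<\<rho>}. x + s *\<^sub>R rot90 d + z *\<^sub>R d \<in> D \<longleftrightarrow> g s < z))"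

text \<open>
  An edge \<open>(a, b)\<close> is the segment from \<open>a\<close> to \<open>b\<close>, oriented by the unit tangent.
  The domain lies on its left, so that the outer normal points to the right.
\<close>

type_synonym edge = "pt \<times> pt"

definition seg :: "edge \<Rightarrow> pt set" where
  "seg e = closed_segment (fst e) (snd e)"

definition tangent :: "edge \<Rightarrow> real^2" where
  "tangent e = sgn (snd e - fst e)"

definition normal :: "edge \<Rightarrow> real^2" where
  "normal e = - rot90 (tangent e)"

definition reversed :: "edge \<Rightarrow> edge" where
  "reversed e = (snd e, fst e)"

text \<open>
  The midsurface is described by an open set \<open>mid\<close> in Cartesian coordinates of its plane, and the
  plane by a point \<open>base\<close> and an orthonormal pair \<open>dir1\<close>, \<open>dir2\<close> in space. Taking the tangent
  counterclockwise with respect to these coordinates is no restriction, as \<open>dir1\<close> and \<open>dir2\<close> can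
  be exchanged.
\<close>

record plate =
  mid :: "pt set"
  base :: "real^3"
  dir1 :: "real^3"
  dir2 :: "real^3"
  clamped :: "edge set"
  unloaded :: "edge set"
  junction :: edge

definition edges :: "plate \<Rightarrow> edge set" where
  "edges X = clamped X \<union> unloaded X \<union> {junction X}"

definition lift :: "plate \<Rightarrow> real^2 \<Rightarrow> real^3" where
  "lift X u = u $ 1 *\<^sub>R dir1 X + u $ 2 *\<^sub>R dir2 X"

definition chart :: "plate \<Rightarrow> pt \<Rightarrow> real^3" where
  "chart X x = base X + lift X x"

definition polygonal_plate :: "plate \<Rightarrow> bool" where
  "polygonal_plate X \<longleftrightarrow>
     norm (dir1 X) = 1 \<and> norm (dir2 X) = 1 \<and> dir1 X \<bullet> dir2 X = 0 \<and>
     lipschitz_domain (mid X) \<and>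
     finite (edges X) \<and>
     clamped X \<inter> unloaded X = {} \<and> junction X \<notin> clamped X \<union> unloaded X \<and>
     frontier (mid X) = (\<Union>e\<in>edges X. seg e) \<and>
     (\<forall>e\<in>edges X. fst e \<noteq> snd e \<and>
        (\<forall>x\<in>open_segment (fst e) (snd e). \<exists>\<epsilon>>0. \<forall>s\<in>{0<..<\<epsilon>}.
           x - s *\<^sub>R normal e \<in> mid X \<and> x + s *\<^sub>R normal e \<notin> mid X)) \<and>
     (\<forall>e\<in>edges X. \<forall>f\<in>edges X. e \<noteq> f \<longrightarrow>
        seg e \<inter> seg f \<subseteq> {fst e, snd e} \<inter> {fst f, snd f})"

text \<open>\<open>n\<close>, \<open>t\<close>, \<open>l\<close> on the common segment \<open>\<Gamma>\<close>, as vectors in space.\<close>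

definition junction_n :: "plate \<Rightarrow> real^3" where
  "junction_n X = lift X (normal (junction X))"

definition junction_t :: "plate \<Rightarrow> real^3" where
  "junction_t X = lift X (tangent (junction X))"

definition junction_l :: "plate \<Rightarrow> real^3" where
  "junction_l X = cross3 (junction_n X) (junction_t X)"

definition folded_plate :: "plate \<Rightarrow> plate \<Rightarrow> real \<Rightarrow> bool" where
  "folded_plate S S' \<theta> \<longleftrightarrow>
     polygonal_plate S \<and> polygonal_plate S' \<and> clamped S \<noteq> {} \<and> clamped S' = {} \<and>
     chart S ` frontier (mid S) \<inter> chart S' ` frontier (mid S') = chart S ` seg (junction S) \<and>
     chart S (fst (junction S)) = chart S' (snd (junction S')) \<and>
     chart S (snd (junction S)) = chart S' (fst (junction S')) \<and>
     junction_t S' = - junction_t S \<and>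
     0 < \<theta> \<and> \<theta> < pi \<and>
     junction_n S' = cos \<theta> *\<^sub>R junction_n S - sin \<theta> *\<^sub>R junction_l S \<and>
     junction_l S' = - sin \<theta> *\<^sub>R junction_n S - cos \<theta> *\<^sub>R junction_l S"


section \<open>Spaces and operators on the folded plate\<close>

text \<open>
  A quadruple \<open>(f, g; f', g')\<close>, the first two fields on \<open>S\<close> and the last two on the second plate \<open>S'\<close>.
\<close>

type_synonym ('b, 'c) field = "((pt \<Rightarrow> 'b) \<times> (pt \<Rightarrow> 'c)) \<times> ((pt \<Rightarrow> 'b) \<times> (pt \<Rightarrow> 'c))"
type_synonym displacement = "(real^2, real) field"
type_synonym stress = "(real^2^2, real^2^2) field"

definition lincomb :: "real \<Rightarrow> ('b::real_vector, 'c::real_vector) field \<Rightarrow> real \<Rightarrow> ('b, 'c) field \<Rightarrow> ('b, 'c) field" where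
  "lincomb r = (\<lambda>((f, g), (f', g')) s ((p, q), (p', q')).
     ((\<lambda>x. r *\<^sub>R f x + s *\<^sub>R p x, \<lambda>x. r *\<^sub>R g x + s *\<^sub>R q x),
      (\<lambda>x. r *\<^sub>R f' x + s *\<^sub>R p' x, \<lambda>x. r *\<^sub>R g' x + s *\<^sub>R q' x)))"

abbreviation field_diff :: "('b::real_vector, 'c::real_vector) field \<Rightarrow> ('b, 'c) field \<Rightarrow> ('b, 'c) field" where
  "field_diff \<Phi> \<Psi> \<equiv> lincomb 1 \<Phi> (-1) \<Psi>"

definition zero_field :: "('b::zero, 'c::zero) field" where
  "zero_field = ((\<lambda>x. 0, \<lambda>x. 0), (\<lambda>x. 0, \<lambda>x. 0))"

definition ae_eq :: "plate \<Rightarrow> plate \<Rightarrow> ('b, 'c) field \<Rightarrow> ('b, 'c) field \<Rightarrow> bool" where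
  "ae_eq S S' = (\<lambda>((f, g), (f', g')) ((p, q), (p', q')).
     (AE x in lebesgue_on (mid S). f x = p x \<and> g x = q x) \<and>
     (AE x in lebesgue_on (mid S'). f' x = p' x \<and> g' x = q' x))"

text \<open>\<open>(\<cdot>, \<cdot>)\<close> and \<open>\<parallel>\<cdot>\<parallel>\<close> of both \<open>V\<close> and \<open>V\<^sub>s\<close>.\<close>

definition field_inner ::
  "plate \<Rightarrow> plate \<Rightarrow> ('b::euclidean_space, 'c::euclidean_space) field \<Rightarrow> ('b, 'c) field \<Rightarrow> real" where
  "field_inner S S' = (\<lambda>((f, g), (f', g')) ((p, q), (p', q')).
     L2_inner (mid S) f p + L2_inner (mid S) g q + L2_inner (mid S') f' p' + L2_inner (mid S') g' q')"

definition field_norm :: "plate \<Rightarrow> plate \<Rightarrow> ('b::euclidean_space, 'c::euclidean_space) field \<Rightarrow> real" where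
  "field_norm S S' \<Phi> = sqrt (field_inner S S' \<Phi> \<Phi>)"

definition linear_space :: "('b::real_vector, 'c::real_vector) field set \<Rightarrow> bool" where
  "linear_space U \<longleftrightarrow> zero_field \<in> U \<and> (\<forall>\<Phi>\<in>U. \<forall>\<Psi>\<in>U. \<forall>r s. lincomb r \<Phi> s \<Psi> \<in> U)"

definition norm_on ::
  "plate \<Rightarrow> plate \<Rightarrow> ('b::real_vector, 'c::real_vector) field set \<Rightarrow> (('b, 'c) field \<Rightarrow> real) \<Rightarrow> bool" where
  "norm_on S S' U N \<longleftrightarrow>
     (\<forall>\<Phi>\<in>U. 0 \<le> N \<Phi> \<and> (N \<Phi> = 0 \<longleftrightarrow> ae_eq S S' \<Phi> zero_field)) \<and>
     (\<forall>\<Phi>\<in>U. \<forall>r. N (lincomb r \<Phi> 0 zero_field) = \<bar>r\<bar> * N \<Phi>) \<and>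
     (\<forall>\<Phi>\<in>U. \<forall>\<Psi>\<in>U. N (lincomb 1 \<Phi> 1 \<Psi>) \<le> N \<Phi> + N \<Psi>)"

definition V_space :: "plate \<Rightarrow> plate \<Rightarrow> displacement set" where
  "V_space S S' = (L2 (mid S) \<times> L2 (mid S)) \<times> (L2 (mid S') \<times> L2 (mid S'))"

definition H_space :: "plate \<Rightarrow> plate \<Rightarrow> displacement set" where
  "H_space S S' =
     ({v. \<forall>i. (\<lambda>x. v x $ i) \<in> H1 (mid S)} \<times> H2 (mid S)) \<times>
     ({v. \<forall>i. (\<lambda>x. v x $ i) \<in> H1 (mid S')} \<times> H2 (mid S'))"

definition normal_derivative :: "pt set \<Rightarrow> edge \<Rightarrow> (pt \<Rightarrow> real) \<Rightarrow> pt \<Rightarrow> real" where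
  "normal_derivative D e f x = weak_grad D f x \<bullet> normal e"

text \<open>
  The edges of the two plates that form \<open>\<Gamma>\<close> have opposite orientations; reversing the second one
  makes equal parameters in \<open>[0, 1]\<close> correspond to the same point of space.
\<close>

definition W_space :: "plate \<Rightarrow> plate \<Rightarrow> real \<Rightarrow> displacement set" where
  "W_space S S' \<theta> = {((v, v3), (v', v3')). ((v, v3), (v', v3')) \<in> H_space S S' \<and>
     (\<forall>e\<in>clamped S. AE s in lebesgue_on {0..1}.
        (\<forall>i. trace_on (mid S) e (\<lambda>x. v x $ i) s = 0) \<and>
        trace_on (mid S) e v3 s = 0 \<and>
        trace_on (mid S) e (normal_derivative (mid S) e v3) s = 0) \<and>
     (let \<Gamma> = junction S; \<Gamma>' = junction S';
          tr = trace_on (mid S) \<Gamma>; tr' = trace_on (mid S') (reversed \<Gamma>');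
          v1 = tr (\<lambda>x. v x \<bullet> normal \<Gamma>); v2 = tr (\<lambda>x. v x \<bullet> tangent \<Gamma>);
          v1' = tr' (\<lambda>x. v' x \<bullet> normal \<Gamma>'); v2' = tr' (\<lambda>x. v' x \<bullet> tangent \<Gamma>')
      in AE s in lebesgue_on {0..1}.
        tr (normal_derivative (mid S) \<Gamma> v3) s = - tr' (normal_derivative (mid S') \<Gamma>' v3') s \<and>
        v1 s = v1' s * cos \<theta> - tr' v3' s * sin \<theta> \<and>
        v2 s = - v2' s \<and>
        tr v3 s = - v1' s * sin \<theta> - tr' v3' s * cos \<theta>)}"

definition L2_sym :: "pt set \<Rightarrow> (pt \<Rightarrow> real^2^2) set" where
  "L2_sym D = {A \<in> L2 D. AE x in lebesgue_on D. transpose (A x) = A x}"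

definition Vs_space :: "plate \<Rightarrow> plate \<Rightarrow> stress set" where
  "Vs_space S S' = (L2_sym (mid S) \<times> L2_sym (mid S)) \<times> (L2_sym (mid S') \<times> L2_sym (mid S'))"

definition Hs_space :: "plate \<Rightarrow> plate \<Rightarrow> stress set" where
  "Hs_space S S' = {((N, M), (N', M')). ((N, M), (N', M')) \<in> Vs_space S S' \<and>
     (\<exists>g\<in>L2 (mid S). has_weak_Div (mid S) N g) \<and> (\<exists>g\<in>L2 (mid S). has_weak_divDiv (mid S) M g) \<and>
     (\<exists>g\<in>L2 (mid S'). has_weak_Div (mid S') N' g) \<and> (\<exists>g\<in>L2 (mid S'). has_weak_divDiv (mid S') M' g)}"

definition B_op :: "plate \<Rightarrow> plate \<Rightarrow> displacement \<Rightarrow> stress" where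
  "B_op S S' = (\<lambda>((v, v3), (v', v3')).
     ((\<lambda>x. - weak_sym_grad (mid S) v x, weak_hessian (mid S) v3),
      (\<lambda>x. - weak_sym_grad (mid S') v' x, weak_hessian (mid S') v3')))"

definition Sigma_space :: "plate \<Rightarrow> plate \<Rightarrow> real \<Rightarrow> stress set" where
  "Sigma_space S S' \<theta> = {\<Phi> \<in> Hs_space S S'.
     \<exists>c>0. \<forall>\<psi>\<in>W_space S S' \<theta>. \<bar>field_inner S S' (B_op S S' \<psi>) \<Phi>\<bar> \<le> c * field_norm S S' \<psi>}"

definition B_star :: "plate \<Rightarrow> plate \<Rightarrow> stress \<Rightarrow> displacement" where
  "B_star S S' = (\<lambda>((N, M), (N', M')).
     ((weak_Div (mid S) N, weak_divDiv (mid S) M),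
      (weak_Div (mid S') N', weak_divDiv (mid S') M')))"

definition Sigma_norm :: "plate \<Rightarrow> plate \<Rightarrow> stress \<Rightarrow> real" where
  "Sigma_norm S S' \<Phi> = sqrt ((field_norm S S' \<Phi>)\<^sup>2 + (field_norm S S' (B_star S S' \<Phi>))\<^sup>2)"


section \<open>Material law\<close>

definition C1 :: "real \<Rightarrow> real \<Rightarrow> real \<Rightarrow> real^2^2 \<Rightarrow> real^2^2" where
  "C1 E e \<nu> A = (E * e / (1 - \<nu>\<^sup>2)) *\<^sub>R ((1 - \<nu>) *\<^sub>R A + (\<nu> * trace A) *\<^sub>R mat 1)"

definition C2 :: "real \<Rightarrow> real \<Rightarrow> real \<Rightarrow> real^2^2 \<Rightarrow> real^2^2" where
  "C2 E e \<nu> A = (E * e ^ 3 / (12 * (1 - \<nu>\<^sup>2))) *\<^sub>R ((1 - \<nu>) *\<^sub>R A + (\<nu> * trace A) *\<^sub>R mat 1)"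

definition sym_inv :: "(real^2^2 \<Rightarrow> real^2^2) \<Rightarrow> real^2^2 \<Rightarrow> real^2^2" where
  "sym_inv C = inv_into {A. transpose A = A} C"

definition compliance_form :: "plate \<Rightarrow> plate \<Rightarrow> real \<Rightarrow> real \<Rightarrow> real \<Rightarrow> stress \<Rightarrow> stress \<Rightarrow> real" where
  "compliance_form S S' E e \<nu> = (\<lambda>((N, M), (N', M')) ((\<tau>, \<kappa>), (\<tau>', \<kappa>')).
     L2_inner (mid S) (\<lambda>x. sym_inv (C1 E e \<nu>) (N x)) \<tau> +
     L2_inner (mid S) (\<lambda>x. sym_inv (C2 E e \<nu>) (M x)) \<kappa> +
     L2_inner (mid S') (\<lambda>x. sym_inv (C1 E e \<nu>) (N' x)) \<tau>' +
     L2_inner (mid S') (\<lambda>x. sym_inv (C2 E e \<nu>) (M' x)) \<kappa>')"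


section \<open>Discrete spaces\<close>

definition mesh_of :: "plate \<Rightarrow> pt set set \<Rightarrow> bool" where
  "mesh_of X T \<longleftrightarrow> triangulation T \<and> (\<forall>K\<in>T. 2 simplex K) \<and> \<Union>T = closure (mid X)"

definition inradius :: "pt set \<Rightarrow> real" where
  "inradius K = Sup {r. 0 \<le> r \<and> (\<exists>x. cball x r \<subseteq> K)}"

definition shape_regular :: "real \<Rightarrow> pt set set \<Rightarrow> bool" where
  "shape_regular \<sigma> T \<longleftrightarrow> (\<forall>K\<in>T. diameter K \<le> \<sigma> * inradius K)"

text \<open>Two points are required: a triangle may also touch \<open>e\<close> in a single vertex.\<close>

definition side_on :: "pt set \<Rightarrow> edge \<Rightarrow> bool" where
  "side_on K e \<longleftrightarrow> (\<exists>x\<in>K \<inter> seg e. \<exists>y\<in>K \<inter> seg e. x \<noteq> y)"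

definition junction_sides :: "plate \<Rightarrow> pt set set \<Rightarrow> (real^3) set set" where
  "junction_sides X T = (\<lambda>K. chart X ` (K \<inter> seg (junction X))) ` {K \<in> T. side_on K (junction X)}"

definition compatible_meshes :: "plate \<Rightarrow> plate \<Rightarrow> pt set set \<Rightarrow> pt set set \<Rightarrow> bool" where
  "compatible_meshes S S' T T' \<longleftrightarrow> junction_sides S T = junction_sides S' T'"

definition mesh_size :: "pt set set \<Rightarrow> pt set set \<Rightarrow> real" where
  "mesh_size T T' = Max (diameter ` (T \<union> T'))"

text \<open>Polynomials of total degree at most \<open>k\<close>; only the zero polynomial if \<open>k < 0\<close>.\<close>

definition poly_space :: "int \<Rightarrow> (pt \<Rightarrow> 'b::real_vector) set" where
  "poly_space k = {p. \<exists>c. \<forall>x. p x =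
     (\<Sum>(i, j)\<in>{(i, j). int i + int j \<le> k}. (x $ 1 ^ i * x $ 2 ^ j) *\<^sub>R c i j)}"

text \<open>
  \<open>p K\<close> is the polynomial, on the whole plane, that agrees with \<open>f\<close> on \<open>K\<close>; boundary values and
  classical derivatives of \<open>f\<close> on the sides of \<open>K\<close> are those of \<open>p K\<close>.
\<close>

definition piecewise_poly ::
  "pt set set \<Rightarrow> int \<Rightarrow> (pt \<Rightarrow> 'b::real_vector) \<Rightarrow> (pt set \<Rightarrow> pt \<Rightarrow> 'b) \<Rightarrow> bool" where
  "piecewise_poly T k f p \<longleftrightarrow>
     (\<forall>K\<in>T. p K \<in> poly_space k \<and> (AE x in lebesgue_on K. f x = p K x))"

definition piecewise_sym_poly ::
  "pt set set \<Rightarrow> int \<Rightarrow> (pt \<Rightarrow> real^2^2) \<Rightarrow> (pt set \<Rightarrow> pt \<Rightarrow> real^2^2) \<Rightarrow> bool" where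
  "piecewise_sym_poly T k f p \<longleftrightarrow>
     piecewise_poly T k f p \<and> (\<forall>K\<in>T. \<forall>x. transpose (p K x) = p K x)"

definition comp_nn :: "edge \<Rightarrow> (pt \<Rightarrow> real^2^2) \<Rightarrow> pt \<Rightarrow> real" where
  "comp_nn e A x = (A x *v normal e) \<bullet> normal e"

definition comp_nt :: "edge \<Rightarrow> (pt \<Rightarrow> real^2^2) \<Rightarrow> pt \<Rightarrow> real" where
  "comp_nt e A x = (A x *v normal e) \<bullet> tangent e"

text \<open>The effective shear force \<open>T\<close>, for polynomial \<open>M\<close>.\<close>

definition shear :: "edge \<Rightarrow> (pt \<Rightarrow> real^2^2) \<Rightarrow> pt \<Rightarrow> real" where
  "shear e M x = Div M x \<bullet> normal e + frechet_derivative (comp_nt e M) (at x) (tangent e)"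

text \<open>
  The jump of \<open>M\<^sub>n\<^sub>t\<close> at \<open>x\<close>: the edge that ends in \<open>x\<close> minus the edge that starts in \<open>x\<close>, with the
  values taken from the triangles that have \<open>x\<close> on a side along the respective edge.
\<close>

definition side_triangle :: "pt set set \<Rightarrow> edge \<Rightarrow> pt \<Rightarrow> pt set" where
  "side_triangle T e x = (THE K. K \<in> T \<and> x \<in> K \<and> side_on K e)"

definition corner_jump :: "plate \<Rightarrow> pt set set \<Rightarrow> (pt set \<Rightarrow> pt \<Rightarrow> real^2^2) \<Rightarrow> pt \<Rightarrow> real" where
  "corner_jump X T q x =
     (let e1 = (THE e. e \<in> edges X \<and> snd e = x); e2 = (THE e. e \<in> edges X \<and> fst e = x)
      in comp_nt e1 (q (side_triangle T e1 x)) x - comp_nt e2 (q (side_triangle T e2 x)) x)"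

definition free_conditions ::
  "plate \<Rightarrow> pt set set \<Rightarrow> (pt set \<Rightarrow> pt \<Rightarrow> real^2^2) \<Rightarrow> (pt set \<Rightarrow> pt \<Rightarrow> real^2^2) \<Rightarrow> bool" where
  "free_conditions X T p q \<longleftrightarrow>
     (\<forall>e\<in>unloaded X. \<forall>K\<in>T. side_on K e \<longrightarrow> (\<forall>x\<in>K \<inter> seg e.
        p K x *v normal e = 0 \<and> shear e (q K) x = 0 \<and> comp_nn e (q K) x = 0)) \<and>
     (\<forall>e1\<in>unloaded X. \<forall>e2\<in>unloaded X. snd e1 = fst e2 \<and> tangent e1 \<noteq> tangent e2 \<longrightarrow>
        corner_jump X T q (snd e1) = 0)"

definition junction_conditions ::
  "plate \<Rightarrow> plate \<Rightarrow> real \<Rightarrow> pt set set \<Rightarrow> pt set set \<Rightarrow>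
   (pt set \<Rightarrow> pt \<Rightarrow> real^2^2) \<Rightarrow> (pt set \<Rightarrow> pt \<Rightarrow> real^2^2) \<Rightarrow>
   (pt set \<Rightarrow> pt \<Rightarrow> real^2^2) \<Rightarrow> (pt set \<Rightarrow> pt \<Rightarrow> real^2^2) \<Rightarrow> bool" where
  "junction_conditions S S' \<theta> T T' p q p' q' \<longleftrightarrow>
     (let \<Gamma> = junction S; \<Gamma>' = junction S' in
      (\<forall>K\<in>T. \<forall>K'\<in>T'. side_on K \<Gamma> \<and> side_on K' \<Gamma>' \<and> chart S ` (K \<inter> seg \<Gamma>) = chart S' ` (K' \<inter> seg \<Gamma>') \<longrightarrow>
         (\<forall>x\<in>K \<inter> seg \<Gamma>. \<forall>x'\<in>K' \<inter> seg \<Gamma>'. chart S x = chart S' x' \<longrightarrow>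
            comp_nn \<Gamma>' (q' K') x' = comp_nn \<Gamma> (q K) x \<and>
            comp_nn \<Gamma>' (p' K') x' = - comp_nn \<Gamma> (p K) x * cos \<theta> + shear \<Gamma> (q K) x * sin \<theta> \<and>
            comp_nt \<Gamma>' (p' K') x' = comp_nt \<Gamma> (p K) x \<and>
            shear \<Gamma>' (q' K') x' = comp_nn \<Gamma> (p K) x * sin \<theta> + shear \<Gamma> (q K) x * cos \<theta>)) \<and>
      (\<forall>(x, x')\<in>{(fst \<Gamma>, snd \<Gamma>'), (snd \<Gamma>, fst \<Gamma>')}.
         corner_jump S T q x * sin \<theta> = 0 \<and>
         corner_jump S' T' q' x' - corner_jump S T q x * cos \<theta> = 0))"

definition fe_stress ::
  "plate \<Rightarrow> plate \<Rightarrow> real \<Rightarrow> pt set set \<Rightarrow> pt set set \<Rightarrow> int \<Rightarrow> int \<Rightarrow> stress set" where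
  "fe_stress S S' \<theta> T T' k1 k2 = {((\<tau>, \<kappa>), (\<tau>', \<kappa>')). ((\<tau>, \<kappa>), (\<tau>', \<kappa>')) \<in> Hs_space S S' \<and>
     (\<exists>p q p' q'. piecewise_sym_poly T k1 \<tau> p \<and> piecewise_sym_poly T k2 \<kappa> q \<and>
        piecewise_sym_poly T' k1 \<tau>' p' \<and> piecewise_sym_poly T' k2 \<kappa>' q' \<and>
        free_conditions S T p q \<and> free_conditions S' T' p' q' \<and>
        junction_conditions S S' \<theta> T T' p q p' q')}"

definition conforming_stress_space ::
  "plate \<Rightarrow> plate \<Rightarrow> real \<Rightarrow> pt set set \<Rightarrow> pt set set \<Rightarrow> int \<Rightarrow> int \<Rightarrow> stress set \<Rightarrow> bool" where
  "conforming_stress_space S S' \<theta> T T' k1 k2 Sig_h \<longleftrightarrow>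
     linear_space Sig_h \<and> Sig_h \<subseteq> Sigma_space S S' \<theta> \<and> Sig_h \<subseteq> fe_stress S S' \<theta> T T' k1 k2"

definition Vh_space ::
  "plate \<Rightarrow> plate \<Rightarrow> pt set set \<Rightarrow> pt set set \<Rightarrow> int \<Rightarrow> int \<Rightarrow> displacement set" where
  "Vh_space S S' T T' k3 k4 = {((v, v3), (v', v3')). ((v, v3), (v', v3')) \<in> V_space S S' \<and>
     (\<exists>p. piecewise_poly T k3 v p) \<and> (\<exists>p. piecewise_poly T k4 v3 p) \<and>
     (\<exists>p. piecewise_poly T' k3 v' p) \<and> (\<exists>p. piecewise_poly T' k4 v3' p)}"

definition L2_projection :: "plate \<Rightarrow> plate \<Rightarrow> displacement set \<Rightarrow> displacement \<Rightarrow> displacement \<Rightarrow> bool" where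
  "L2_projection S S' Vh f g \<longleftrightarrow>
     g \<in> Vh \<and> (\<forall>\<psi>\<in>Vh. field_inner S S' f \<psi> = field_inner S S' g \<psi>)"

definition discrete_solution ::
  "plate \<Rightarrow> plate \<Rightarrow> real \<Rightarrow> real \<Rightarrow> real \<Rightarrow> stress set \<Rightarrow> displacement set \<Rightarrow>
   displacement \<Rightarrow> stress \<Rightarrow> displacement \<Rightarrow> bool" where
  "discrete_solution S S' E e \<nu> Sig_h Vh F \<Phi> \<phi> \<longleftrightarrow>
     \<Phi> \<in> Sig_h \<and> \<phi> \<in> Vh \<and>
     (\<forall>\<Psi>\<in>Sig_h. compliance_form S S' E e \<nu> \<Phi> \<Psi> + field_inner S S' (B_star S S' \<Psi>) \<phi> = 0) \<and>
     (\<forall>\<psi>\<in>Vh. field_inner S S' (B_star S S' \<Phi>) \<psi> = - field_inner S S' F \<psi>)"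

end

theory Submission
  imports Defs "HOL-Library.Function_Algebras" "HOL-Computational_Algebra.Polynomial"
begin

text \<open>
  The discrete problem is a saddle point problem between two spaces that are finite-dimensional
  modulo equality almost everywhere, with the positive definite compliance form on the stresses and
  the coupling form \<open>\<beta> \<Phi> \<psi> = (B\<^sup>* \<Phi>, \<psi>)\<close>. Given \<open>\<psi>\<close> in \<open>V\<^sub>h\<close>, (A1) yields \<open>\<Phi>\<close> with \<open>B\<^sup>* \<Phi> = \<psi>\<close>, and by
  (A2) \<open>B\<^sup>* \<Pi>\<^sub>h \<Phi>\<close> is the projection of \<open>\<psi>\<close>, that is \<open>\<psi>\<close> itself. So \<open>B\<^sup>*\<close> maps the discrete stresses onto
  \<open>V\<^sub>h\<close>, which in finite dimension is the inf-sup condition; the inclusion \<open>B\<^sup>* \<Sigma>\<^sub>h \<subseteq> V\<^sub>h\<close> gives the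
  bound on \<open>B\<^sup>* \<Phi>\<^sub>h\<close>. Since weak divergences are chosen arbitrarily in their class, the linearity of
  \<open>B\<^sup>*\<close> holds only almost everywhere and rests on the fundamental lemma of the calculus of variations.
\<close>

section \<open>Finite-dimensional saddle point problems\<close>

text \<open>Fields are functions, and the quotient by functions vanishing almost everywhere is never
  formed. The abstract part therefore works with forms that are only positive semidefinite on a
  subspace, and vectors of length zero take over the part of 0: expansions hold up to such vectors,
  and a functional can be expanded only if it vanishes on them. Since values on null sets are free,
  \<open>Vh\<close> is infinite-dimensional as a space of functions; finite dimension is expressed
  instead by a bound on the cardinality of orthonormal sets. The stability constant is the sum of
  the lengths of liftings of an orthonormal basis of \<open>Vh\<close>, combined with its square and
  with the coercivity constant of the material law; it thus depends on the discrete spaces.\<close>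

locale semi_inner =
  fixes U :: "'a::real_vector set" and g :: "'a \<Rightarrow> 'a \<Rightarrow> real"
  assumes subspace: "subspace U"
    and commute: "x \<in> U \<Longrightarrow> y \<in> U \<Longrightarrow> g x y = g y x"
    and add_left: "x \<in> U \<Longrightarrow> y \<in> U \<Longrightarrow> z \<in> U \<Longrightarrow> g (x + y) z = g x z + g y z"
    and scale_left: "x \<in> U \<Longrightarrow> z \<in> U \<Longrightarrow> g (r *\<^sub>R x) z = r * g x z"
    and nonneg: "x \<in> U \<Longrightarrow> 0 \<le> g x x"
begin

lemmas mem = subspace_0[OF subspace] subspace_add[OF subspace] subspace_scale[OF subspace]
  subspace_diff[OF subspace] subspace_sum[OF subspace]

lemma add_right: "x \<in> U \<Longrightarrow> y \<in> U \<Longrightarrow> z \<in> U \<Longrightarrow> g z (x + y) = g z x + g z y"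
  using add_left commute mem by metis

lemma scale_right: "x \<in> U \<Longrightarrow> z \<in> U \<Longrightarrow> g z (r *\<^sub>R x) = r * g z x"
  using scale_left commute mem by metis

lemma diff_left: "x \<in> U \<Longrightarrow> y \<in> U \<Longrightarrow> z \<in> U \<Longrightarrow> g (x - y) z = g x z - g y z"
  using add_left[of x "(-1) *\<^sub>R y" z] scale_left[of y z "-1"] subspace_neg[OF subspace] by simp

lemma diff_right: "x \<in> U \<Longrightarrow> y \<in> U \<Longrightarrow> z \<in> U \<Longrightarrow> g z (x - y) = g z x - g z y"
  using diff_left commute mem by metis

lemma zero_left: "z \<in> U \<Longrightarrow> g 0 z = 0"
  using scale_left[of 0 z 0] mem by simp

lemma sum_left:
  "(\<And>i. i \<in> I \<Longrightarrow> f i \<in> U) \<Longrightarrow> z \<in> U \<Longrightarrow> g (\<Sum>i\<in>I. f i) z = (\<Sum>i\<in>I. g (f i) z)"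
  by (induction I rule: infinite_finite_induct) (auto simp: zero_left add_left mem)

lemma Cauchy_Schwarz:
  assumes "x \<in> U" "y \<in> U"
  shows "(g x y)\<^sup>2 \<le> g x x * g y y"
proof -
  have eq: "g (r *\<^sub>R x + s *\<^sub>R y) (r *\<^sub>R x + s *\<^sub>R y) = r\<^sup>2 * g x x + 2 * r * s * g x y + s\<^sup>2 * g y y" for r s
    using assms commute[of x y]
    by (simp add: add_left add_right scale_left scale_right mem algebra_simps power2_eq_square)
  have pos: "0 \<le> r\<^sup>2 * g x x + 2 * r * s * g x y + s\<^sup>2 * g y y" for r s
    unfolding eq[symmetric] using assms by (intro nonneg mem)
  show ?thesis
  proof (cases "g x x = 0")
    case True
    have "g x y = 0"
    proof (rule ccontr)
      assume ne: "g x y \<noteq> 0"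
      \<comment> \<open>For \<open>g x x = 0\<close> and \<open>s = 1\<close> the quadratic is
        affine in \<open>r\<close>; at this \<open>r\<close> its value is -1.\<close>
      show False using pos[of "- (g y y + 1) / (2 * g x y)" 1] True ne by (simp add: field_simps)
    qed
    then show ?thesis using True by simp
  next
    case False
    then have px: "g x x > 0" using nonneg[OF assms(1)] by simp
    \<comment> \<open>The minimiser in \<open>r\<close>, scaled by \<open>g x x\<close> to avoid a
      division.\<close>
    have "0 \<le> (g x y)\<^sup>2 * g x x - 2 * (g x y)\<^sup>2 * g x x + (g x x)\<^sup>2 * g y y"
      using pos[of "- g x y" "g x x"] by (simp add: power2_eq_square algebra_simps)
    then have "0 \<le> g x x * (g x x * g y y - (g x y)\<^sup>2)"
      by (simp add: power2_eq_square algebra_simps)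
    then show ?thesis using px by (simp add: zero_le_mult_iff)
  qed
qed

lemma Cauchy_Schwarz_abs: "x \<in> U \<Longrightarrow> y \<in> U \<Longrightarrow> \<bar>g x y\<bar> \<le> sqrt (g x x) * sqrt (g y y)"
  using Cauchy_Schwarz[of x y] by (metis real_sqrt_abs real_sqrt_le_iff real_sqrt_mult)

text \<open>By Cauchy-Schwarz a vector of length zero is orthogonal to everything. This is what
  allows such vectors to be treated like 0 although the form is degenerate.\<close>

lemma null_left: "x \<in> U \<Longrightarrow> y \<in> U \<Longrightarrow> g x x = 0 \<Longrightarrow> g x y = 0"
  using Cauchy_Schwarz[of x y] by simp

lemma semi_inner_subset: "subspace K \<Longrightarrow> K \<subseteq> U \<Longrightarrow> semi_inner K g"
  by unfold_locales (auto simp: commute add_left scale_left nonneg subset_iff)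

section \<open>Orthonormal sets and expansions modulo null vectors\<close>

definition orthonormal :: "'a set \<Rightarrow> bool" where
  "orthonormal Y \<longleftrightarrow> finite Y \<and> Y \<subseteq> U \<and> (\<forall>x\<in>Y. \<forall>y\<in>Y. g x y = (if x = y then 1 else 0))"

lemma orthonormal_coefficient:
  assumes "orthonormal Y" "x \<in> Y"
  shows "g (\<Sum>y\<in>Y. c y *\<^sub>R y) x = c x"
proof -
  have "g (\<Sum>y\<in>Y. c y *\<^sub>R y) x = (\<Sum>y\<in>Y. c y * g y x)"
    using assms by (subst sum_left) (auto simp: orthonormal_def mem subset_iff scale_left)
  also have "\<dots> = (\<Sum>y\<in>Y. if y = x then c y else 0)"
    using assms by (intro sum.cong) (auto simp: orthonormal_def)
  also have "\<dots> = c x"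
    using assms by (simp add: orthonormal_def)
  finally show ?thesis .
qed

lemma orthonormal_independent:
  assumes "orthonormal Y"
  shows "independent Y"
proof (rule independent_if_scalars_zero)
  show "finite Y" using assms by (simp add: orthonormal_def)
  fix c x assume "(\<Sum>x\<in>Y. c x *\<^sub>R x) = 0" "x \<in> Y"
  then show "c x = 0"
    using orthonormal_coefficient[OF assms \<open>x \<in> Y\<close>, of c] zero_left assms
    by (auto simp: orthonormal_def)
qed

text \<open>The remainder of the expansion is a vector of length zero and not necessarily 0: the
  span of finitely many functions cannot reach all their modifications on null sets.\<close>

definition orthonormal_basis :: "'a set \<Rightarrow> bool" where
  "orthonormal_basis Y \<longleftrightarrow> orthonormal Y \<and>
     (\<forall>x\<in>U. g (x - (\<Sum>y\<in>Y. g x y *\<^sub>R y)) (x - (\<Sum>y\<in>Y. g x y *\<^sub>R y)) = 0)"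

text \<open>An orthonormal set of largest cardinality is a basis: a remainder of positive length is
  orthogonal to the set, so it could be normalised and added.\<close>

lemma orthonormal_basis_exists:
  assumes bound: "\<And>Y. orthonormal Y \<Longrightarrow> card Y \<le> n"
  shows "\<exists>Y. orthonormal_basis Y"
proof -
  have "orthonormal {}" by (simp add: orthonormal_def)
  then obtain Y where Y: "orthonormal Y" and max: "\<And>Z. orthonormal Z \<Longrightarrow> card Z \<le> card Y"
    using ex_has_greatest_nat[of orthonormal "{}" card "Suc n"] bound by (metis le_imp_less_Suc)
  have YU: "Y \<subseteq> U" "finite Y" using Y by (auto simp: orthonormal_def)
  have "g r r = 0" if x: "x \<in> U" and r: "r = x - (\<Sum>y\<in>Y. g x y *\<^sub>R y)" for x r
  proof (rule ccontr)
    assume "g r r \<noteq> 0"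
    have rU: "r \<in> U" unfolding r using YU x by (intro mem) (auto simp: mem subset_iff)
    then have pos: "g r r > 0" using nonneg[of r] \<open>g r r \<noteq> 0\<close> by simp
    have sU: "(\<Sum>y\<in>Y. g x y *\<^sub>R y) \<in> U" using YU by (intro mem) (auto simp: mem subset_iff)
    have ry: "g r y = 0" if "y \<in> Y" for y
      using orthonormal_coefficient[OF Y that, of "g x"] that YU x sU
      by (auto simp: r diff_left subset_iff)
    define z where "z = (1 / sqrt (g r r)) *\<^sub>R r"
    have zU: "z \<in> U" by (simp add: z_def rU mem)
    have zz: "g z z = 1" using rU pos by (simp add: z_def scale_left scale_right mem)
    have zy: "g z y = 0" "g y z = 0" if "y \<in> Y" for y
      using ry[OF that] that YU rU zU commute[of y z] by (auto simp: z_def scale_left mem subset_iff)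
    have "z \<notin> Y" using zy(1)[of z] zz by auto
    have "orthonormal (insert z Y)"
      using Y zU zz zy \<open>z \<notin> Y\<close> by (auto simp: orthonormal_def)
    then show False using max[of "insert z Y"] YU \<open>z \<notin> Y\<close> by simp
  qed
  then show ?thesis using Y unfolding orthonormal_basis_def by blast
qed

text \<open>The remainder of the expansion of \<open>x\<close> has length zero, so \<open>l\<close>
  kills it and is determined by its values on the basis. This replaces the Riesz representation of
  \<open>l\<close>.\<close>

lemma functional_expansion:
  fixes l :: "'a \<Rightarrow> real"
  assumes Y: "orthonormal_basis Y"
    and add: "\<And>x y. x \<in> U \<Longrightarrow> y \<in> U \<Longrightarrow> l (x + y) = l x + l y"
    and scale: "\<And>r x. x \<in> U \<Longrightarrow> l (r *\<^sub>R x) = r * l x"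
    and null: "\<And>x. x \<in> U \<Longrightarrow> g x x = 0 \<Longrightarrow> l x = 0"
    and x: "x \<in> U"
  shows "l x = (\<Sum>y\<in>Y. g x y * l y)"
proof -
  have YU: "Y \<subseteq> U" using Y by (auto simp: orthonormal_def orthonormal_basis_def)
  \<comment> \<open>The value \<open>l 0 = 0\<close> of the empty sum comes from
    \<open>null\<close>, as 0 has length zero.\<close>
  have sum: "(\<Sum>y\<in>Z. g x y *\<^sub>R y) \<in> U \<and> l (\<Sum>y\<in>Z. g x y *\<^sub>R y) = (\<Sum>y\<in>Z. g x y * l y)" if "Z \<subseteq> U" for Z
    using that by (induction Z rule: infinite_finite_induct) (auto simp: add scale mem null zero_left)
  let ?s = "\<Sum>y\<in>Y. g x y *\<^sub>R y"
  have "l (x - ?s) = 0"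
    using Y x sum[OF YU] mem by (intro null) (auto simp: orthonormal_basis_def)
  moreover have "l x = l (x - ?s) + l ?s"
    using add[of "x - ?s" ?s] x sum[OF YU] mem by auto
  ultimately show ?thesis using sum[OF YU] by simp
qed

lemma coefficient_bound:
  assumes "orthonormal Y" "y \<in> Y" "x \<in> U"
  shows "\<bar>g x y\<bar> \<le> sqrt (g x x)"
  using Cauchy_Schwarz_abs[of x y] assms by (auto simp: orthonormal_def)

text \<open>
  Replacing each member of an orthonormal set by a null-equivalent element of the span of \<open>B\<close>
  keeps it orthonormal, hence independent.
\<close>

lemma orthonormal_card_le:
  assumes B: "finite B" "B \<subseteq> U"
    and approx: "\<And>x. x \<in> K \<Longrightarrow> \<exists>y\<in>span B. g (x - y) (x - y) = 0"
    and Y: "orthonormal Y" "Y \<subseteq> K"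
  shows "card Y \<le> card B"
proof -
  obtain f where f: "\<And>x. x \<in> K \<Longrightarrow> f x \<in> span B \<and> g (x - f x) (x - f x) = 0"
    using approx by metis
  have YU: "finite Y" "Y \<subseteq> U" using Y by (auto simp: orthonormal_def)
  have BU: "span B \<subseteq> U" using B subspace by (simp add: span_minimal)
  have fU: "f x \<in> U" if "x \<in> Y" for x using f[of x] that Y BU by auto
  have eq: "g (f x) (f y) = g x y" if xy: "x \<in> Y" "y \<in> Y" for x y
  proof -
    have U: "x \<in> U" "y \<in> U" "f x \<in> U" "f y \<in> U" using xy YU fU by auto
    have 0: "g (x - f x) (x - f x) = 0" "g (y - f y) (y - f y) = 0" using f xy Y by auto
    have 1: "g (x - f x) (f y) = 0" "g (y - f y) x = 0"
      by (rule null_left; use U mem 0 in simp)+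
    have "g (f x) (f y) = g x (f y)"
      using 1(1) xy fU YU by (auto simp: diff_left subset_iff)
    also have "\<dots> = g (f y) x" using xy fU YU commute by auto
    also have "\<dots> = g y x" using 1(2) xy fU YU by (auto simp: diff_left subset_iff)
    also have "\<dots> = g x y" using xy YU commute by auto
    finally show ?thesis .
  qed
  have inj: "inj_on f Y"
  proof (rule inj_onI)
    fix x y assume xy: "x \<in> Y" "y \<in> Y" "f x = f y"
    have "g x y = g y y" using eq[of x y] eq[of y y] xy by simp
    then show "x = y" using Y xy by (auto simp: orthonormal_def split: if_splits)
  qed
  have "orthonormal (f ` Y)"
    using Y fU eq inj YU unfolding orthonormal_def by (auto simp: inj_on_eq_iff)
  then have "independent (f ` Y)" by (rule orthonormal_independent)
  moreover have "f ` Y \<subseteq> span B" using f Y by auto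
  ultimately have "card (f ` Y) \<le> card B"
    using independent_span_bound[OF B(1)] by blast
  then show ?thesis using card_image[OF inj] by simp
qed

end

section \<open>Saddle point problems modulo null vectors\<close>

text \<open>\<open>onto\<close> says that every functional \<open>b y\<close> on \<open>Y\<close> is
  represented by the coupling form. Together with the dimension bounds it stands in for the inf-sup
  condition; \<open>m\<close> and \<open>n\<close> are mere upper bounds, which provide orthonormal
  bases.\<close>

locale saddle_point = X: semi_inner X a + Y: semi_inner Y b
  for X :: "'a::real_vector set" and a and Y :: "'b::real_vector set" and b +
  fixes \<beta> :: "'a \<Rightarrow> 'b \<Rightarrow> real" and m n :: nat
  assumes beta_add_left: "x \<in> X \<Longrightarrow> x' \<in> X \<Longrightarrow> y \<in> Y \<Longrightarrow> \<beta> (x + x') y = \<beta> x y + \<beta> x' y"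
    and beta_scale_left: "x \<in> X \<Longrightarrow> y \<in> Y \<Longrightarrow> \<beta> (r *\<^sub>R x) y = r * \<beta> x y"
    and beta_add_right: "x \<in> X \<Longrightarrow> y \<in> Y \<Longrightarrow> y' \<in> Y \<Longrightarrow> \<beta> x (y + y') = \<beta> x y + \<beta> x y'"
    and beta_scale_right: "x \<in> X \<Longrightarrow> y \<in> Y \<Longrightarrow> \<beta> x (r *\<^sub>R y) = r * \<beta> x y"
    and beta_null: "x \<in> X \<Longrightarrow> y \<in> Y \<Longrightarrow> b y y = 0 \<Longrightarrow> \<beta> x y = 0"
    and onto: "y \<in> Y \<Longrightarrow> \<exists>x\<in>X. \<forall>z\<in>Y. \<beta> x z = b y z"
    and X_dim: "X.orthonormal A \<Longrightarrow> card A \<le> m"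
    and Y_dim: "Y.orthonormal B \<Longrightarrow> card B \<le> n"
begin

definition kernel :: "'a set" where
  "kernel = {x \<in> X. \<forall>y\<in>Y. \<beta> x y = 0}"

lemma beta_zero_left: "y \<in> Y \<Longrightarrow> \<beta> 0 y = 0"
  using beta_scale_left[of 0 y 0] X.mem(1) by simp

lemma beta_sum_left:
  "(\<And>i. i \<in> I \<Longrightarrow> f i \<in> X) \<Longrightarrow> y \<in> Y \<Longrightarrow> \<beta> (\<Sum>i\<in>I. f i) y = (\<Sum>i\<in>I. \<beta> (f i) y)"
  by (induction I rule: infinite_finite_induct) (auto simp: beta_zero_left beta_add_left X.mem(5))

lemma beta_diff_left: "x \<in> X \<Longrightarrow> x' \<in> X \<Longrightarrow> y \<in> Y \<Longrightarrow> \<beta> (x - x') y = \<beta> x y - \<beta> x' y"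
  using beta_add_left[of x "(-1) *\<^sub>R x'" y] beta_scale_left[of x' y "-1"] subspace_neg[OF X.subspace] by simp

lemma subspace_kernel: "subspace kernel"
  unfolding subspace_def kernel_def
  by (auto simp: beta_zero_left beta_add_left beta_scale_left X.mem(1-3))

lemma kernel_subset: "kernel \<subseteq> X"
  by (auto simp: kernel_def)

sublocale K: semi_inner kernel a
  by (rule X.semi_inner_subset[OF subspace_kernel kernel_subset])

definition y_basis :: "'b set" where
  "y_basis = (SOME B. Y.orthonormal_basis B)"

text \<open>A right inverse of the constraint, chosen pointwise and hence possibly not linear.
  Linear combinations are therefore formed from the liftings of the members of
  \<open>y_basis\<close>.\<close>

definition lifting :: "'b \<Rightarrow> 'a" where
  "lifting y = (SOME x. x \<in> X \<and> (\<forall>z\<in>Y. \<beta> x z = b y z))"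

lemma y_basis: "Y.orthonormal_basis y_basis"
  unfolding y_basis_def using Y.orthonormal_basis_exists[of n] Y_dim by (metis someI_ex)

lemma y_basis': "Y.orthonormal y_basis" "finite y_basis" "y \<in> y_basis \<Longrightarrow> y \<in> Y"
  using y_basis by (auto simp: Y.orthonormal_basis_def Y.orthonormal_def)

lemma lifting: "y \<in> Y \<Longrightarrow> lifting y \<in> X" "y \<in> Y \<Longrightarrow> z \<in> Y \<Longrightarrow> \<beta> (lifting y) z = b y z"
  unfolding lifting_def using someI_ex[of "\<lambda>x. x \<in> X \<and> (\<forall>z\<in>Y. \<beta> x z = b y z)"] onto[of y] by auto

lemma lifted_mem: "(\<Sum>y\<in>y_basis. c y *\<^sub>R lifting y) \<in> X"
  using lifting y_basis' by (auto intro!: X.mem(3,5))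

lemma beta_lifted: "z \<in> Y \<Longrightarrow> \<beta> (\<Sum>y\<in>y_basis. c y *\<^sub>R lifting y) z = (\<Sum>y\<in>y_basis. c y * b y z)"
  using lifting y_basis' by (subst beta_sum_left) (auto simp: beta_scale_left X.mem(3))

lemma y_expansion:
  assumes "\<And>x y. x \<in> Y \<Longrightarrow> y \<in> Y \<Longrightarrow> l (x + y) = l x + l y"
    and "\<And>r x. x \<in> Y \<Longrightarrow> l (r *\<^sub>R x) = r * l x"
    and "\<And>x. x \<in> Y \<Longrightarrow> b x x = 0 \<Longrightarrow> l x = 0"
    and "z \<in> Y"
  shows "l z = (\<Sum>y\<in>y_basis. l y * b y z)"
proof -
  have "l z = (\<Sum>y\<in>y_basis. b z y * l y)"
    using assms by (intro Y.functional_expansion[where l = l, OF y_basis]) simp_all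
  also have "\<dots> = (\<Sum>y\<in>y_basis. l y * b y z)"
    using y_basis' Y.commute[OF _ assms(4)] by (intro sum.cong) simp_all
  finally show ?thesis .
qed

text \<open>Expanding the functional \<open>\<beta> x\<close> in \<open>y_basis\<close> and lifting
  the basis vectors produces an element with the same constraint values as \<open>x\<close>. So
  \<open>X\<close> is the sum of the kernel and the span of finitely many liftings, and the first
  equation has to be tested only on these two parts.\<close>

lemma minus_lifted_in_kernel:
  assumes "x \<in> X"
  shows "x - (\<Sum>y\<in>y_basis. \<beta> x y *\<^sub>R lifting y) \<in> kernel"
  unfolding kernel_def
proof (intro CollectI conjI ballI)
  fix z assume z: "z \<in> Y"
  have "\<beta> x z = (\<Sum>y\<in>y_basis. \<beta> x y * b y z)"
    using assms z by (intro y_expansion[where l = "\<beta> x"]) (auto simp: beta_add_right beta_scale_right beta_null)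
  then show "\<beta> (x - (\<Sum>y\<in>y_basis. \<beta> x y *\<^sub>R lifting y)) z = 0"
    using assms z lifted_mem by (simp add: beta_diff_left beta_lifted)
qed (rule X.mem(4)[OF assms lifted_mem])

text \<open>Subtracting from a lifting its \<open>a\<close>-projection onto the kernel leaves the
  constraint values unchanged. The kernel has an orthonormal basis because its orthonormal sets are
  orthonormal in \<open>X\<close> as well.\<close>

lemma kernel_orthogonal_lift:
  assumes y: "y \<in> Y"
  shows "\<exists>x\<in>X. (\<forall>z\<in>Y. \<beta> x z = b y z) \<and> (\<forall>k\<in>kernel. a x k = 0)"
proof -
  have "K.orthonormal A \<Longrightarrow> card A \<le> m" for A
    using X_dim[of A] kernel_subset by (auto simp: K.orthonormal_def X.orthonormal_def)
  then obtain A where A: "K.orthonormal_basis A"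
    using K.orthonormal_basis_exists by metis
  have AK: "A \<subseteq> kernel" using A by (auto simp: K.orthonormal_basis_def K.orthonormal_def)
  let ?x = "lifting y" let ?s = "\<Sum>k\<in>A. a ?x k *\<^sub>R k"
  have xX: "?x \<in> X" using lifting y by blast
  have sK: "?s \<in> kernel" using AK by (auto intro!: K.mem(3,5))
  have "a (?x - ?s) k = 0" if k: "k \<in> kernel" for k
  proof -
    have kX: "k \<in> X" "\<And>z. z \<in> A \<Longrightarrow> z \<in> X" using k AK kernel_subset by auto
    have "a ?x k = (\<Sum>z\<in>A. a k z * a ?x z)"
    proof (rule K.functional_expansion[where l = "a ?x", OF A])
      fix z assume "z \<in> kernel" "a z z = 0"
      then show "a ?x z = 0"
        using xX kernel_subset X.null_left[of z ?x] X.commute[of z ?x] by auto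
    qed (use xX kernel_subset k in \<open>auto simp: X.add_right X.scale_right subset_iff\<close>)
    also have "\<dots> = (\<Sum>z\<in>A. a ?x z * a z k)"
      using kX by (intro sum.cong) (auto simp: X.commute)
    also have "\<dots> = a ?s k"
      using kX by (subst X.sum_left) (auto simp: X.scale_left X.mem(3))
    finally show ?thesis using xX sK kX kernel_subset by (auto simp: X.diff_left)
  qed
  moreover have "\<beta> (?x - ?s) z = b y z" if "z \<in> Y" for z
    using that xX sK lifting y by (auto simp: beta_diff_left kernel_def)
  moreover have "?x - ?s \<in> X" using xX sK kernel_subset by (auto intro: X.mem(4))
  ultimately show ?thesis by blast
qed

text \<open>Liftings orthogonal to the kernel, with the coefficients of \<open>l\<close>, give an
  \<open>x\<close> that satisfies the constraint and the first equation on the kernel. The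
  multiplier \<open>y\<close> is then free to satisfy the first equation on the liftings.\<close>

theorem solution_exists:
  fixes l :: "'b \<Rightarrow> real"
  assumes add: "\<And>x y. x \<in> Y \<Longrightarrow> y \<in> Y \<Longrightarrow> l (x + y) = l x + l y"
    and scale: "\<And>r x. x \<in> Y \<Longrightarrow> l (r *\<^sub>R x) = r * l x"
    and null: "\<And>x. x \<in> Y \<Longrightarrow> b x x = 0 \<Longrightarrow> l x = 0"
  shows "\<exists>x\<in>X. \<exists>y\<in>Y. (\<forall>z\<in>X. a x z + \<beta> z y = 0) \<and> (\<forall>z\<in>Y. \<beta> x z = l z)"
proof -
  have "\<forall>y\<in>y_basis. \<exists>x\<in>X. (\<forall>z\<in>Y. \<beta> x z = b y z) \<and> (\<forall>k\<in>kernel. a x k = 0)"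
    using kernel_orthogonal_lift y_basis' by blast
  then obtain f where f: "\<And>y. y \<in> y_basis \<Longrightarrow> f y \<in> X"
    "\<And>y z. y \<in> y_basis \<Longrightarrow> z \<in> Y \<Longrightarrow> \<beta> (f y) z = b y z"
    "\<And>y k. y \<in> y_basis \<Longrightarrow> k \<in> kernel \<Longrightarrow> a (f y) k = 0"
    by metis
  define x where "x = (\<Sum>y\<in>y_basis. l y *\<^sub>R f y)"
  \<comment> \<open>Testing the first equation with \<open>lifting w\<close> reads
    \<open>a x (lifting w) + b w y = 0\<close>, which forces these coefficients.\<close>
  define y where "y = (\<Sum>y\<in>y_basis. (- a x (lifting y)) *\<^sub>R y)"
  have xX: "x \<in> X" unfolding x_def using f by (auto intro!: X.mem(3,5))
  have yY: "y \<in> Y" unfolding y_def using y_basis' by (intro Y.mem(3,5))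
  have "\<beta> x z = l z" if z: "z \<in> Y" for z
  proof -
    have "\<beta> x z = (\<Sum>y\<in>y_basis. l y * b y z)"
      unfolding x_def using f z by (subst beta_sum_left) (auto simp: beta_scale_left X.mem(3))
    then show ?thesis using y_expansion[of l z] assms z by simp
  qed
  moreover have "a x z + \<beta> z y = 0" if z: "z \<in> X" for z
  proof -
    \<comment> \<open>\<open>z\<close> splits into a kernel element, to which \<open>x\<close> is
      orthogonal, and the lifted part \<open>?s\<close>.\<close>
    let ?s = "\<Sum>y\<in>y_basis. \<beta> z y *\<^sub>R lifting y"
    have k: "z - ?s \<in> kernel" by (rule minus_lifted_in_kernel[OF z])
    have "a x (z - ?s) = 0"
      unfolding x_def using f k kernel_subset
      by (subst X.sum_left) (auto simp: X.mem(3) X.scale_left)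
    then have "a x z = a x ?s" using xX z lifted_mem by (simp add: X.diff_right)
    also have "\<dots> = a ?s x" using xX lifted_mem by (rule X.commute)
    also have "\<dots> = (\<Sum>y\<in>y_basis. \<beta> z y * a (lifting y) x)"
      using xX lifting y_basis' by (subst X.sum_left) (auto simp: X.mem(3) X.scale_left)
    also have "\<dots> = (\<Sum>y\<in>y_basis. \<beta> z y * a x (lifting y))"
      using xX lifting y_basis' by (intro sum.cong) (auto simp: X.commute)
    finally have 1: "a x z = (\<Sum>y\<in>y_basis. \<beta> z y * a x (lifting y))" .
    have "\<beta> z y = (\<Sum>w\<in>y_basis. \<beta> z w * b w y)"
      using z yY by (intro y_expansion[where l = "\<beta> z"]) (auto simp: beta_null beta_add_right beta_scale_right)
    also have "\<dots> = (\<Sum>w\<in>y_basis. \<beta> z w * b y w)"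
      using y_basis' yY Y.commute by (intro sum.cong) auto
    also have "\<dots> = (\<Sum>w\<in>y_basis. \<beta> z w * (- a x (lifting w)))"
      unfolding y_def by (intro sum.cong refl) (simp only: Y.orthonormal_coefficient[OF y_basis'(1)])
    finally show ?thesis using 1 by (simp add: sum_negf)
  qed
  ultimately show ?thesis using xX yY by blast
qed

text \<open>Cauchy-Schwarz for each lifting. The sum of their lengths acts as the reciprocal of an
  inf-sup constant in both estimates of \<open>stability\<close>.\<close>

lemma sqrt_form_lifted_le:
  assumes "\<And>y. y \<in> y_basis \<Longrightarrow> \<bar>c y\<bar> \<le> M" "x \<in> X"
  shows "\<bar>a x (\<Sum>y\<in>y_basis. c y *\<^sub>R lifting y)\<bar>
    \<le> sqrt (a x x) * (M * (\<Sum>y\<in>y_basis. sqrt (a (lifting y) (lifting y))))"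
proof -
  let ?s = "\<Sum>y\<in>y_basis. c y *\<^sub>R lifting y"
  have "\<bar>a x ?s\<bar> = \<bar>a ?s x\<bar>" using assms lifted_mem by (simp add: X.commute)
  also have "\<dots> = \<bar>\<Sum>y\<in>y_basis. c y * a (lifting y) x\<bar>"
    using assms lifting y_basis' by (subst X.sum_left) (auto simp: X.mem(3) X.scale_left)
  also have "\<dots> \<le> (\<Sum>y\<in>y_basis. \<bar>c y\<bar> * \<bar>a (lifting y) x\<bar>)"
    by (rule order_trans[OF sum_abs]) (simp add: abs_mult)
  also have "\<dots> \<le> (\<Sum>y\<in>y_basis. M * (sqrt (a (lifting y) (lifting y)) * sqrt (a x x)))"
  proof (rule sum_mono)
    fix y assume y: "y \<in> y_basis"
    then have "\<bar>a (lifting y) x\<bar> \<le> sqrt (a (lifting y) (lifting y)) * sqrt (a x x)"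
      using X.Cauchy_Schwarz_abs lifting y_basis' assms by blast
    then show "\<bar>c y\<bar> * \<bar>a (lifting y) x\<bar> \<le> M * (sqrt (a (lifting y) (lifting y)) * sqrt (a x x))"
      using assms(1)[OF y] by (intro mult_mono) auto
  qed
  also have "\<dots> = sqrt (a x x) * (M * (\<Sum>y\<in>y_basis. sqrt (a (lifting y) (lifting y))))"
    by (simp add: sum_distrib_left sum_distrib_right mult_ac)
  finally show ?thesis .
qed

text \<open>Testing the first equation with the kernel part of \<open>x\<close> removes the
  multiplier and leaves \<open>a x x = a x ?s\<close> for a lifted sum \<open>?s\<close>; testing
  with the lifted expansion of \<open>y\<close> gives \<open>b y y = - a x ?t\<close>. Both
  right-hand sides are bounded by \<open>sqrt_form_lifted_le\<close>. The number \<open>M\<close> is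
  any bound on the constraint data in the dual norm.\<close>

theorem stability:
  "\<exists>c\<ge>0. \<forall>x\<in>X. \<forall>y\<in>Y. \<forall>M. (\<forall>z\<in>X. a x z + \<beta> z y = 0) \<and> (\<forall>z\<in>Y. \<bar>\<beta> x z\<bar> \<le> M * sqrt (b z z)) \<longrightarrow>
     sqrt (a x x) \<le> c * M \<and> sqrt (b y y) \<le> c * M"
proof -
  define L where "L = (\<Sum>y\<in>y_basis. sqrt (a (lifting y) (lifting y)))"
  have L0: "L \<ge> 0" unfolding L_def using X.nonneg lifting y_basis' by (intro sum_nonneg) auto
  \<comment> \<open>Cancels \<open>p\<close> without asking for its sign: a nonpositive
    \<open>p\<close> is below \<open>q\<close> anyway.\<close>
  have le: "p \<le> q" if "p * p \<le> p * q" "0 \<le> q" for p q :: real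
    using that by (metis linorder_not_le mult_less_cancel_left_pos order_le_less_trans)
  have main: "sqrt (a x x) \<le> M * L \<and> sqrt (b y y) \<le> sqrt (a x x) * L"
    if xX: "x \<in> X" and yY: "y \<in> Y" and 1: "\<And>z. z \<in> X \<Longrightarrow> a x z + \<beta> z y = 0"
      and 2: "\<And>z. z \<in> Y \<Longrightarrow> \<bar>\<beta> x z\<bar> \<le> M * sqrt (b z z)" for x y M
  proof
    let ?s = "\<Sum>y\<in>y_basis. \<beta> x y *\<^sub>R lifting y"
    have k: "x - ?s \<in> kernel" by (rule minus_lifted_in_kernel[OF xX])
    then have "a x (x - ?s) = 0" using 1[of "x - ?s"] yY by (auto simp: kernel_def)
    then have eq: "a x x = a x ?s" using xX lifted_mem by (simp add: X.diff_right)
    have M: "\<bar>\<beta> x w\<bar> \<le> M" if "w \<in> y_basis" for w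
      using 2[of w] y_basis' that by (auto simp: Y.orthonormal_def)
    have "sqrt (a x x) * sqrt (a x x) \<le> sqrt (a x x) * (M * L)"
      using sqrt_form_lifted_le[of "\<beta> x" M x, OF M xX] eq X.nonneg[OF xX] by (simp add: L_def)
    \<comment> \<open>The sign of \<open>M\<close> is not assumed. A basis vector forces
      \<open>M\<close> to be nonnegative, and without basis vectors \<open>L = 0\<close>.\<close>
    moreover have "0 \<le> M * L"
    proof (cases "y_basis = {}")
      case True then show ?thesis by (simp add: L_def)
    next
      case False
      then obtain w where "w \<in> y_basis" by auto
      then have "0 \<le> M" using M[of w] by linarith
      then show ?thesis using L0 by simp
    qed
    ultimately show "sqrt (a x x) \<le> M * L" by (rule le)
    let ?t = "\<Sum>w\<in>y_basis. b y w *\<^sub>R lifting w"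
    have null: "b y w = 0" if "w \<in> Y" "b w w = 0" for w
      using Y.null_left[OF that(1) yY that(2)] Y.commute[OF yY that(1)] by simp
    have "\<beta> ?t y = (\<Sum>w\<in>y_basis. b y w * b w y)" by (rule beta_lifted[OF yY])
    also have "\<dots> = b y y"
      using null
      by (intro y_expansion[where l = "b y", symmetric]) (simp_all add: yY Y.add_right Y.scale_right)
    finally have "b y y \<le> \<bar>a x ?t\<bar>" using 1[OF lifted_mem, of "b y"] by simp
    also have "\<dots> \<le> sqrt (a x x) * (sqrt (b y y) * L)"
      unfolding L_def using Y.coefficient_bound y_basis' yY xX by (intro sqrt_form_lifted_le) auto
    finally have "sqrt (b y y) * sqrt (b y y) \<le> sqrt (b y y) * (sqrt (a x x) * L)"
      using Y.nonneg[OF yY] by (simp add: mult_ac)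
    then show "sqrt (b y y) \<le> sqrt (a x x) * L"
      by (rule le) (use L0 X.nonneg[OF xX] in simp)
  qed
  show ?thesis
  \<comment> \<open>\<open>L\<close> bounds \<open>x\<close>, and \<open>L * L\<close> bounds
    \<open>y\<close>, whose estimate passes through that of \<open>x\<close>.\<close>
  proof (intro exI[of _ "L + L * L"] conjI ballI allI impI)
    fix x y M
    assume xy: "x \<in> X" "y \<in> Y"
      and h: "(\<forall>z\<in>X. a x z + \<beta> z y = 0) \<and> (\<forall>z\<in>Y. \<bar>\<beta> x z\<bar> \<le> M * sqrt (b z z))"
    have m: "sqrt (a x x) \<le> M * L" "sqrt (b y y) \<le> sqrt (a x x) * L"
      using main[OF xy] h by auto
    then have "sqrt (b y y) \<le> M * L * L" using L0 by (meson mult_right_mono order_trans)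
    moreover have "0 \<le> M * L" using m(1) X.nonneg[OF xy(1)] by (meson order_trans real_sqrt_ge_zero)
    moreover have "0 \<le> M * L * L" using calculation(2) L0 by simp
    ultimately show "sqrt (a x x) \<le> (L + L * L) * M" "sqrt (b y y) \<le> (L + L * L) * M"
      using m(1) by (auto simp: algebra_simps)
  qed (use L0 in simp)
qed

end


section \<open>Square integrable fields\<close>

text \<open>Scalar multiplication on functions, next to the pointwise addition of
  \<open>Function_Algebras\<close>, turns fields, which are nested pairs of functions, into elements
  of a \<open>real_vector\<close> type, so that \<open>subspace\<close>, \<open>span\<close> and
  \<open>independent\<close> apply to them.\<close>

instantiation "fun" :: (type, real_vector) real_vector
begin

definition scaleR_fun :: "real \<Rightarrow> ('a \<Rightarrow> 'b) \<Rightarrow> 'a \<Rightarrow> 'b" where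
  "scaleR_fun r f = (\<lambda>x. r *\<^sub>R f x)"

instance
  by standard (auto simp: scaleR_fun_def fun_eq_iff scaleR_add_right scaleR_add_left)

end

lemma scaleR_fun_apply [simp]: "(r *\<^sub>R f) x = r *\<^sub>R f x"
  by (simp add: scaleR_fun_def)

lemma lincomb_eq: "lincomb r \<Phi> s \<Psi> = r *\<^sub>R \<Phi> + s *\<^sub>R \<Psi>"
  by (simp add: lincomb_def fun_eq_iff prod_eq_iff split: prod.split)

lemma zero_field_eq: "zero_field = 0"
  by (simp add: zero_field_def prod_eq_iff fun_eq_iff)

lemma linear_space_eq: "linear_space U \<longleftrightarrow> subspace U"
proof
  assume U: "linear_space U"
  show "subspace U"
    unfolding subspace_def
  proof (intro conjI ballI allI)
    fix x y r assume "x \<in> U" "y \<in> U"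
    then have l: "r *\<^sub>R x + s *\<^sub>R y \<in> U" for r s
      using U by (auto simp: linear_space_def lincomb_eq)
    show "x + y \<in> U" "r *\<^sub>R x \<in> U" using l[of 1 1] l[of r 0] by simp_all
  qed (use U in \<open>simp add: linear_space_def zero_field_eq\<close>)
next
  assume "subspace U"
  then show "linear_space U"
    by (auto simp: linear_space_def lincomb_eq zero_field_eq subspace_0 intro!: subspace_add subspace_scale)
qed


text \<open>The orthogonal direct sum. Nested twice it yields the forms on fields, so that
  semidefiniteness and finite dimension have to be checked for single components only.\<close>

definition sum_form :: "('a \<Rightarrow> 'a \<Rightarrow> real) \<Rightarrow> ('b \<Rightarrow> 'b \<Rightarrow> real) \<Rightarrow> 'a \<times> 'b \<Rightarrow> 'a \<times> 'b \<Rightarrow> real" where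
  "sum_form g h x y = g (fst x) (fst y) + h (snd x) (snd y)"

lemma semi_inner_sum_form:
  assumes "semi_inner U g" "semi_inner V h"
  shows "semi_inner (U \<times> V) (sum_form g h)"
proof -
  interpret U: semi_inner U g by fact
  interpret V: semi_inner V h by fact
  show ?thesis
    by unfold_locales
      (auto simp: sum_form_def subspace_Times U.subspace V.subspace U.add_left V.add_left
        U.scale_left V.scale_left U.nonneg V.nonneg distrib_left U.commute V.commute)
qed

text \<open>Finite dimension of \<open>K\<close> modulo vectors of length zero. The spanning set is
  taken in \<open>U\<close> and may leave \<open>K\<close>, so the property passes to all subsets of
  \<open>K\<close>.\<close>

definition finitely_spanned :: "'a::real_vector set \<Rightarrow> ('a \<Rightarrow> 'a \<Rightarrow> real) \<Rightarrow> 'a set \<Rightarrow> bool" where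
  "finitely_spanned U g K \<longleftrightarrow>
     (\<exists>B. finite B \<and> B \<subseteq> U \<and> (\<forall>x\<in>K. \<exists>y\<in>span B. g (x - y) (x - y) = 0))"

lemma finitely_spanned_Times:
  assumes U: "finitely_spanned U g K" "0 \<in> U" and V: "finitely_spanned V h L" "0 \<in> V"
  shows "finitely_spanned (U \<times> V) (sum_form g h) (K \<times> L)"
proof -
  obtain B where B: "finite B" "B \<subseteq> U" "\<And>x. x \<in> K \<Longrightarrow> \<exists>y\<in>span B. g (x - y) (x - y) = 0"
    using U unfolding finitely_spanned_def by metis
  obtain C where C: "finite C" "C \<subseteq> V" "\<And>x. x \<in> L \<Longrightarrow> \<exists>y\<in>span C. h (x - y) (x - y) = 0"
    using V unfolding finitely_spanned_def by metis
  let ?i = "\<lambda>x. (x, 0)" and ?j = "\<lambda>y. (0, y)"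
  have lin: "linear ?i" "linear ?j" by (auto intro!: linearI)
  let ?B = "?i ` B \<union> ?j ` C"
  show ?thesis
    unfolding finitely_spanned_def
  proof (intro exI[of _ ?B] conjI ballI)
    fix z assume "z \<in> K \<times> L"
    then obtain x y where z: "z = (x, y)" "x \<in> K" "y \<in> L" by auto
    obtain x' y' where x': "x' \<in> span B" "g (x - x') (x - x') = 0"
      and y': "y' \<in> span C" "h (y - y') (y - y') = 0"
      using B(3) C(3) z by blast
    have "(x', 0) \<in> span ?B" "(0, y') \<in> span ?B"
      using x'(1) y'(1) span_mono[of "?i ` B" ?B] span_mono[of "?j ` C" ?B]
      by (auto simp: linear_span_image[OF lin(1)] linear_span_image[OF lin(2)])
    then have "(x', 0) + (0, y') \<in> span ?B" by (rule span_add)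
    then show "\<exists>w\<in>span ?B. sum_form g h (z - w) (z - w) = 0"
      using x' y' z by (intro bexI[of _ "(x', y')"]) (auto simp: sum_form_def)
  qed (use B C U V in auto)
qed


section \<open>Square integrable functions\<close>

lemma L2_D:
  assumes "f \<in> L2 D"
  shows "f \<in> borel_measurable (lebesgue_on D)" "integrable (lebesgue_on D) (\<lambda>x. (norm (f x))\<^sup>2)"
  using assms by (auto simp: L2_def)

lemma L2_boundI:
  fixes f :: "'a::euclidean_space \<Rightarrow> 'b::euclidean_space" and g :: "'a \<Rightarrow> real"
  assumes "f \<in> borel_measurable (lebesgue_on D)" "integrable (lebesgue_on D) g"
    and "\<And>x. x \<in> D \<Longrightarrow> (norm (f x))\<^sup>2 \<le> g x"
  shows "f \<in> L2 D"
proof -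
  have "integrable (lebesgue_on D) (\<lambda>x. (norm (f x))\<^sup>2)"
    using assms by (intro Bochner_Integration.integrable_bound[OF assms(2)])
      (auto intro!: AE_I2 order_trans[OF assms(3)])
  then show ?thesis using assms by (simp add: L2_def)
qed

lemma subspace_L2: "subspace (L2 D :: ('a::euclidean_space \<Rightarrow> 'b::euclidean_space) set)"
proof -
  have "f + g \<in> L2 D" if "f \<in> L2 D" "g \<in> L2 D" for f g :: "'a \<Rightarrow> 'b"
  proof (rule L2_boundI)
    show "f + g \<in> borel_measurable (lebesgue_on D)"
      using L2_D(1)[OF that(1)] L2_D(1)[OF that(2)] unfolding plus_fun_def by measurable
    show "integrable (lebesgue_on D) (\<lambda>x. 2 * (norm (f x))\<^sup>2 + 2 * (norm (g x))\<^sup>2)"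
      using L2_D(2)[OF that(1)] L2_D(2)[OF that(2)] by simp
    fix x
    have "(norm (f x + g x))\<^sup>2 \<le> (norm (f x) + norm (g x))\<^sup>2"
      by (intro power_mono norm_triangle_ineq) auto
    also have "\<dots> \<le> 2 * (norm (f x))\<^sup>2 + 2 * (norm (g x))\<^sup>2"
      using zero_le_power2[of "norm (f x) - norm (g x)"] by (simp add: power2_eq_square algebra_simps)
    finally show "(norm ((f + g) x))\<^sup>2 \<le> 2 * (norm (f x))\<^sup>2 + 2 * (norm (g x))\<^sup>2" by simp
  qed
  moreover have "r *\<^sub>R f \<in> L2 D" if "f \<in> L2 D" for r and f :: "'a \<Rightarrow> 'b"
    using that by (auto simp: L2_def scaleR_fun_def power_mult_distrib)
  moreover have "0 \<in> (L2 D :: ('a \<Rightarrow> 'b) set)"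
    by (simp add: L2_def zero_fun_def)
  ultimately show ?thesis by (simp add: subspace_def)
qed

lemma L2_inner_integrable:
  assumes "f \<in> L2 D" "g \<in> L2 D"
  shows "integrable (lebesgue_on D) (\<lambda>x. f x \<bullet> g x)"
proof (rule Bochner_Integration.integrable_bound)
  show "integrable (lebesgue_on D) (\<lambda>x. (norm (f x))\<^sup>2 + (norm (g x))\<^sup>2)"
    using L2_D(2)[OF assms(1)] L2_D(2)[OF assms(2)] by simp
  show "(\<lambda>x. f x \<bullet> g x) \<in> borel_measurable (lebesgue_on D)"
    using assms by (intro borel_measurable_inner L2_D)
  have "norm (f x \<bullet> g x) \<le> norm ((norm (f x))\<^sup>2 + (norm (g x))\<^sup>2)" for x
  proof -
    have "norm (f x \<bullet> g x) \<le> norm (f x) * norm (g x)" by (simp add: Cauchy_Schwarz_ineq2)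
    also have "\<dots> \<le> (norm (f x))\<^sup>2 + (norm (g x))\<^sup>2"
      using zero_le_power2[of "norm (f x) - norm (g x)"] zero_le_power2[of "norm (f x)"]
        zero_le_power2[of "norm (g x)"]
      by (simp only: power2_diff)
    finally show ?thesis by simp
  qed
  then show "AE x in lebesgue_on D. norm (f x \<bullet> g x) \<le> norm ((norm (f x))\<^sup>2 + (norm (g x))\<^sup>2)" by simp
qed

lemma semi_inner_L2: "semi_inner (L2 D) (L2_inner D)"
proof
  show "L2_inner D f g = L2_inner D g f" for f g :: "'a \<Rightarrow> 'b"
    by (simp add: L2_inner_def inner_commute)
qed (auto simp: subspace_L2 L2_inner_def inner_add_left L2_inner_integrable)

lemma L2_bounded:
  assumes "D \<in> lmeasurable" "f \<in> borel_measurable (lebesgue_on D)"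
    and "\<And>x. x \<in> D \<Longrightarrow> norm (f x) \<le> c"
  shows "f \<in> L2 D"
proof (rule L2_boundI[OF assms(2)])
  interpret finite_measure "lebesgue_on D" by (rule finite_measure_lebesgue_on[OF assms(1)])
  show "integrable (lebesgue_on D) (\<lambda>x. c\<^sup>2)" by simp
qed (use assms(3) in \<open>auto intro!: power_mono\<close>)

lemma L2_integrable:
  assumes "D \<in> lmeasurable" "f \<in> L2 D"
  shows "integrable (lebesgue_on D) f"
proof (rule Bochner_Integration.integrable_bound)
  interpret finite_measure "lebesgue_on D" by (rule finite_measure_lebesgue_on[OF assms(1)])
  show "integrable (lebesgue_on D) (\<lambda>x. 1 + (norm (f x))\<^sup>2)" using L2_D[OF assms(2)] by simp
  have "norm (f x) \<le> norm (1 + (norm (f x))\<^sup>2)" for x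
  proof -
    have "0 \<le> (norm (f x) - 1)\<^sup>2" "0 \<le> (norm (f x))\<^sup>2" "0 \<le> norm (f x)" by simp_all
    then have "norm (f x) \<le> 1 + (norm (f x))\<^sup>2" by (simp only: power2_diff power_one)
    then show ?thesis unfolding real_norm_def by linarith
  qed
  then show "AE x in lebesgue_on D. norm (f x) \<le> norm (1 + (norm (f x))\<^sup>2)" by simp
qed (use L2_D[OF assms(2)] in simp)

lemma L2_bounded_linear:
  assumes T: "bounded_linear T" and f: "f \<in> L2 D"
  shows "(\<lambda>x. T (f x)) \<in> L2 D"
proof -
  obtain K where K: "\<And>x. norm (T x) \<le> norm x * K" using bounded_linear.bounded[OF T] by blast
  show ?thesis
  proof (rule L2_boundI)
    show "(\<lambda>x. T (f x)) \<in> borel_measurable (lebesgue_on D)"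
      using measurable_compose[OF L2_D(1)[OF f] borel_measurable_continuous_onI[OF linear_continuous_on[OF T]]] .
    show "integrable (lebesgue_on D) (\<lambda>x. (norm (f x))\<^sup>2 * K\<^sup>2)" using L2_D(2)[OF f] by simp
    show "(norm (T (f x)))\<^sup>2 \<le> (norm (f x))\<^sup>2 * K\<^sup>2" for x
      using power_mono[OF K[of "f x"], of 2] by (simp add: power_mult_distrib)
  qed
qed

lemma L2_inner_self_eq_0_iff:
  assumes "f \<in> L2 D"
  shows "L2_inner D f f = 0 \<longleftrightarrow> (AE x in lebesgue_on D. f x = 0)"
  unfolding L2_inner_def
  using integral_nonneg_eq_0_iff_AE[OF L2_inner_integrable[OF assms assms]] by simp

lemma field_inner_eq:
  "field_inner S S' = sum_form (sum_form (L2_inner (mid S)) (L2_inner (mid S)))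
     (sum_form (L2_inner (mid S')) (L2_inner (mid S')))"
  by (simp add: fun_eq_iff field_inner_def sum_form_def split: prod.split)

definition L2_fields :: "plate \<Rightarrow> plate \<Rightarrow> ('b::euclidean_space, 'c::euclidean_space) field set" where
  "L2_fields S S' = (L2 (mid S) \<times> L2 (mid S)) \<times> (L2 (mid S') \<times> L2 (mid S'))"

lemma semi_inner_fields: "semi_inner (L2_fields S S') (field_inner S S')"
  unfolding L2_fields_def field_inner_eq by (intro semi_inner_sum_form semi_inner_L2)

text \<open>Identifies the null vectors of the abstract theory with the fields that vanish almost
  everywhere.\<close>

lemma field_inner_self_eq_0_iff:
  assumes "\<Phi> \<in> L2_fields S S'"
  shows "field_inner S S' \<Phi> \<Phi> = 0 \<longleftrightarrow> ae_eq S S' \<Phi> 0"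
proof -
  interpret semi_inner "L2 D" "L2_inner D" for D by (rule semi_inner_L2)
  obtain f g f' g' where \<Phi>: "\<Phi> = ((f, g), (f', g'))" by (metis surj_pair)
  have L2: "f \<in> L2 (mid S)" "g \<in> L2 (mid S)" "f' \<in> L2 (mid S')" "g' \<in> L2 (mid S')"
    using assms by (auto simp: L2_fields_def \<Phi>)
  show ?thesis
    using L2 nonneg[OF L2(1)] nonneg[OF L2(2)] nonneg[OF L2(3)] nonneg[OF L2(4)]
    by (auto simp: \<Phi> field_inner_def ae_eq_def zero_prod_def add_nonneg_eq_0_iff L2_inner_self_eq_0_iff)
qed

lemma ae_eq_iff_diff: "ae_eq S S' \<Phi> \<Psi> \<longleftrightarrow> ae_eq S S' (\<Phi> - \<Psi>) (0 :: ('b::real_vector, 'c::real_vector) field)"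
  by (auto simp: ae_eq_def zero_prod_def split: prod.split)


section \<open>The compliance form\<close>

text \<open>The inverse of the material law on symmetric matrices, up to a positive factor.\<close>

definition compliance :: "real \<Rightarrow> real^2^2 \<Rightarrow> real^2^2" where
  "compliance \<nu> A = (1 + \<nu>) *\<^sub>R A - (\<nu> * trace A) *\<^sub>R mat 1"

lemma inner_mat_2: "A \<bullet> B = A$1$1 * B$1$1 + A$1$2 * B$1$2 + A$2$1 * B$2$1 + A$2$2 * B$2$2"
  for A B :: "real^2^2"
  by (simp add: inner_vec_def sum_2)

lemma trace_2: "trace A = A$1$1 + A$2$2" for A :: "real^2^2"
  by (simp add: trace_def sum_2)

lemma mat_eq_2_iff: "A = B \<longleftrightarrow> A$1$1 = B$1$1 \<and> A$1$2 = B$1$2 \<and> A$2$1 = B$2$1 \<and> A$2$2 = B$2$2"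
  for A B :: "real^2^2"
  by (auto simp: vec_eq_iff forall_2)

lemma inner_compliance:
  "compliance \<nu> A \<bullet> B = (1 + \<nu>) * (A \<bullet> B) - \<nu> * trace A * trace B"
  by (simp add: compliance_def inner_mat_2 trace_2 mat_def algebra_simps)

lemma compliance_self_adjoint: "compliance \<nu> A \<bullet> B = compliance \<nu> B \<bullet> A"
  by (simp add: inner_compliance inner_commute[of A B])

lemma trace_square_le: "(trace A)\<^sup>2 \<le> 2 * (A \<bullet> A)" for A :: "real^2^2"
proof -
  have "2 * (A \<bullet> A) - (trace A)\<^sup>2 = (A$1$1 - A$2$2)\<^sup>2 + 2 * (A$1$2)\<^sup>2 + 2 * (A$2$1)\<^sup>2"
    by (simp add: inner_mat_2 trace_2 power2_eq_square algebra_simps)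
  then show ?thesis by (smt (verit) zero_le_power2)
qed

text \<open>The map \<open>compliance \<nu>\<close> has the eigenvalue \<open>1 + \<nu>\<close> on
  trace-free matrices and \<open>1 - \<nu>\<close> on multiples of the identity; the smaller of them
  is \<open>1 - \<bar>\<nu>\<bar>\<close>. The second case of the proof simply drops a trace term of
  favourable sign.\<close>

lemma compliance_coercive:
  assumes "-1 < \<nu>" "\<nu> < 1"
  shows "(1 - \<bar>\<nu>\<bar>) * (A \<bullet> A) \<le> compliance \<nu> A \<bullet> A"
proof (cases "\<nu> \<ge> 0")
  case True
  have "\<nu> * (trace A)\<^sup>2 \<le> \<nu> * (2 * (A \<bullet> A))" using True by (intro mult_left_mono trace_square_le) auto
  then show ?thesis using True by (simp add: inner_compliance power2_eq_square algebra_simps)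
next
  case False
  then have "\<nu> * (trace A * trace A) \<le> 0" by (simp add: mult_nonpos_nonneg)
  then show ?thesis using False by (simp add: inner_compliance algebra_simps)
qed

lemma bounded_linear_compliance: "bounded_linear (compliance \<nu>)"
  by (intro linear_conv_bounded_linear[THEN iffD1] linearI)
    (simp_all add: compliance_def trace_2 mat_eq_2_iff mat_def algebra_simps)

text \<open>In dimension two the elastic bracket and \<open>compliance \<nu>\<close> compose to
  \<open>1 - \<nu>\<^sup>2\<close> times the identity, in either order. As \<open>sym_inv\<close>
  inverts on symmetric matrices only, the explicit preimage must also be shown to be
  symmetric.\<close>

lemma sym_inv_elastic:
  assumes "k > 0" "-1 < \<nu>" "\<nu> < 1" "transpose A = A"
    and C: "\<And>A. C A = (k / (1 - \<nu>\<^sup>2)) *\<^sub>R ((1 - \<nu>) *\<^sub>R A + (\<nu> * trace A) *\<^sub>R mat 1)"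
  shows "sym_inv C A = (1 / k) *\<^sub>R compliance \<nu> A"
proof -
  have ne: "1 - \<nu>\<^sup>2 > 0" using assms(2,3) by (simp add: abs_square_less_1 abs_less_iff)
  have eq: "compliance \<nu> ((1 - \<nu>) *\<^sub>R B + (\<nu> * trace B) *\<^sub>R mat 1) = (1 - \<nu>\<^sup>2) *\<^sub>R B"
    "(1 - \<nu>) *\<^sub>R compliance \<nu> B + (\<nu> * trace (compliance \<nu> B)) *\<^sub>R mat 1 = (1 - \<nu>\<^sup>2) *\<^sub>R B" for B
    unfolding compliance_def mat_eq_2_iff trace_2 by (simp_all add: mat_def power2_eq_square algebra_simps)
  have scale: "C (r *\<^sub>R B) = r *\<^sub>R C B" for r B
  proof -
    have "trace (r *\<^sub>R B) = r * trace B" by (simp add: trace_2 distrib_left)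
    then show ?thesis by (simp add: C scaleR_add_right mult_ac)
  qed
  note scale' = linear_scale[OF bounded_linear.linear[OF bounded_linear_compliance]]
  have left: "(1 / k) *\<^sub>R compliance \<nu> (C B) = B" for B
    using ne assms(1) by (simp add: C scale' eq)
  have right: "C ((1 / k) *\<^sub>R compliance \<nu> B) = B" for B
    using ne assms(1) by (simp add: scale) (simp add: C eq)
  have sym: "transpose ((1 / k) *\<^sub>R compliance \<nu> A) = (1 / k) *\<^sub>R compliance \<nu> A"
  proof -
    have "A $ 1 $ 2 = A $ 2 $ 1" using arg_cong[OF assms(4), of "\<lambda>A. A $ 1 $ 2"] by (simp add: transpose_def)
    then show ?thesis by (simp add: mat_eq_2_iff transpose_def compliance_def mat_def)
  qed
  have inj: "inj_on C {A. transpose A = A}"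
    by (rule inj_on_inverseI[where g = "\<lambda>B. (1 / k) *\<^sub>R compliance \<nu> B"]) (rule left)
  have "inv_into {A. transpose A = A} C (C ((1 / k) *\<^sub>R compliance \<nu> A)) = (1 / k) *\<^sub>R compliance \<nu> A"
    by (rule inv_into_f_f[OF inj]) (use sym in simp)
  then show ?thesis by (simp add: right sym_inv_def)
qed

lemma sym_inv_C1:
  assumes "E > 0" "e > 0" "-1 < \<nu>" "\<nu> < 1" "transpose A = A"
  shows "sym_inv (C1 E e \<nu>) A = (1 / (E * e)) *\<^sub>R compliance \<nu> A"
  by (rule sym_inv_elastic) (use assms in \<open>auto simp: C1_def\<close>)

lemma sym_inv_C2:
  assumes "E > 0" "e > 0" "-1 < \<nu>" "\<nu> < 1" "transpose A = A"
  shows "sym_inv (C2 E e \<nu>) A = (1 / (E * e ^ 3 / 12)) *\<^sub>R compliance \<nu> A"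
  by (rule sym_inv_elastic) (use assms in \<open>auto simp: C2_def\<close>)

section \<open>The compliance form on square integrable fields\<close>

text \<open>\<open>sym_inv\<close> is determined only on symmetric matrices, and a field in
  \<open>L2_sym\<close> may take other values on a null set. The explicit linear inverse gives a
  form that is bilinear on all of \<open>L2 D\<close>.\<close>

definition L2_compliance :: "real \<Rightarrow> real \<Rightarrow> pt set \<Rightarrow> (pt \<Rightarrow> real^2^2) \<Rightarrow> (pt \<Rightarrow> real^2^2) \<Rightarrow> real" where
  "L2_compliance k \<nu> D f g = L2_inner D (\<lambda>x. (1 / k) *\<^sub>R compliance \<nu> (f x)) g"

lemma L2_compliance:
  assumes "f \<in> L2 D"
  shows "(\<lambda>x. (1 / k) *\<^sub>R compliance \<nu> (f x)) \<in> L2 D"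
  using L2_bounded_linear[OF bounded_linear_const_scaleR[OF bounded_linear_compliance] assms] .

lemma L2_compliance_coercive:
  assumes "k > 0" "-1 < \<nu>" "\<nu> < 1" and f: "f \<in> L2 D"
  shows "(1 / k) * (1 - \<bar>\<nu>\<bar>) * L2_inner D f f \<le> L2_compliance k \<nu> D f f"
proof -
  have "(1 / k) * (1 - \<bar>\<nu>\<bar>) * L2_inner D f f
    = (\<integral>x. (1 / k) * ((1 - \<bar>\<nu>\<bar>) * (f x \<bullet> f x)) \<partial>lebesgue_on D)"
    unfolding L2_inner_def by (simp add: mult.assoc)
  also have "\<dots> \<le> L2_compliance k \<nu> D f f"
    unfolding L2_compliance_def L2_inner_def
  proof (rule integral_mono)
    show "integrable (lebesgue_on D) (\<lambda>x. (1 / k) * ((1 - \<bar>\<nu>\<bar>) * (f x \<bullet> f x)))"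
      using L2_inner_integrable[OF f f] by simp
    show "integrable (lebesgue_on D) (\<lambda>x. (1 / k) *\<^sub>R compliance \<nu> (f x) \<bullet> f x)"
      by (intro L2_inner_integrable L2_compliance f)
    fix x
    show "(1 / k) * ((1 - \<bar>\<nu>\<bar>) * (f x \<bullet> f x)) \<le> (1 / k) *\<^sub>R compliance \<nu> (f x) \<bullet> f x"
      using compliance_coercive[OF assms(2,3), of "f x"] assms(1) by (simp add: divide_right_mono)
  qed
  finally show ?thesis .
qed

lemma semi_inner_compliance:
  assumes "k > 0" "-1 < \<nu>" "\<nu> < 1"
  shows "semi_inner (L2 D) (L2_compliance k \<nu> D)"
proof
  interpret L2: semi_inner "L2 D" "L2_inner D" by (rule semi_inner_L2)
  fix x y z :: "pt \<Rightarrow> real^2^2" and r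
  note lin = bounded_linear.linear[OF bounded_linear_compliance[of \<nu>]]
  show "subspace (L2 D)" by (rule subspace_L2)
  have "(\<lambda>u. (1 / k) *\<^sub>R compliance \<nu> (x u) \<bullet> y u) = (\<lambda>u. (1 / k) *\<^sub>R compliance \<nu> (y u) \<bullet> x u)"
    by (simp add: fun_eq_iff compliance_self_adjoint[of \<nu> "y _"])
  then show "L2_compliance k \<nu> D x y = L2_compliance k \<nu> D y x"
    by (simp only: L2_compliance_def L2_inner_def)
  assume x: "x \<in> L2 D"
  show "L2_compliance k \<nu> D (r *\<^sub>R x) z = r * L2_compliance k \<nu> D x z"
    by (simp add: L2_compliance_def L2_inner_def linear_scale[OF lin])
  have "0 \<le> (1 / k) * (1 - \<bar>\<nu>\<bar>) * L2_inner D x x"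
    using L2.nonneg[OF x] assms by (intro mult_nonneg_nonneg) auto
  then show "0 \<le> L2_compliance k \<nu> D x x"
    using L2_compliance_coercive[OF assms x] by linarith
  assume y: "y \<in> L2 D" and z: "z \<in> L2 D"
  have "L2_compliance k \<nu> D (x + y) z
    = L2_inner D ((\<lambda>u. (1 / k) *\<^sub>R compliance \<nu> (x u)) + (\<lambda>u. (1 / k) *\<^sub>R compliance \<nu> (y u))) z"
    by (simp add: L2_compliance_def L2_inner_def linear_add[OF lin] scaleR_add_right inner_add_left)
  then show "L2_compliance k \<nu> D (x + y) z = L2_compliance k \<nu> D x z + L2_compliance k \<nu> D y z"
    using x y z by (simp only: L2.add_left L2_compliance L2_compliance_def)
qed

definition field_compliance :: "plate \<Rightarrow> plate \<Rightarrow> real \<Rightarrow> real \<Rightarrow> real \<Rightarrow> stress \<Rightarrow> stress \<Rightarrow> real" where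
  "field_compliance S S' E e \<nu> =
     sum_form (sum_form (L2_compliance (E * e) \<nu> (mid S)) (L2_compliance (E * e ^ 3 / 12) \<nu> (mid S)))
       (sum_form (L2_compliance (E * e) \<nu> (mid S')) (L2_compliance (E * e ^ 3 / 12) \<nu> (mid S')))"

lemma semi_inner_field_compliance:
  assumes "E > 0" "e > 0" "-1 < \<nu>" "\<nu> < 1"
  shows "semi_inner (L2_fields S S') (field_compliance S S' E e \<nu>)"
  unfolding L2_fields_def field_compliance_def
  by (intro semi_inner_sum_form semi_inner_compliance) (use assms in auto)

text \<open>Membrane and bending parts have different stiffness, \<open>E * e\<close> and
  \<open>E * e ^ 3 / 12\<close>; the smaller of the two coercivity constants serves for all four
  components.\<close>

lemma field_compliance_coercive:
  assumes "E > 0" "e > 0" "-1 < \<nu>" "\<nu> < 1"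
  shows "\<exists>\<alpha>>0. \<forall>\<Phi>\<in>L2_fields S S'. \<alpha> * field_inner S S' \<Phi> \<Phi> \<le> field_compliance S S' E e \<nu> \<Phi> \<Phi>"
proof -
  interpret L2: semi_inner "L2 D" "L2_inner D" for D by (rule semi_inner_L2)
  let ?a = "(1 / (E * e)) * (1 - \<bar>\<nu>\<bar>)" and ?b = "(1 / (E * e ^ 3 / 12)) * (1 - \<bar>\<nu>\<bar>)"
  have pos: "E * e > 0" "E * e ^ 3 / 12 > 0" using assms by auto
  have "min ?a ?b > 0" using pos assms(3,4) by (auto intro!: mult_pos_pos)
  moreover have "min ?a ?b * field_inner S S' \<Phi> \<Phi> \<le> field_compliance S S' E e \<nu> \<Phi> \<Phi>"
    if "\<Phi> \<in> L2_fields S S'" for \<Phi>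
  proof -
    obtain f g f' g' where \<Phi>: "\<Phi> = ((f, g), (f', g'))" by (metis surj_pair)
    have L2: "f \<in> L2 (mid S)" "g \<in> L2 (mid S)" "f' \<in> L2 (mid S')" "g' \<in> L2 (mid S')"
      using that by (auto simp: L2_fields_def \<Phi>)
    have 1: "min ?a ?b * L2_inner D h h \<le> L2_compliance (E * e) \<nu> D h h"
      "min ?a ?b * L2_inner D h h \<le> L2_compliance (E * e ^ 3 / 12) \<nu> D h h" if "h \<in> L2 D" for h D
    proof -
      have "min ?a ?b * L2_inner D h h \<le> ?a * L2_inner D h h" "min ?a ?b * L2_inner D h h \<le> ?b * L2_inner D h h"
        by (intro mult_right_mono min.cobounded1 min.cobounded2 L2.nonneg that)+
      then show "min ?a ?b * L2_inner D h h \<le> L2_compliance (E * e) \<nu> D h h"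
        "min ?a ?b * L2_inner D h h \<le> L2_compliance (E * e ^ 3 / 12) \<nu> D h h"
        using L2_compliance_coercive[OF pos(1) assms(3,4) that] L2_compliance_coercive[OF pos(2) assms(3,4) that]
        by (blast intro: order_trans)+
    qed
    show ?thesis
      using 1(1)[OF L2(1)] 1(2)[OF L2(2)] 1(1)[OF L2(3)] 1(2)[OF L2(4)]
      by (simp only: \<Phi> field_inner_eq field_compliance_def sum_form_def distrib_left fst_conv snd_conv)
       
  qed
  ultimately show ?thesis by blast
qed

lemma Vs_space_subset: "Vs_space S S' \<subseteq> L2_fields S S'"
  by (auto simp: Vs_space_def L2_fields_def L2_sym_def)

text \<open>Completeness of Lebesgue measure; extension by 0 outside \<open>D\<close> transports it
  to \<open>lebesgue_on D\<close>.\<close>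

lemma borel_measurable_lebesgue_on_AE:
  fixes f g :: "'a::euclidean_space \<Rightarrow> 'b::euclidean_space"
  assumes D: "D \<in> sets lebesgue" and f: "f \<in> borel_measurable (lebesgue_on D)"
    and eq: "AE x in lebesgue_on D. f x = g x"
  shows "g \<in> borel_measurable (lebesgue_on D)"
proof -
  have "(\<lambda>x. if x \<in> D then f x else 0) \<in> borel_measurable lebesgue"
    using f D by (simp add: borel_measurable_if)
  moreover have "AE x in lebesgue. (if x \<in> D then f x else 0) = (if x \<in> D then g x else 0)"
    using eq D by (subst (asm) AE_restrict_space_iff) (auto elim!: eventually_mono)
  ultimately have "(\<lambda>x. if x \<in> D then g x else 0) \<in> borel_measurable lebesgue"
    by (rule borel_measurable_AE)
  then show ?thesis using D by (simp add: borel_measurable_if)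
qed

lemma L2_inner_cong_AE:
  fixes f f' g g' :: "'a::euclidean_space \<Rightarrow> 'b::euclidean_space"
  assumes D: "D \<in> sets lebesgue" and L2: "f \<in> borel_measurable (lebesgue_on D)" "g \<in> borel_measurable (lebesgue_on D)"
    and eq: "AE x in lebesgue_on D. f x = f' x" "AE x in lebesgue_on D. g x = g' x"
  shows "L2_inner D f g = L2_inner D f' g'"
  unfolding L2_inner_def
proof (rule integral_cong_AE)
  have "f' \<in> borel_measurable (lebesgue_on D)" "g' \<in> borel_measurable (lebesgue_on D)"
    using borel_measurable_lebesgue_on_AE[OF D] L2 eq by blast+
  then show "(\<lambda>x. f' x \<bullet> g' x) \<in> borel_measurable (lebesgue_on D)" by measurable
  show "(\<lambda>x. f x \<bullet> g x) \<in> borel_measurable (lebesgue_on D)" using L2 by measurable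
  show "AE x in lebesgue_on D. f x \<bullet> g x = f' x \<bullet> g' x" using eq by eventually_elim simp
qed

lemma L2_inner_sym_inv:
  assumes D: "D \<in> sets lebesgue" and f: "f \<in> L2_sym D" and g: "g \<in> L2 D"
    and C: "\<And>A. transpose A = A \<Longrightarrow> sym_inv C A = (1 / k) *\<^sub>R compliance \<nu> A"
  shows "L2_inner D (\<lambda>x. sym_inv C (f x)) g = L2_compliance k \<nu> D f g"
  unfolding L2_compliance_def
proof (rule L2_inner_cong_AE[OF D, symmetric])
  have "f \<in> L2 D" "AE x in lebesgue_on D. transpose (f x) = f x" using f by (auto simp: L2_sym_def)
  then show "(\<lambda>x. (1 / k) *\<^sub>R compliance \<nu> (f x)) \<in> borel_measurable (lebesgue_on D)"
    and "AE x in lebesgue_on D. (1 / k) *\<^sub>R compliance \<nu> (f x) = sym_inv C (f x)"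
    using L2_D(1)[OF L2_compliance] C by (auto elim!: eventually_mono)
qed (use L2_D[OF g] in auto)

lemma compliance_form_eq:
  assumes "E > 0" "e > 0" "-1 < \<nu>" "\<nu> < 1"
    and "mid S \<in> sets lebesgue" "mid S' \<in> sets lebesgue"
    and "\<Phi> \<in> Vs_space S S'" "\<Psi> \<in> Vs_space S S'"
  shows "compliance_form S S' E e \<nu> \<Phi> \<Psi> = field_compliance S S' E e \<nu> \<Phi> \<Psi>"
proof -
  obtain N M N' M' \<tau> \<kappa> \<tau>' \<kappa>' where eq: "\<Phi> = ((N, M), (N', M'))" "\<Psi> = ((\<tau>, \<kappa>), (\<tau>', \<kappa>'))"
    by (metis surj_pair)
  have sym: "N \<in> L2_sym (mid S)" "M \<in> L2_sym (mid S)" "N' \<in> L2_sym (mid S')" "M' \<in> L2_sym (mid S')"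
    and L2: "\<tau> \<in> L2 (mid S)" "\<kappa> \<in> L2 (mid S)" "\<tau>' \<in> L2 (mid S')" "\<kappa>' \<in> L2 (mid S')"
    using assms(7,8) by (auto simp: eq Vs_space_def L2_sym_def)
  note 1 = L2_inner_sym_inv[OF _ _ _ sym_inv_C1[OF assms(1-4)]]
  note 2 = L2_inner_sym_inv[OF _ _ _ sym_inv_C2[OF assms(1-4)]]
  show ?thesis
    using assms(5,6) sym L2 by (simp add: eq compliance_form_def field_compliance_def sum_form_def 1 2)
qed


section \<open>The fundamental lemma of the calculus of variations\<close>

definition smooth_real :: "(real \<Rightarrow> real) \<Rightarrow> bool" where
  "smooth_real f \<longleftrightarrow> (\<exists>d :: nat \<Rightarrow> real \<Rightarrow> real. d 0 = f \<and>
     (\<forall>n t. (d n has_real_derivative d (Suc n) t) (at t)))"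

lemma smooth_real_affine:
  assumes "smooth_real f"
  shows "smooth_real (\<lambda>t. f (a * t + b))"
proof -
  obtain d where d: "d 0 = f" "\<And>n t. (d n has_real_derivative d (Suc n) t) (at t)"
    using assms by (auto simp: smooth_real_def)
  have "((\<lambda>t. a ^ n * d n (a * t + b)) has_real_derivative a ^ Suc n * d (Suc n) (a * t + b)) (at t)" for n t
    by (auto intro!: derivative_eq_intros DERIV_chain2[OF d(2)])
  then show ?thesis
    unfolding smooth_real_def by (intro exI[of _ "\<lambda>n t. a ^ n * d n (a * t + b)"]) (simp add: d(1))
qed

text \<open>The Leibniz rule without binomial coefficients: a list of index pairs
  \<open>(i, j)\<close> encodes the sum of the products of the derivatives \<open>d i\<close> and
  \<open>e j\<close>, and \<open>s\<close> replaces each pair by the two pairs that its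
  differentiation produces.\<close>

lemma smooth_real_mult:
  assumes "smooth_real f" "smooth_real g"
  shows "smooth_real (\<lambda>t. f t * g t)"
proof -
  obtain d where d: "d 0 = f" "\<And>n t. (d n has_real_derivative d (Suc n) t) (at t)"
    using assms(1) by (auto simp: smooth_real_def)
  obtain e where e: "e 0 = g" "\<And>n t. (e n has_real_derivative e (Suc n) t) (at t)"
    using assms(2) by (auto simp: smooth_real_def)
  define F where "F xs t = (\<Sum>(i, j)\<leftarrow>xs. d i t * e j t)" for xs t
  define s :: "(nat \<times> nat) list \<Rightarrow> (nat \<times> nat) list"
    where "s xs = concat (map (\<lambda>(i, j). [(Suc i, j), (i, Suc j)]) xs)" for xs
  have F: "(F xs has_real_derivative F (s xs) t) (at t)" for xs t
    unfolding F_def s_def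
    by (induction xs) (auto intro!: derivative_eq_intros d(2) e(2))
  show ?thesis
    unfolding smooth_real_def
    using F by (intro exI[of _ "\<lambda>n. F ((s ^^ n) [(0, 0)])"]) (auto simp: F_def d(1) e(1))
qed

lemma smooth_tensor:
  assumes "smooth_real f" "smooth_real g"
  shows "smooth (\<lambda>x. f (x $ 1) * g (x $ 2))"
proof -
  obtain d where d: "d 0 = f" "\<And>n t. (d n has_real_derivative d (Suc n) t) (at t)"
    using assms(1) by (auto simp: smooth_real_def)
  obtain e where e: "e 0 = g" "\<And>n t. (e n has_real_derivative e (Suc n) t) (at t)"
    using assms(2) by (auto simp: smooth_real_def)
  have comp: "((\<lambda>x :: pt. x $ k) has_derivative (\<lambda>h. h $ k)) (at x)" for k x
    by (rule bounded_linear.has_derivative[OF bounded_linear_vec_nth has_derivative_ident])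
  have "((\<lambda>x :: pt. d i (x $ 1) * e j (x $ 2)) has_derivative
      (\<lambda>h. h $ 1 * (d (Suc i) (x $ 1) * e j (x $ 2)) + h $ 2 * (d i (x $ 1) * e (Suc j) (x $ 2)))) (at x)" for i j x
    by (rule has_derivative_eq_rhs[OF has_derivative_mult[OF
            DERIV_compose_FDERIV[OF d(2) comp] DERIV_compose_FDERIV[OF e(2) comp]]])
      (simp add: fun_eq_iff algebra_simps)
  then show ?thesis
    unfolding smooth_def
    by (intro exI[of _ "\<lambda>i j x. d i (x $ 1) * e j (x $ 2)"]) (simp add: d(1) e(1))
qed

text \<open>The functions \<open>flat p\<close> form a family closed under differentiation, hence are smooth.\<close>

definition flat :: "real poly \<Rightarrow> real \<Rightarrow> real" where
  "flat p t = (if t > 0 then poly p (1 / t) * exp (- (1 / t)) else 0)"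

lemma flat_lim: "((\<lambda>y. poly q y * exp (- y)) \<longlongrightarrow> 0) at_top" for q :: "real poly"
proof -
  have "((\<lambda>y. \<Sum>i\<le>degree q. coeff q i * (y ^ i / exp y)) \<longlongrightarrow> (\<Sum>i\<le>degree q. coeff q i * 0)) at_top"
    by (intro tendsto_intros tendsto_power_div_exp_0)
  then show ?thesis
    by (simp add: poly_altdef exp_minus sum_distrib_right divide_inverse mult.assoc)
qed

text \<open>With \<open>y = 1 / t\<close>, the derivative of \<open>p(y) exp(-y)\<close> in
  \<open>t\<close> is \<open>y^2 (p(y) - p'(y)) exp(-y)\<close>, which explains the polynomial. At 0
  the difference quotient is 0 from the left and \<open>y p(y) exp(-y)\<close> from the right, and
  the latter tends to 0 as \<open>y\<close> grows.\<close>

lemma flat_deriv: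
  "(flat p has_real_derivative flat ([:0, 0, 1:] * (p - pderiv p)) t) (at t)"
proof (cases t "0 :: real" rule: linorder_cases)
  case less
  have "((\<lambda>_. 0) has_real_derivative 0) (at t)" by simp
  moreover have "\<forall>\<^sub>F s in nhds t. flat p s = 0"
    using less by (intro eventually_nhds_in_open[of "{..<0}" t, THEN eventually_mono]) (auto simp: flat_def)
  ultimately show ?thesis
    using less by (subst DERIV_cong_ev[OF refl _ refl]) (auto simp: flat_def)
next
  case greater
  have "\<forall>\<^sub>F s in nhds t. flat p s = poly p (1 / s) * exp (- (1 / s))"
    using greater by (intro eventually_nhds_in_open[of "{0<..}" t, THEN eventually_mono]) (auto simp: flat_def)
  moreover have "((\<lambda>s. poly p (1 / s) * exp (- (1 / s))) has_real_derivative
      flat ([:0, 0, 1:] * (p - pderiv p)) t) (at t)"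
    using greater
    by (auto intro!: derivative_eq_intros DERIV_chain2[OF poly_DERIV] simp: flat_def divide_simps power2_eq_square)
       (simp add: algebra_simps)
  ultimately show ?thesis by (subst DERIV_cong_ev[OF refl _ refl])
next
  case equal
  have "((\<lambda>s. poly p (1 / s) * exp (- (1 / s)) / s) \<longlongrightarrow> 0) (at_right 0)"
    using flat_lim[of "[:0, 1:] * p"]
    by (subst filterlim_at_right_to_top) (simp add: divide_inverse mult_ac)
  then have "((\<lambda>s. flat p s / s) \<longlongrightarrow> 0) (at_right 0)"
    by (rule Lim_transform_eventually) (auto simp: flat_def eventually_at_right_less intro: eventually_mono[OF eventually_at_right_less])
  moreover have "((\<lambda>s. flat p s / s) \<longlongrightarrow> 0) (at_left 0)"
    by (rule Lim_transform_eventually[OF tendsto_const])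
      (auto simp: flat_def eventually_at_filter)
  ultimately have "((\<lambda>s. flat p s / s) \<longlongrightarrow> 0) (at 0)"
    by (simp add: filterlim_at_split)
  then show ?thesis
    by (simp add: equal has_field_derivative_iff) (simp add: flat_def)
qed

lemma smooth_real_flat: "smooth_real (flat p)"
  unfolding smooth_real_def
  using flat_deriv by (intro exI[of _ "\<lambda>n. flat (((\<lambda>p. [:0, 0, 1:] * (p - pderiv p)) ^^ n) p)"]) auto

section \<open>Bump functions on boxes\<close>

definition rise :: "real \<Rightarrow> real" where
  "rise = flat 1"

lemma rise: "0 \<le> rise t" "rise t \<le> 1" "rise t \<noteq> 0 \<longleftrightarrow> 0 < t"
  by (auto simp: rise_def flat_def)

lemma rise_lim: "(\<lambda>n. rise (real (Suc n) * t)) \<longlonglongrightarrow> (if t > 0 then 1 else 0)"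
proof (cases "t > 0")
  case True
  have "(\<lambda>n. exp (- (inverse (real (Suc n)) * (1 / t)))) \<longlonglongrightarrow> exp (- (0 * (1 / t)))"
    by (intro tendsto_intros LIMSEQ_inverse_real_of_nat)
  moreover have "exp (- (inverse (real (Suc n)) * (1 / t))) = rise (real (Suc n) * t)" for n
    using True by (simp add: rise_def flat_def divide_inverse)
  ultimately show ?thesis using True by simp
qed (simp add: rise_def flat_def zero_less_mult_iff)

text \<open>One factor for each side of the box, vanishing beyond that side. The factor
  \<open>k\<close> controls the steepness: the support is the closed box or empty for every positive
  \<open>k\<close>, while the values increase to the indicator of the open box as \<open>k\<close>
  grows.\<close>

definition bump :: "real \<Rightarrow> pt \<Rightarrow> pt \<Rightarrow> pt \<Rightarrow> real" where
  "bump k a b x = (rise (k * (x $ 1 - a $ 1)) * rise (k * (b $ 1 - x $ 1))) *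
     (rise (k * (x $ 2 - a $ 2)) * rise (k * (b $ 2 - x $ 2)))"

lemma smooth_bump: "smooth (bump k a b)"
proof -
  have "smooth_real (\<lambda>t. rise (k * t + - k * a $ i) * rise ((- k) * t + k * b $ i))" for i
    unfolding rise_def by (intro smooth_real_mult smooth_real_affine smooth_real_flat)
  from smooth_tensor[OF this[of 1] this[of 2]] show ?thesis
    by (simp add: bump_def[abs_def] algebra_simps)
qed

lemma bump_nonzero_iff: "k > 0 \<Longrightarrow> bump k a b x \<noteq> 0 \<longleftrightarrow> x \<in> box a b"
  by (auto simp: bump_def rise zero_less_mult_iff mem_box_cart forall_2)

lemma bump_test_function:
  assumes "k > 0" "cbox a b \<subseteq> D"
  shows "bump k a b \<in> test_functions D"
proof -
  have "{x. bump k a b x \<noteq> 0} \<subseteq> cbox a b"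
    using bump_nonzero_iff[OF assms(1)] box_subset_cbox by blast
  then have "closure {x. bump k a b x \<noteq> 0} \<subseteq> cbox a b" using closure_minimal closed_cbox by blast
  moreover from this have "compact (closure {x. bump k a b x \<noteq> 0})"
    using compact_Int_closed[of "cbox a b"] by (metis closed_closure compact_cbox inf.absorb2)
  ultimately show ?thesis using assms(2) by (auto simp: test_functions_def smooth_bump)
qed

lemma bump_le_1: "\<bar>bump k a b x\<bar> \<le> 1"
proof -
  have "bump k a b x \<le> (1 * 1) * (1 * 1)" unfolding bump_def by (intro mult_mono rise mult_nonneg_nonneg) auto
  moreover have "0 \<le> bump k a b x" unfolding bump_def by (intro mult_nonneg_nonneg rise)
  ultimately show ?thesis by simp
qed

lemma bump_lim: "(\<lambda>n. bump (real (Suc n)) a b x) \<longlonglongrightarrow> indicator (box a b) x"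
proof -
  let ?i = "\<lambda>t. if t > 0 then 1 else 0 :: real"
  let ?l = "(?i (x $ 1 - a $ 1) * ?i (b $ 1 - x $ 1)) * (?i (x $ 2 - a $ 2) * ?i (b $ 2 - x $ 2))"
  have "(\<lambda>n. bump (real (Suc n)) a b x) \<longlonglongrightarrow> ?l"
    unfolding bump_def by (intro tendsto_mult rise_lim)
  moreover have "?l = indicator (box a b) x"
    by (auto simp: indicator_def mem_box_cart forall_2)
  ultimately show ?thesis by simp
qed

lemma smoothE:
  assumes "smooth u"
  obtains d :: "nat \<Rightarrow> nat \<Rightarrow> pt \<Rightarrow> real" where "d 0 0 = u"
    and "\<And>i j x. (d i j has_derivative (\<lambda>h. h $ 1 * d (Suc i) j x + h $ 2 * d i (Suc j) x)) (at x)"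
    and "\<And>i j A. continuous_on A (d i j)"
proof -
  obtain d :: "nat \<Rightarrow> nat \<Rightarrow> pt \<Rightarrow> real" where d: "d 0 0 = u"
    "\<And>i j x. (d i j has_derivative (\<lambda>h. h $ 1 * d (Suc i) j x + h $ 2 * d i (Suc j) x)) (at x)"
    using assms unfolding smooth_def by blast
  have "continuous_on A (d i j)" for i j A
    by (intro continuous_at_imp_continuous_on ballI has_derivative_continuous[OF d(2)])
  then show ?thesis using that d by blast
qed

lemma smooth_continuous: "smooth u \<Longrightarrow> continuous_on A u"
  by (auto elim: smoothE)

section \<open>From test functions to boxes, Borel sets and points\<close>

text \<open>Bumps of growing steepness are test functions bounded by 1 that converge to the
  indicator of the open box; the majorant is \<open>\<bar>g x\<bar>\<close>.\<close>

lemma integral_box_eq_0: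
  fixes g :: "pt \<Rightarrow> real"
  assumes D: "D \<in> sets lebesgue" and g: "integrable (lebesgue_on D) g"
    and zero: "\<And>u. u \<in> test_functions D \<Longrightarrow> (\<integral>x. u x * g x \<partial>lebesgue_on D) = 0"
    and sub: "cbox a b \<subseteq> D"
  shows "(\<integral>x. indicator (box a b) x * g x \<partial>lebesgue_on D) = 0"
proof -
  have "(\<lambda>n. \<integral>x. bump (real (Suc n)) a b x * g x \<partial>lebesgue_on D) \<longlonglongrightarrow>
      (\<integral>x. indicator (box a b) x * g x \<partial>lebesgue_on D)"
  proof (rule integral_dominated_convergence[where w = "\<lambda>x. \<bar>g x\<bar>"])
    show "(\<lambda>x. indicator (box a b) x * g x) \<in> borel_measurable (lebesgue_on D)"
    proof (intro borel_measurable_times borel_measurable_indicator)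
      show "box a b \<in> sets (lebesgue_on D)"
        using D sub box_subset_cbox[of a b]
        by (subst sets_restrict_space_iff) auto
    qed (use g in auto)
    show "(\<lambda>x. bump (real (Suc n)) a b x * g x) \<in> borel_measurable (lebesgue_on D)" for n
      using borel_measurable_integrable[OF g]
        continuous_imp_measurable_on_sets_lebesgue[OF smooth_continuous[OF smooth_bump] D]
      by (intro borel_measurable_times)
    show "AE x in lebesgue_on D. (\<lambda>n. bump (real (Suc n)) a b x * g x) \<longlonglongrightarrow> indicator (box a b) x * g x"
      by (intro AE_I2 tendsto_mult bump_lim tendsto_const)
    show "AE x in lebesgue_on D. norm (bump (real (Suc n)) a b x * g x) \<le> \<bar>g x\<bar>" for n
      using bump_le_1 by (intro AE_I2) (simp add: abs_mult mult_left_le_one_le)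
  qed (use g in auto)
  moreover have "(\<integral>x. bump (real (Suc n)) a b x * g x \<partial>lebesgue_on D) = 0" for n
    by (intro zero bump_test_function sub) simp
  ultimately show ?thesis by (simp add: LIMSEQ_const_iff)
qed

text \<open>Boxes form an intersection-stable generator of the Borel sets, and the sets over whose
  part in the box the integral of \<open>G\<close> vanishes form a Dynkin system. So the density
  \<open>G\<close> on the box agrees almost everywhere with 0.\<close>

lemma AE_zero_of_box_integrals:
  fixes G :: "pt \<Rightarrow> real"
  assumes G: "integrable lborel G"
    and zero: "\<And>a b. box a b \<subseteq> box c d \<Longrightarrow> (LINT x:box a b|lborel. G x) = 0"
  shows "AE x in lborel. x \<in> box c d \<longrightarrow> G x = 0"
proof -
  let ?Q = "box c d"
  have int: "set_integrable lborel A G" if "A \<in> sets borel" for A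
    using that G integrable_mult_indicator[of A lborel G] by (simp add: set_integrable_def)
  have P: "(LINT x:A \<inter> ?Q|lborel. G x) = 0" if A: "A \<in> sets borel" for A
  proof -
    have "A \<in> sigma_sets UNIV (range (\<lambda>(a, b). box a b))" using A by (simp add: borel_eq_box)
    show ?thesis
    proof (rule sigma_sets_induct_disjoint[where P = "\<lambda>A. (LINT x:A \<inter> ?Q|lborel. G x) = 0",
          OF _ _ \<open>A \<in> sigma_sets _ _\<close>])
      show "Int_stable (range (\<lambda>(a, b). box a b :: pt set))"
        by (auto simp: Int_stable_def box_Int_box)
    next
      fix A assume "A \<in> range (\<lambda>(a, b). box a b :: pt set)"
      then obtain a b where "A = box a b" by auto
      moreover obtain a' b' where "box a b \<inter> ?Q = box a' b'" by (auto simp: box_Int_box)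
      ultimately show "(LINT x:A \<inter> ?Q|lborel. G x) = 0" using zero[of a' b'] by auto
    next
      fix A assume A: "A \<in> sigma_sets UNIV (range (\<lambda>(a, b). box a b :: pt set))"
        and IH: "(LINT x:A \<inter> ?Q|lborel. G x) = 0"
      have "A \<in> sets borel" using A by (simp add: borel_eq_box)
      \<comment> \<open>The complement is taken within the box, whose own integral vanishes by
        \<open>zero\<close>; this is why all integrals are restricted to it.\<close>
      then have "(LINT x:?Q|lborel. G x) = (LINT x:A \<inter> ?Q|lborel. G x) + (LINT x:(UNIV - A) \<inter> ?Q|lborel. G x)"
        by (subst set_integral_Un[symmetric]) (auto intro!: int arg_cong2[where f = "\<lambda>A. set_lebesgue_integral lborel A"] simp: Int_Un_distrib2[symmetric])
      then show "(LINT x:(UNIV - A) \<inter> ?Q|lborel. G x) = 0" using IH zero[of c d] by simp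
    next
      fix A :: "nat \<Rightarrow> pt set"
      assume dis: "disjoint_family A" and A: "range A \<subseteq> sigma_sets UNIV (range (\<lambda>(a, b). box a b))"
        and IH: "\<And>i. (LINT x:A i \<inter> ?Q|lborel. G x) = 0"
      have "A i \<in> sets borel" for i using A by (auto simp: borel_eq_box)
      then have "(LINT x:(\<Union>i. A i \<inter> ?Q)|lborel. G x) = (\<Sum>i. LINT x:A i \<inter> ?Q|lborel. G x)"
        using dis by (intro lebesgue_integral_countable_add int) (auto simp: disjoint_family_on_def)
      then show "(LINT x:\<Union> (range A) \<inter> ?Q|lborel. G x) = 0" by (simp add: IH)
    qed (auto simp: set_lebesgue_integral_def)
  qed
  have "AE x in lborel. indicator ?Q x * G x = 0"
  proof (rule density_unique_real)
    show "integrable lborel (\<lambda>x. indicator ?Q x * G x)" using int[of ?Q] by (simp add: set_integrable_def)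
    fix A assume "A \<in> sets (lborel :: pt measure)"
    then show "(LINT x:A|lborel. indicator ?Q x * G x) = (LINT x:A|lborel. 0)"
      using P[of A] by (simp add: set_lebesgue_integral_def indicator_inter_arith mult.assoc)
  qed simp
  then show ?thesis by eventually_elim auto
qed

text \<open>The box argument needs a Borel function, whereas \<open>g\<close> is only Lebesgue
  measurable on \<open>D\<close>; hence the passage to its extension \<open>G\<close> by 0 and to a
  Borel representative \<open>G'\<close>. It applies to open boxes whose closed box lies in
  \<open>D\<close>, and countably many closed boxes exhaust \<open>D\<close>.\<close>

theorem fundamental_lemma:
  fixes g :: "pt \<Rightarrow> real"
  assumes D: "open D" and g: "integrable (lebesgue_on D) g"
    and zero: "\<And>u. u \<in> test_functions D \<Longrightarrow> (\<integral>x. u x * g x \<partial>lebesgue_on D) = 0"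
  shows "AE x in lebesgue_on D. g x = 0"
proof -
  have DL: "D \<in> sets lebesgue" using D by auto
  define G where "G x = indicator D x * g x" for x
  have GL: "integrable lebesgue G"
    using g DL by (simp add: G_def[abs_def] integrable_restrict_space)
  obtain G' where G': "G' \<in> borel_measurable lborel" "AE x in lborel. G x = G' x"
    using completion_ex_borel_measurable_real[of G lborel] GL by auto
  have GG': "AE x in lebesgue. G x = G' x" using G'(2) by (rule AE_completion)
  have "integrable lebesgue G'"
    using integrable_cong_AE[of G lebesgue G'] GL GG' G'(1) measurable_completion by blast
  then have intG': "integrable lborel G'" using G'(1) by (simp add: integrable_completion)
  have box0: "AE x in lborel. x \<in> box c d \<longrightarrow> G' x = 0" if cd: "cbox c d \<subseteq> D" for c d
  proof (rule AE_zero_of_box_integrals[OF intG'])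
    fix a b :: pt assume ab: "box a b \<subseteq> box c d"
    show "(LINT x:box a b|lborel. G' x) = 0"
    proof (cases "box a b = {}")
      case True then show ?thesis by (simp add: set_lebesgue_integral_def)
    next
      case False
      \<comment> \<open>A nonempty open box has the closed box as its closure, so the inclusion in
        \<open>box c d\<close> carries over to closed boxes. For an empty box this would
        fail.\<close>
      then have sub: "cbox a b \<subseteq> D"
        using closure_mono[OF ab] cd ab by (metis closure_box box_eq_empty(1) subset_empty closure_subset order_trans)
      have "(LINT x:box a b|lborel. G' x) = (\<integral>x. indicator (box a b) x * G' x \<partial>lebesgue)"
        unfolding set_lebesgue_integral_def using G'(1) by (subst integral_completion) auto
      also have "\<dots> = (\<integral>x. indicator (box a b) x * G x \<partial>lebesgue)"
      proof (rule integral_cong_AE)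
        have "(indicator (box a b) :: pt \<Rightarrow> real) \<in> borel_measurable lebesgue"
          by (intro borel_measurable_indicator) auto
        note mult = borel_measurable_times[OF this]
        show "(\<lambda>x. indicator (box a b) x * G' x) \<in> borel_measurable lebesgue"
          by (rule mult[OF measurable_completion[OF G'(1)]])
        show "(\<lambda>x. indicator (box a b) x * G x) \<in> borel_measurable lebesgue"
          by (rule mult[OF borel_measurable_integrable[OF GL]])
        show "AE x in lebesgue. indicator (box a b) x * G' x = indicator (box a b) x * G x"
          using GG' by eventually_elim simp
      qed
      also have "\<dots> = (\<integral>x. indicator (box a b) x * g x \<partial>lebesgue_on D)"
        using DL by (subst integral_restrict_space) (auto simp: G_def mult_ac)
      also have "\<dots> = 0" by (rule integral_box_eq_0[OF DL g zero sub])
      finally show ?thesis .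
    qed
  qed
  obtain \<D> where \<D>: "countable \<D>" "\<D> \<subseteq> Pow D" "\<And>X. X \<in> \<D> \<Longrightarrow> \<exists>a b. X = cbox a b" "\<Union> \<D> = D"
    using open_countable_Union_open_cbox[OF D] by metis
  have "AE x in lebesgue. x \<in> X \<longrightarrow> G' x = 0" if XD: "X \<in> \<D>" for X
  proof -
    obtain a b where X: "X = cbox a b" using \<D>(3)[OF XD] by auto
    have "AE x in lebesgue. x \<in> box a b \<longrightarrow> G' x = 0"
      using \<D>(2) XD X by (intro AE_completion box0) auto
    \<comment> \<open>The cover consists of closed boxes but \<open>box0\<close> speaks of open
      ones; the faces are negligible.\<close>
    moreover have "AE x in lebesgue. x \<notin> cbox a b - box a b"
      using negligible_frontier_interval[of a b] by (intro AE_not_in) (simp add: negligible_iff_null_sets)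
    ultimately show ?thesis by eventually_elim (auto simp: X)
  qed
  then have "AE x in lebesgue. \<forall>X\<in>\<D>. x \<in> X \<longrightarrow> G' x = 0"
    by (simp only: AE_ball_countable[OF \<D>(1)]) blast
  with GG' have "AE x in lebesgue. x \<in> D \<longrightarrow> g x = 0"
  proof eventually_elim
    fix x assume x: "G x = G' x" "\<forall>X\<in>\<D>. x \<in> X \<longrightarrow> G' x = 0"
    show "x \<in> D \<longrightarrow> g x = 0"
    proof
      assume "x \<in> D"
      then have "G x = 0" using x \<D>(4) by (metis UnionE)
      then show "g x = 0" using \<open>x \<in> D\<close> by (simp add: G_def)
    qed
  qed
  then show ?thesis using DL by (subst AE_restrict_space_iff) auto
qed


section \<open>Weak divergences\<close>

lemma smooth_grad:
  assumes "smooth u"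
  shows "smooth (\<lambda>x. grad u x $ i)"
proof -
  obtain d :: "nat \<Rightarrow> nat \<Rightarrow> pt \<Rightarrow> real" where d: "d 0 0 = u"
    "\<And>i j x. (d i j has_derivative (\<lambda>h. h $ 1 * d (Suc i) j x + h $ 2 * d i (Suc j) x)) (at x)"
    using assms unfolding smooth_def by blast
  have "frechet_derivative u (at x) = (\<lambda>h. h $ 1 * d (Suc 0) 0 x + h $ 2 * d 0 (Suc 0) x)" for x
    using frechet_derivative_at[OF d(2)[of 0 0 x]] by (simp add: d(1))
  then have "grad u x $ 1 = d 1 0 x" "grad u x $ 2 = d 0 1 x" for x
    by (simp_all add: grad_def axis_def)
  moreover have "smooth (d 1 0)" unfolding smooth_def
    using d(2) by (intro exI[of _ "\<lambda>i j. d (Suc i) j"]) auto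
  moreover have "smooth (d 0 1)" unfolding smooth_def
    using d(2) by (intro exI[of _ "\<lambda>i j. d i (Suc j)"]) auto
  ultimately show ?thesis using exhaust_2[of i] by auto
qed

lemma continuous_on_grad: "smooth u \<Longrightarrow> continuous_on A (grad u)"
  using continuous_on_vec_lambda[of A "\<lambda>i x. grad u x $ i"] smooth_continuous[OF smooth_grad]
  by simp

lemma continuous_on_hessian: "smooth u \<Longrightarrow> continuous_on A (hessian u)"
  unfolding hessian_def
  by (intro continuous_on_vec_lambda smooth_continuous smooth_grad)

lemma L2_continuous:
  fixes f :: "'a::euclidean_space \<Rightarrow> 'b::euclidean_space"
  assumes D: "open D" "bounded D" and f: "continuous_on UNIV f"
  shows "f \<in> L2 D"
proof -
  have DL: "D \<in> lmeasurable" using D by (simp add: lmeasurable_open)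
  have "compact (f ` closure D)"
    using D f by (intro compact_continuous_image continuous_on_subset[OF f]) auto
  then obtain c where "\<And>x. x \<in> closure D \<Longrightarrow> norm (f x) \<le> c"
    using compact_imp_bounded bounded_iff by (metis image_eqI)
  then show ?thesis
    using D f closure_subset
    by (intro L2_bounded[OF DL, of f c] continuous_imp_measurable_on_sets_lebesgue)
      (auto intro: continuous_on_subset)
qed

text \<open>Covers all the pairings with a test function: a product of reals, a scalar times a
  vector, and a matrix applied to a gradient.\<close>

lemma L2_bilinear_integrable:
  fixes p :: "'b::euclidean_space \<Rightarrow> 'c::euclidean_space \<Rightarrow> 'd::euclidean_space"
  assumes p: "bounded_bilinear p" and f: "f \<in> L2 D" and g: "g \<in> L2 D"
  shows "integrable (lebesgue_on D) (\<lambda>x. p (f x) (g x))"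
proof -
  obtain K where K: "K \<ge> 0" "\<And>x y. norm (p x y) \<le> norm x * norm y * K"
    using bounded_bilinear.nonneg_bounded[OF p] by blast
  have L2n: "(\<lambda>x. norm (f x)) \<in> L2 D" "(\<lambda>x. norm (g x)) \<in> L2 D"
    using f g by (auto simp: L2_def)
  show ?thesis
  proof (rule Bochner_Integration.integrable_bound)
    show "integrable (lebesgue_on D) (\<lambda>x. norm (f x) * norm (g x) * K)"
      using L2_inner_integrable[OF L2n] by simp
    have cont: "continuous_on UNIV (\<lambda>z. p (fst z) (snd z))"
      by (intro bounded_bilinear.continuous_on[OF p] continuous_intros)
    have pair: "(\<lambda>x. (f x, g x)) \<in> borel_measurable (lebesgue_on D)"
      using L2_D(1)[OF f] L2_D(1)[OF g] by (rule borel_measurable_Pair)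
    show "(\<lambda>x. p (f x) (g x)) \<in> borel_measurable (lebesgue_on D)"
      using measurable_compose[OF pair borel_measurable_continuous_onI[OF cont]] by simp
    show "AE x in lebesgue_on D. norm (p (f x) (g x)) \<le> norm (norm (f x) * norm (g x) * K)"
      using K by simp
  qed
qed

lemma bounded_bilinear_matrix_vector: "bounded_bilinear ((*v) :: real^'n^'m \<Rightarrow> real^'n \<Rightarrow> real^'m)"
proof -
  have "bilinear ((*v) :: real^'n^'m \<Rightarrow> real^'n \<Rightarrow> real^'m)"
    unfolding bilinear_def
    by (auto intro!: linearI simp: matrix_vector_mult_add_rdistrib matrix_vector_right_distrib
        scaleR_matrix_vector_assoc matrix_vector_mult_scaleR)
  then show ?thesis by (simp add: bilinear_conv_bounded_bilinear)
qed

lemma test_function_L2: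
  assumes "open D" "bounded D" "u \<in> test_functions D"
  shows "u \<in> L2 D" "grad u \<in> L2 D" "hessian u \<in> L2 D"
  using assms by (auto simp: test_functions_def intro!: L2_continuous smooth_continuous
      continuous_on_grad continuous_on_hessian)

section \<open>Uniqueness and linearity of weak divergences\<close>

text \<open>The domain is bounded, so square integrable functions are integrable and the fundamental
  lemma applies to the difference.\<close>

lemma L2_weak_unique:
  fixes g h :: "pt \<Rightarrow> real"
  assumes D: "open D" "bounded D" and L2: "g \<in> L2 D" "h \<in> L2 D"
    and eq: "\<And>u. u \<in> test_functions D \<Longrightarrow> (\<integral>x. u x * g x \<partial>lebesgue_on D) = (\<integral>x. u x * h x \<partial>lebesgue_on D)"
  shows "AE x in lebesgue_on D. g x = h x"
proof -
  have DL: "D \<in> lmeasurable" using D by (simp add: lmeasurable_open)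
  have "AE x in lebesgue_on D. g x - h x = 0"
  proof (rule fundamental_lemma[OF D(1)])
    show "integrable (lebesgue_on D) (\<lambda>x. g x - h x)" using L2 DL by (auto intro: L2_integrable)
    fix u assume u: "u \<in> test_functions D"
    have "integrable (lebesgue_on D) (\<lambda>x. u x * g x)" "integrable (lebesgue_on D) (\<lambda>x. u x * h x)"
      using L2 test_function_L2(1)[OF D u] by (auto intro: L2_bilinear_integrable[OF bounded_bilinear_mult])
    then show "(\<integral>x. u x * (g x - h x) \<partial>lebesgue_on D) = 0" using eq[OF u] by (simp add: right_diff_distrib)
  qed
  then show ?thesis by simp
qed

lemma has_weak_Div_unique:
  assumes D: "open D" "bounded D" and L2: "g \<in> L2 D" "h \<in> L2 D"
    and "has_weak_Div D A g" "has_weak_Div D A h"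
  shows "AE x in lebesgue_on D. g x = h x"
proof -
  have "AE x in lebesgue_on D. g x $ i = h x $ i" for i
  proof (rule L2_weak_unique[OF D])
    show "(\<lambda>x. g x $ i) \<in> L2 D" "(\<lambda>x. h x $ i) \<in> L2 D"
      using L2 by (auto intro: L2_bounded_linear[OF bounded_linear_vec_nth])
    fix u assume u: "u \<in> test_functions D"
    have int: "integrable (lebesgue_on D) (\<lambda>x. u x *\<^sub>R g x)" "integrable (lebesgue_on D) (\<lambda>x. u x *\<^sub>R h x)"
      using L2 test_function_L2(1)[OF D u] by (auto intro: L2_bilinear_integrable[OF bounded_bilinear_scaleR])
    have "integral\<^sup>L (lebesgue_on D) (\<lambda>x. u x *\<^sub>R g x) = integral\<^sup>L (lebesgue_on D) (\<lambda>x. u x *\<^sub>R h x)"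
      using bspec[OF assms(5)[unfolded has_weak_Div_def] u] bspec[OF assms(6)[unfolded has_weak_Div_def] u]
      by simp
    from arg_cong[OF this, of "\<lambda>v. v $ i"]
    show "(\<integral>x. u x * g x $ i \<partial>lebesgue_on D) = (\<integral>x. u x * h x $ i \<partial>lebesgue_on D)"
      using integral_bounded_linear[OF bounded_linear_vec_nth int(1)]
        integral_bounded_linear[OF bounded_linear_vec_nth int(2)] by simp
  qed
  from this[of 1] this[of 2] show ?thesis
    by eventually_elim (simp add: vec_eq_iff forall_2)
qed

lemma has_weak_divDiv_unique:
  assumes D: "open D" "bounded D" and L2: "g \<in> L2 D" "h \<in> L2 D"
    and "has_weak_divDiv D A g" "has_weak_divDiv D A h"
  shows "AE x in lebesgue_on D. g x = h x"
  using assms by (intro L2_weak_unique[OF D L2]) (simp add: has_weak_divDiv_def)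

lemma has_weak_Div_lincomb:
  assumes D: "open D" "bounded D" and A: "A \<in> L2 D" "A' \<in> L2 D" and g: "g \<in> L2 D" "g' \<in> L2 D"
    and h: "has_weak_Div D A g" "has_weak_Div D A' g'"
  shows "has_weak_Div D (r *\<^sub>R A + s *\<^sub>R A') (r *\<^sub>R g + s *\<^sub>R g')"
  unfolding has_weak_Div_def
proof
  fix u assume u: "u \<in> test_functions D"
  note v = test_function_L2[OF D u]
  note [simp] = L2_bilinear_integrable[OF bounded_bilinear_matrix_vector A(1) v(2)]
    L2_bilinear_integrable[OF bounded_bilinear_matrix_vector A(2) v(2)]
    L2_bilinear_integrable[OF bounded_bilinear_scaleR v(1) g(1)]
    L2_bilinear_integrable[OF bounded_bilinear_scaleR v(1) g(2)]
  have "integral\<^sup>L (lebesgue_on D) (\<lambda>x. (r *\<^sub>R A + s *\<^sub>R A') x *v grad u x)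
    = integral\<^sup>L (lebesgue_on D) (\<lambda>x. r *\<^sub>R (A x *v grad u x) + s *\<^sub>R (A' x *v grad u x))"
    by (simp add: matrix_vector_mult_add_rdistrib scaleR_matrix_vector_assoc)
  also have "\<dots> = r *\<^sub>R integral\<^sup>L (lebesgue_on D) (\<lambda>x. A x *v grad u x)
    + s *\<^sub>R integral\<^sup>L (lebesgue_on D) (\<lambda>x. A' x *v grad u x)"
    by simp
  also have "\<dots> = - (r *\<^sub>R integral\<^sup>L (lebesgue_on D) (\<lambda>x. u x *\<^sub>R g x)
    + s *\<^sub>R integral\<^sup>L (lebesgue_on D) (\<lambda>x. u x *\<^sub>R g' x))"
    using h u by (simp add: has_weak_Div_def)
  also have "r *\<^sub>R integral\<^sup>L (lebesgue_on D) (\<lambda>x. u x *\<^sub>R g x)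
    + s *\<^sub>R integral\<^sup>L (lebesgue_on D) (\<lambda>x. u x *\<^sub>R g' x)
    = integral\<^sup>L (lebesgue_on D) (\<lambda>x. r *\<^sub>R (u x *\<^sub>R g x) + s *\<^sub>R (u x *\<^sub>R g' x))"
    by (simp del: scaleR_scaleR)
  also have "\<dots> = integral\<^sup>L (lebesgue_on D) (\<lambda>x. u x *\<^sub>R (r *\<^sub>R g + s *\<^sub>R g') x)"
    by (simp add: scaleR_add_right mult.commute)
  finally show "integral\<^sup>L (lebesgue_on D) (\<lambda>x. (r *\<^sub>R A + s *\<^sub>R A') x *v grad u x)
    = - integral\<^sup>L (lebesgue_on D) (\<lambda>x. u x *\<^sub>R (r *\<^sub>R g + s *\<^sub>R g') x)" .
qed

lemma has_weak_divDiv_lincomb: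
  assumes D: "open D" "bounded D" and A: "A \<in> L2 D" "A' \<in> L2 D" and g: "g \<in> L2 D" "g' \<in> L2 D"
    and h: "has_weak_divDiv D A g" "has_weak_divDiv D A' g'"
  shows "has_weak_divDiv D (r *\<^sub>R A + s *\<^sub>R A') (r *\<^sub>R g + s *\<^sub>R g')"
  unfolding has_weak_divDiv_def
proof
  fix u assume u: "u \<in> test_functions D"
  note v = test_function_L2[OF D u]
  note [simp] = L2_inner_integrable[OF A(1) v(3)] L2_inner_integrable[OF A(2) v(3)]
    L2_bilinear_integrable[OF bounded_bilinear_mult v(1) g(1)]
    L2_bilinear_integrable[OF bounded_bilinear_mult v(1) g(2)]
  have "(\<integral>x. (r *\<^sub>R A + s *\<^sub>R A') x \<bullet> hessian u x \<partial>lebesgue_on D)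
    = r * (\<integral>x. A x \<bullet> hessian u x \<partial>lebesgue_on D) + s * (\<integral>x. A' x \<bullet> hessian u x \<partial>lebesgue_on D)"
    by (simp add: inner_add_left)
  also have "\<dots> = r * (\<integral>x. u x * g x \<partial>lebesgue_on D) + s * (\<integral>x. u x * g' x \<partial>lebesgue_on D)"
    using h u by (simp add: has_weak_divDiv_def)
  also have "\<dots> = (\<integral>x. r * (u x * g x) + s * (u x * g' x) \<partial>lebesgue_on D)"
    by simp
  also have "\<dots> = (\<integral>x. u x * (r *\<^sub>R g + s *\<^sub>R g') x \<partial>lebesgue_on D)"
    by (simp add: distrib_left mult_ac)
  finally show "(\<integral>x. (r *\<^sub>R A + s *\<^sub>R A') x \<bullet> hessian u x \<partial>lebesgue_on D)
    = (\<integral>x. u x * (r *\<^sub>R g + s *\<^sub>R g') x \<partial>lebesgue_on D)" .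
qed

lemma weak_Div:
  assumes "\<exists>g\<in>L2 D. has_weak_Div D A g"
  shows "weak_Div D A \<in> L2 D" "has_weak_Div D A (weak_Div D A)"
  using someI_ex[of "\<lambda>g. g \<in> L2 D \<and> has_weak_Div D A g"] assms by (auto simp: weak_Div_def)

lemma weak_divDiv:
  assumes "\<exists>g\<in>L2 D. has_weak_divDiv D A g"
  shows "weak_divDiv D A \<in> L2 D" "has_weak_divDiv D A (weak_divDiv D A)"
  using someI_ex[of "\<lambda>g. g \<in> L2 D \<and> has_weak_divDiv D A g"] assms by (auto simp: weak_divDiv_def)

text \<open>Both sides are square integrable weak divergences of the same field, the left by choice
  and the right by linearity of the defining identity, so uniqueness applies.\<close>

lemma weak_Div_lincomb:
  assumes D: "open D" "bounded D" and A: "A \<in> L2 D" "A' \<in> L2 D"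
    and ex: "\<exists>g\<in>L2 D. has_weak_Div D A g" "\<exists>g\<in>L2 D. has_weak_Div D A' g"
  shows "AE x in lebesgue_on D. weak_Div D (r *\<^sub>R A + s *\<^sub>R A') x = (r *\<^sub>R weak_Div D A + s *\<^sub>R weak_Div D A') x"
proof -
  note w = weak_Div[OF ex(1)] weak_Div[OF ex(2)]
  have 1: "has_weak_Div D (r *\<^sub>R A + s *\<^sub>R A') (r *\<^sub>R weak_Div D A + s *\<^sub>R weak_Div D A')"
    by (rule has_weak_Div_lincomb[OF D A w(1,3,2,4)])
  have 2: "r *\<^sub>R weak_Div D A + s *\<^sub>R weak_Div D A' \<in> L2 D"
    using w by (intro subspace_add[OF subspace_L2] subspace_scale[OF subspace_L2])
  have "\<exists>g\<in>L2 D. has_weak_Div D (r *\<^sub>R A + s *\<^sub>R A') g" using 1 2 by blast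
  from has_weak_Div_unique[OF D weak_Div(1)[OF this] 2 weak_Div(2)[OF this] 1] show ?thesis .
qed

lemma weak_divDiv_lincomb:
  assumes D: "open D" "bounded D" and A: "A \<in> L2 D" "A' \<in> L2 D"
    and ex: "\<exists>g\<in>L2 D. has_weak_divDiv D A g" "\<exists>g\<in>L2 D. has_weak_divDiv D A' g"
  shows "AE x in lebesgue_on D. weak_divDiv D (r *\<^sub>R A + s *\<^sub>R A') x = (r *\<^sub>R weak_divDiv D A + s *\<^sub>R weak_divDiv D A') x"
proof -
  note w = weak_divDiv[OF ex(1)] weak_divDiv[OF ex(2)]
  have 1: "has_weak_divDiv D (r *\<^sub>R A + s *\<^sub>R A') (r *\<^sub>R weak_divDiv D A + s *\<^sub>R weak_divDiv D A')"
    by (rule has_weak_divDiv_lincomb[OF D A w(1,3,2,4)])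
  have 2: "r *\<^sub>R weak_divDiv D A + s *\<^sub>R weak_divDiv D A' \<in> L2 D"
    using w by (intro subspace_add[OF subspace_L2] subspace_scale[OF subspace_L2])
  have "\<exists>g\<in>L2 D. has_weak_divDiv D (r *\<^sub>R A + s *\<^sub>R A') g" using 1 2 by blast
  from has_weak_divDiv_unique[OF D weak_divDiv(1)[OF this] 2 weak_divDiv(2)[OF this] 1] show ?thesis .
qed

lemma B_star_mem: "\<Phi> \<in> Hs_space S S' \<Longrightarrow> B_star S S' \<Phi> \<in> L2_fields S S'"
  by (auto simp: Hs_space_def B_star_def L2_fields_def intro!: weak_Div weak_divDiv)

lemma B_star_lincomb:
  assumes D: "open (mid S)" "bounded (mid S)" "open (mid S')" "bounded (mid S')"
    and "\<Phi> \<in> Hs_space S S'" "\<Psi> \<in> Hs_space S S'"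
  shows "ae_eq S S' (B_star S S' (r *\<^sub>R \<Phi> + s *\<^sub>R \<Psi>)) (r *\<^sub>R B_star S S' \<Phi> + s *\<^sub>R B_star S S' \<Psi>)"
proof -
  obtain N M N' M' \<tau> \<kappa> \<tau>' \<kappa>' where eq: "\<Phi> = ((N, M), (N', M'))" "\<Psi> = ((\<tau>, \<kappa>), (\<tau>', \<kappa>'))"
    by (metis surj_pair)
  have L2: "N \<in> L2 (mid S)" "M \<in> L2 (mid S)" "N' \<in> L2 (mid S')" "M' \<in> L2 (mid S')"
    "\<tau> \<in> L2 (mid S)" "\<kappa> \<in> L2 (mid S)" "\<tau>' \<in> L2 (mid S')" "\<kappa>' \<in> L2 (mid S')"
    and ex: "\<exists>g\<in>L2 (mid S). has_weak_Div (mid S) N g" "\<exists>g\<in>L2 (mid S). has_weak_divDiv (mid S) M g"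
    "\<exists>g\<in>L2 (mid S'). has_weak_Div (mid S') N' g" "\<exists>g\<in>L2 (mid S'). has_weak_divDiv (mid S') M' g"
    "\<exists>g\<in>L2 (mid S). has_weak_Div (mid S) \<tau> g" "\<exists>g\<in>L2 (mid S). has_weak_divDiv (mid S) \<kappa> g"
    "\<exists>g\<in>L2 (mid S'). has_weak_Div (mid S') \<tau>' g" "\<exists>g\<in>L2 (mid S'). has_weak_divDiv (mid S') \<kappa>' g"
    using assms(5,6) by (simp_all add: eq Hs_space_def Vs_space_def L2_sym_def)
  have "AE x in lebesgue_on (mid S). weak_Div (mid S) (r *\<^sub>R N + s *\<^sub>R \<tau>) x
      = (r *\<^sub>R weak_Div (mid S) N + s *\<^sub>R weak_Div (mid S) \<tau>) x
    \<and> weak_divDiv (mid S) (r *\<^sub>R M + s *\<^sub>R \<kappa>) x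
      = (r *\<^sub>R weak_divDiv (mid S) M + s *\<^sub>R weak_divDiv (mid S) \<kappa>) x"
    by (intro AE_conjI weak_Div_lincomb weak_divDiv_lincomb D L2 ex)
  moreover have "AE x in lebesgue_on (mid S'). weak_Div (mid S') (r *\<^sub>R N' + s *\<^sub>R \<tau>') x
      = (r *\<^sub>R weak_Div (mid S') N' + s *\<^sub>R weak_Div (mid S') \<tau>') x
    \<and> weak_divDiv (mid S') (r *\<^sub>R M' + s *\<^sub>R \<kappa>') x
      = (r *\<^sub>R weak_divDiv (mid S') M' + s *\<^sub>R weak_divDiv (mid S') \<kappa>') x"
    by (intro AE_conjI weak_Div_lincomb weak_divDiv_lincomb D L2 ex)
  ultimately show ?thesis
    by (simp add: eq B_star_def ae_eq_def)
qed


section \<open>Piecewise polynomials\<close>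

lemma finitely_spanned_mono: "finitely_spanned U g L \<Longrightarrow> K \<subseteq> L \<Longrightarrow> finitely_spanned U g K"
  unfolding finitely_spanned_def by blast

lemma finitely_spanned_orthonormal_card:
  assumes U: "semi_inner U g" and K: "subspace K" "K \<subseteq> U" and fs: "finitely_spanned U g K"
  shows "\<exists>n. \<forall>A. semi_inner.orthonormal K g A \<longrightarrow> card A \<le> n"
proof -
  interpret U: semi_inner U g by fact
  interpret K: semi_inner K g by (rule U.semi_inner_subset[OF K])
  obtain B where B: "finite B" "B \<subseteq> U" "\<And>x. x \<in> K \<Longrightarrow> \<exists>y\<in>span B. g (x - y) (x - y) = 0"
    using fs unfolding finitely_spanned_def by blast
  have "card A \<le> card B" if "K.orthonormal A" for A
    by (rule U.orthonormal_card_le[OF B]) (use that K in \<open>auto simp: K.orthonormal_def U.orthonormal_def\<close>)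
  then show ?thesis by blast
qed

text \<open>A remainder of length zero in \<open>L2\<close> is orthogonal to every square integrable
  function, in particular to its own image under the compliance map. The same spanning set therefore
  works.\<close>

lemma finitely_spanned_L2_compliance:
  assumes "finitely_spanned (L2 D) (L2_inner D) K" "K \<subseteq> L2 D"
  shows "finitely_spanned (L2 D) (L2_compliance k \<nu> D) K"
proof -
  interpret L2: semi_inner "L2 D" "L2_inner D" by (rule semi_inner_L2)
  obtain B where B: "finite B" "B \<subseteq> L2 D" "\<And>x. x \<in> K \<Longrightarrow> \<exists>y\<in>span B. L2_inner D (x - y) (x - y) = 0"
    using assms(1) unfolding finitely_spanned_def by blast
  have "\<exists>y\<in>span B. L2_compliance k \<nu> D (x - y) (x - y) = 0" if x: "x \<in> K" for x
  proof -
    obtain y where y: "y \<in> span B" "L2_inner D (x - y) (x - y) = 0" using B(3)[OF x] by blast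
    have d: "x - y \<in> L2 D"
      using x assms(2) y(1) span_minimal[OF B(2) subspace_L2] by (intro L2.mem(4)) auto
    have "L2_compliance k \<nu> D (x - y) (x - y) = 0"
      using L2.null_left[OF d L2_compliance[OF d] y(2)] L2.commute[OF d L2_compliance[OF d]]
      by (simp add: L2_compliance_def)
    then show ?thesis using y(1) by blast
  qed
  then show ?thesis unfolding finitely_spanned_def using B(1,2) by blast
qed

definition piecewise_polynomials :: "pt set \<Rightarrow> pt set set \<Rightarrow> int \<Rightarrow> (pt \<Rightarrow> 'b::euclidean_space) set" where
  "piecewise_polynomials D T k = {f \<in> L2 D. \<exists>p. piecewise_poly T k f p}"

lemma subspace_poly_space: "subspace (poly_space k :: (pt \<Rightarrow> 'b::real_vector) set)"
  unfolding subspace_def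
proof (intro conjI ballI allI)
  show "0 \<in> (poly_space k :: (pt \<Rightarrow> 'b) set)"
    unfolding poly_space_def by (intro CollectI exI[of _ "\<lambda>i j. 0"]) (simp add: case_prod_beta)
next
  fix p q :: "pt \<Rightarrow> 'b" assume "p \<in> poly_space k" "q \<in> poly_space k"
  then obtain c d where
    "\<And>x. p x = (\<Sum>(i, j)\<in>{(i, j). int i + int j \<le> k}. (x $ 1 ^ i * x $ 2 ^ j) *\<^sub>R c i j)"
    "\<And>x. q x = (\<Sum>(i, j)\<in>{(i, j). int i + int j \<le> k}. (x $ 1 ^ i * x $ 2 ^ j) *\<^sub>R d i j)"
    unfolding poly_space_def by blast
  then show "p + q \<in> poly_space k"
    unfolding poly_space_def
    by (intro CollectI exI[of _ "\<lambda>i j. c i j + d i j"])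
      (simp add: case_prod_beta scaleR_add_right sum.distrib)
next
  fix p :: "pt \<Rightarrow> 'b" and r assume "p \<in> poly_space k"
  then obtain c where
    "\<And>x. p x = (\<Sum>(i, j)\<in>{(i, j). int i + int j \<le> k}. (x $ 1 ^ i * x $ 2 ^ j) *\<^sub>R c i j)"
    unfolding poly_space_def by blast
  then show "r *\<^sub>R p \<in> poly_space k"
    unfolding poly_space_def
    by (intro CollectI exI[of _ "\<lambda>i j. r *\<^sub>R c i j"])
      (simp add: case_prod_beta scaleR_sum_right mult_ac)
qed

lemma subspace_piecewise_polynomials:
  "subspace (piecewise_polynomials D T k :: (pt \<Rightarrow> 'b::euclidean_space) set)"
  unfolding subspace_def
proof (intro conjI ballI allI)
  show "0 \<in> (piecewise_polynomials D T k :: (pt \<Rightarrow> 'b) set)"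
    using subspace_0[OF subspace_L2] subspace_0[OF subspace_poly_space]
    by (auto simp: piecewise_polynomials_def piecewise_poly_def intro!: exI[of _ "\<lambda>_. 0"])
next
  fix f g :: "pt \<Rightarrow> 'b"
  assume fg: "f \<in> piecewise_polynomials D T k" "g \<in> piecewise_polynomials D T k"
  then obtain p q where p: "piecewise_poly T k f p" and q: "piecewise_poly T k g q"
    by (auto simp: piecewise_polynomials_def)
  have "piecewise_poly T k (f + g) (\<lambda>K. p K + q K)"
    unfolding piecewise_poly_def
  proof (intro ballI conjI)
    fix K assume K: "K \<in> T"
    show "p K + q K \<in> poly_space k"
      using p q K by (intro subspace_add[OF subspace_poly_space]) (auto simp: piecewise_poly_def)
    have "AE x in lebesgue_on K. f x = p K x" "AE x in lebesgue_on K. g x = q K x"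
      using p q K by (auto simp: piecewise_poly_def)
    then show "AE x in lebesgue_on K. (f + g) x = (p K + q K) x" by eventually_elim simp
  qed
  then show "f + g \<in> piecewise_polynomials D T k"
    using fg subspace_add[OF subspace_L2] by (auto simp: piecewise_polynomials_def)
next
  fix f :: "pt \<Rightarrow> 'b" and r
  assume f: "f \<in> piecewise_polynomials D T k"
  then obtain p where p: "piecewise_poly T k f p" by (auto simp: piecewise_polynomials_def)
  have "piecewise_poly T k (r *\<^sub>R f) (\<lambda>K. r *\<^sub>R p K)"
    unfolding piecewise_poly_def
  proof (intro ballI conjI)
    fix K assume K: "K \<in> T"
    show "r *\<^sub>R p K \<in> poly_space k"
      using p K by (intro subspace_scale[OF subspace_poly_space]) (auto simp: piecewise_poly_def)
    have "AE x in lebesgue_on K. f x = p K x" using p K by (auto simp: piecewise_poly_def)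
    then show "AE x in lebesgue_on K. (r *\<^sub>R f) x = (r *\<^sub>R p K) x" by eventually_elim simp
  qed
  then show "r *\<^sub>R f \<in> piecewise_polynomials D T k"
    using f subspace_scale[OF subspace_L2] by (auto simp: piecewise_polynomials_def)
qed

text \<open>
  A finite family \<open>T\<close> is made disjoint by removing the members that precede in some enumeration;
  the monomials cut off to the resulting cells span all piecewise polynomials.
\<close>

lemma finitely_spanned_piecewise_polynomials:
  assumes D: "open D" "bounded D" and T: "finite T" "\<And>K. K \<in> T \<Longrightarrow> closed K" "D \<subseteq> \<Union>T"
  shows "finitely_spanned (L2 D) (L2_inner D) (piecewise_polynomials D T k :: (pt \<Rightarrow> 'b::euclidean_space) set)"
proof -
  obtain r :: "pt set \<Rightarrow> nat" where r: "inj_on r T" using finite_imp_inj_to_nat_seg[OF T(1)] by blast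
  define A where "A K = K - \<Union>{L \<in> T. r L < r K}" for K
  define I where "I = {(i, j). int i + int j \<le> k}"
  have finI: "finite I"
    by (rule finite_subset[of _ "{..nat k} \<times> {..nat k}"]) (auto simp: I_def)
  have A_ex: "\<exists>K\<in>T. x \<in> A K" if x: "x \<in> \<Union>T" for x
  proof -
    obtain K where "K \<in> T \<and> x \<in> K" using x by blast
    \<comment> \<open>Of the members containing \<open>x\<close>, the one with the least index keeps
      it.\<close>
    from exists_least_iff[THEN iffD1, of "\<lambda>n. \<exists>K. (K \<in> T \<and> x \<in> K) \<and> r K = n"] this
    show ?thesis unfolding A_def by blast
  qed
  have A_unique: "K = L" if "K \<in> T" "L \<in> T" "x \<in> A K" "x \<in> A L" for K L x
  proof (rule inj_onD[OF r _ that(1,2)])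
    have "\<not> r K < r L" "\<not> r L < r K" using that by (auto simp: A_def)
    then show "r K = r L" by simp
  qed
  define e :: "pt set \<times> (nat \<times> nat) \<times> 'b \<Rightarrow> pt \<Rightarrow> 'b"
    where "e = (\<lambda>(K, (i, j), b) x. indicator (A K) x *\<^sub>R ((x $ 1 ^ i * x $ 2 ^ j) *\<^sub>R b))"
  let ?B = "e ` (T \<times> I \<times> Basis)"
  have e_L2: "e (K, (i, j), b) \<in> L2 D" if K: "K \<in> T" for K i j b
  proof -
    let ?q = "\<lambda>x :: pt. (x $ 1 ^ i * x $ 2 ^ j) *\<^sub>R b"
    have q: "?q \<in> L2 D" by (intro L2_continuous[OF D] continuous_intros)
    have "A K \<in> sets borel"
      unfolding A_def using T K by (intro sets.Diff borel_closed sets.finite_Union) auto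
    then have "(\<lambda>x. indicat_real (A K) x) \<in> borel_measurable (lebesgue_on D)"
      by (intro measurable_restrict_space1 measurable_completion) simp
    then have m: "e (K, (i, j), b) \<in> borel_measurable (lebesgue_on D)"
      using L2_D(1)[OF q] unfolding e_def prod.case by (rule borel_measurable_scaleR)
    show ?thesis
      by (rule L2_boundI[OF m L2_D(2)[OF q]]) (auto simp: e_def indicator_def)
  qed
  have BL2: "?B \<subseteq> L2 D" using e_L2 by auto
  have "\<exists>y\<in>span ?B. L2_inner D (f - y) (f - y) = 0" if f: "f \<in> piecewise_polynomials D T k" for f :: "pt \<Rightarrow> 'b"
  proof -
    obtain p where p: "piecewise_poly T k f p" using f by (auto simp: piecewise_polynomials_def)
    have "\<forall>K\<in>T. \<exists>c. \<forall>x. p K x = (\<Sum>(i, j)\<in>I. (x $ 1 ^ i * x $ 2 ^ j) *\<^sub>R c i j)"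
      using p by (simp add: piecewise_poly_def poly_space_def I_def)
    from bchoice[OF this]
    obtain c where "\<forall>K\<in>T. \<forall>x. p K x = (\<Sum>(i, j)\<in>I. (x $ 1 ^ i * x $ 2 ^ j) *\<^sub>R c K i j)" ..
    note c = this[rule_format]
    \<comment> \<open>\<open>y\<close> copies the polynomial of each member on its disjoint cell;
      the vector coefficients are resolved in \<open>Basis\<close>.\<close>
    define y where "y = (\<Sum>K\<in>T. \<Sum>m\<in>I. \<Sum>b\<in>Basis. (c K (fst m) (snd m) \<bullet> b) *\<^sub>R e (K, m, b))"
    have y_span: "y \<in> span ?B"
      unfolding y_def by (intro span_sum span_scale span_base) auto
    have sum_apply: "(\<Sum>z\<in>Z. F z) x = (\<Sum>z\<in>Z. F z x)" for Z and F :: "'z \<Rightarrow> pt \<Rightarrow> 'b" and x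
      by (induction Z rule: infinite_finite_induct) auto
    have y_apply: "y x = p K x" if K: "K \<in> T" "x \<in> A K" for K x
    proof -
      have "(\<Sum>m\<in>I. \<Sum>b\<in>Basis. (c L (fst m) (snd m) \<bullet> b) *\<^sub>R e (L, m, b) x) = (if L = K then p K x else 0)"
        if L: "L \<in> T" for L
      proof (cases "L = K")
        case True
        have "(\<Sum>b\<in>Basis. (c K (fst m) (snd m) \<bullet> b) *\<^sub>R e (K, m, b) x)
          = (x $ 1 ^ fst m * x $ 2 ^ snd m) *\<^sub>R c K (fst m) (snd m)" for m
        proof -
          have "(\<Sum>b\<in>Basis. (c K (fst m) (snd m) \<bullet> b) *\<^sub>R e (K, m, b) x)
            = (x $ 1 ^ fst m * x $ 2 ^ snd m) *\<^sub>R (\<Sum>b\<in>Basis. (c K (fst m) (snd m) \<bullet> b) *\<^sub>R b)"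
            using K(2) by (simp add: e_def case_prod_beta scaleR_sum_right mult.commute)
          then show ?thesis by (simp add: euclidean_representation)
        qed
        then show ?thesis using True c[OF K(1)] by (simp add: case_prod_beta)
      next
        case False
        then have "x \<notin> A L" using A_unique[OF K(1) L K(2)] by auto
        then show ?thesis using False by (simp add: e_def case_prod_beta)
      qed
      then have "y x = (\<Sum>L\<in>T. if L = K then p K x else 0)"
        unfolding y_def by (simp add: sum_apply cong: sum.cong)
      then show ?thesis using T(1) K(1) by simp
    qed
    \<comment> \<open>Outside a null set \<open>f\<close> agrees with the polynomial of every member
      that contains the point, so it is immaterial which cell a shared point is assigned to.\<close>
    have "AE x in lebesgue. \<forall>K\<in>T. x \<in> K \<longrightarrow> f x = p K x"
    proof (intro AE_ball_countable[THEN iffD2] ballI countable_finite T(1))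
      fix K assume K: "K \<in> T"
      then have "AE x in lebesgue_on K. f x = p K x" using p by (simp add: piecewise_poly_def)
      then show "AE x in lebesgue. x \<in> K \<longrightarrow> f x = p K x"
        using T(2)[OF K] by (subst (asm) AE_restrict_space_iff) auto
    qed
    then have "AE x in lebesgue. x \<in> D \<longrightarrow> (f - y) x = 0"
    proof eventually_elim
      fix x assume x: "\<forall>K\<in>T. x \<in> K \<longrightarrow> f x = p K x"
      show "x \<in> D \<longrightarrow> (f - y) x = 0"
      proof
        assume "x \<in> D"
        then obtain K where "K \<in> T" "x \<in> A K" using A_ex T(3) by blast
        then show "(f - y) x = 0" using x y_apply by (auto simp: A_def)
      qed
    qed
    then have "AE x in lebesgue_on D. (f - y) x = 0"
      using D(1) by (subst AE_restrict_space_iff) auto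
    moreover have "f - y \<in> L2 D"
      using f y_span span_minimal[OF BL2 subspace_L2]
      by (intro subspace_diff[OF subspace_L2]) (auto simp: piecewise_polynomials_def)
    ultimately show ?thesis using y_span L2_inner_self_eq_0_iff by blast
  qed
  then show ?thesis
    unfolding finitely_spanned_def using T(1) finI BL2
    by (intro exI[of _ ?B]) auto
qed

lemma mesh_of_D:
  assumes "mesh_of X T"
  shows "finite T" "K \<in> T \<Longrightarrow> closed K" "mid X \<subseteq> \<Union>T"
  using assms closure_subset[of "mid X"]
  by (auto simp: mesh_of_def triangulation_def intro: closed_simplex)


section \<open>Well-posedness of the discrete problem\<close>

lemma field_diff_eq: "field_diff \<Phi> \<Psi> = \<Phi> - \<Psi>"
  by (simp add: lincomb_eq)

lemma field_inner_cong_ae_eq: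
  assumes "f \<in> L2_fields S S'" "g \<in> L2_fields S S'" "h \<in> L2_fields S S'" "ae_eq S S' f g"
  shows "field_inner S S' f h = field_inner S S' g h"
proof -
  interpret semi_inner "L2_fields S S'" "field_inner S S'" by (rule semi_inner_fields)
  have d: "f - g \<in> L2_fields S S'" using assms(1,2) by (rule mem(4))
  have "ae_eq S S' (f - g) 0" using assms(4) by (rule ae_eq_iff_diff[THEN iffD1])
  then have "field_inner S S' (f - g) (f - g) = 0" using field_inner_self_eq_0_iff[OF d] by blast
  then have "field_inner S S' (f - g) h = 0" by (rule null_left[OF d assms(3)])
  then show ?thesis using diff_left[OF assms(1-3)] by simp
qed

lemma ae_eq_of_field_norm_le_0:
  assumes "f \<in> L2_fields S S'" "g \<in> L2_fields S S'" "field_norm S S' (f - g) \<le> 0"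
  shows "ae_eq S S' f g"
proof -
  interpret semi_inner "L2_fields S S'" "field_inner S S'" by (rule semi_inner_fields)
  have d: "f - g \<in> L2_fields S S'" using assms(1,2) by (rule mem(4))
  then have "field_inner S S' (f - g) (f - g) = 0"
    using assms(3) nonneg[OF d] by (simp add: field_norm_def)
  then show ?thesis using field_inner_self_eq_0_iff[OF d] ae_eq_iff_diff by blast
qed

lemma polygonal_plate_mid: "polygonal_plate X \<Longrightarrow> open (mid X) \<and> bounded (mid X)"
  by (simp add: polygonal_plate_def lipschitz_domain_def)

lemma Vh_space_eq:
  "Vh_space S S' T T' k3 k4 =
     (piecewise_polynomials (mid S) T k3 \<times> piecewise_polynomials (mid S) T k4) \<times>
     (piecewise_polynomials (mid S') T' k3 \<times> piecewise_polynomials (mid S') T' k4)"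
  by (auto simp: Vh_space_def V_space_def piecewise_polynomials_def)

lemma fe_stress_subset:
  "fe_stress S S' \<theta> T T' k1 k2 \<subseteq>
     (piecewise_polynomials (mid S) T k1 \<times> piecewise_polynomials (mid S) T k2) \<times>
     (piecewise_polynomials (mid S') T' k1 \<times> piecewise_polynomials (mid S') T' k2)"
  by (auto simp: fe_stress_def Hs_space_def Vs_space_def L2_sym_def piecewise_sym_poly_def
      piecewise_polynomials_def)

theorem theorem4p1:
  fixes S S' :: plate and \<theta> E e \<nu> \<sigma> h C :: real
    and T T' :: "pt set set" and k1 k2 k3 k4 :: int
    and Sig_h Sig_t :: "stress set" and Vh :: "displacement set"
    and norm_t :: "stress \<Rightarrow> real" and Pi_h :: "stress \<Rightarrow> stress"
  assumes geometry: "folded_plate S S' \<theta>"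
    and material: "E > 0" "e > 0" "-1 < \<nu>" "\<nu> < 1"
    and meshes: "mesh_of S T" "mesh_of S' T'" "shape_regular \<sigma> T" "shape_regular \<sigma> T'"
      "compatible_meshes S S' T T'" "h = mesh_size T T'"
    and Sig_h: "conforming_stress_space S S' \<theta> T T' k1 k2 Sig_h"
    and Vh: "Vh = Vh_space S S' T T' k3 k4"
    and B_star_Sig_h: "B_star S S' ` Sig_h \<subseteq> Vh"
    and A1_space: "linear_space Sig_t" "Sig_t \<subseteq> Sigma_space S S' \<theta>" "norm_on S S' Sig_t norm_t"
    and A1: "\<And>\<psi>. \<psi> \<in> Vh \<Longrightarrow> \<exists>\<Phi>\<in>Sig_t. ae_eq S S' (B_star S S' \<Phi>) \<psi>"
    and A2_maps: "\<And>\<Phi>. \<Phi> \<in> Sig_t \<Longrightarrow> Pi_h \<Phi> \<in> Sig_h"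
    and A2_commutes: "\<And>\<Phi>. \<Phi> \<in> Sig_t \<Longrightarrow>
      L2_projection S S' Vh (B_star S S' \<Phi>) (B_star S S' (Pi_h \<Phi>))"
    and A2_bounded: "\<And>\<Phi>. \<Phi> \<in> Sig_t \<Longrightarrow> Sigma_norm S S' (Pi_h \<Phi>) \<le> C * norm_t \<Phi>"
  shows
    "(\<forall>F\<in>V_space S S'. \<exists>\<Phi> \<phi>. discrete_solution S S' E e \<nu> Sig_h Vh F \<Phi> \<phi> \<and>
        (\<forall>\<Phi>' \<phi>'. discrete_solution S S' E e \<nu> Sig_h Vh F \<Phi>' \<phi>' \<longrightarrow>
           ae_eq S S' \<Phi>' \<Phi> \<and> ae_eq S S' \<phi>' \<phi>)) \<and>
     (\<exists>c. \<forall>F\<in>V_space S S'. \<forall>F'\<in>V_space S S'. \<forall>\<Phi> \<phi> \<Phi>' \<phi>'.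
        discrete_solution S S' E e \<nu> Sig_h Vh F \<Phi> \<phi> \<and>
        discrete_solution S S' E e \<nu> Sig_h Vh F' \<Phi>' \<phi>' \<longrightarrow>
        Sigma_norm S S' (field_diff \<Phi> \<Phi>') + field_norm S S' (field_diff \<phi> \<phi>')
          \<le> c * field_norm S S' (field_diff F F'))"
proof -
  have D: "open (mid S)" "bounded (mid S)" "open (mid S')" "bounded (mid S')"
    using geometry polygonal_plate_mid by (auto simp: folded_plate_def)
  have DL: "mid S \<in> sets lebesgue" "mid S' \<in> sets lebesgue" using D by auto
  let ?a = "field_compliance S S' E e \<nu>" and ?b = "field_inner S S' :: displacement \<Rightarrow> _"
  let ?B = "B_star S S'"
  define \<beta> where "\<beta> \<Phi> \<psi> = ?b (?B \<Phi>) \<psi>" for \<Phi> \<psi>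
  interpret A: semi_inner "L2_fields S S'" ?a
    by (rule semi_inner_field_compliance[OF material])
  interpret V: semi_inner "L2_fields S S'" ?b by (rule semi_inner_fields)
  interpret Vs: semi_inner "L2_fields S S'" "field_inner S S' :: stress \<Rightarrow> _" by (rule semi_inner_fields)

  have SigU: "subspace Sig_h" and SigHs: "Sig_h \<subseteq> Hs_space S S'"
    and SigFE: "Sig_h \<subseteq> fe_stress S S' \<theta> T T' k1 k2"
    using Sig_h by (auto simp: conforming_stress_space_def linear_space_eq Sigma_space_def)
  have SigVs: "Sig_h \<subseteq> Vs_space S S'" using SigHs by (auto simp: Hs_space_def)
  have SigL2: "Sig_h \<subseteq> L2_fields S S'" using SigVs Vs_space_subset by blast
  have VhU: "subspace Vh" unfolding Vh Vh_space_eq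
    by (intro subspace_Times subspace_piecewise_polynomials)
  have VhL2: "Vh \<subseteq> L2_fields S S'"
    unfolding Vh Vh_space_eq L2_fields_def by (auto simp: piecewise_polynomials_def)
  have BVh: "?B \<Phi> \<in> Vh" if "\<Phi> \<in> Sig_h" for \<Phi> using B_star_Sig_h that by blast
  have BL2: "?B \<Phi> \<in> L2_fields S S'" if "\<Phi> \<in> Sig_h" for \<Phi> using BVh[OF that] VhL2 by blast
  have poly_L2: "piecewise_polynomials X U k \<subseteq> L2 X" for X U k
    by (auto simp: piecewise_polynomials_def)
  have zero_L2: "0 \<in> L2 X" for X by (rule subspace_0[OF subspace_L2])
  note fs = finitely_spanned_piecewise_polynomials[OF D(1,2) mesh_of_D[OF meshes(1)]]
    finitely_spanned_piecewise_polynomials[OF D(3,4) mesh_of_D[OF meshes(2)]]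
  have "finitely_spanned (L2_fields S S') ?b Vh"
    unfolding Vh Vh_space_eq L2_fields_def field_inner_eq
    by (intro finitely_spanned_Times fs zero_L2) (auto simp: zero_prod_def zero_L2)
  from finitely_spanned_orthonormal_card[OF V.semi_inner_axioms VhU VhL2 this]
  obtain n where n: "\<And>Y. semi_inner.orthonormal Vh ?b Y \<Longrightarrow> card Y \<le> n" by blast
  have "finitely_spanned (L2_fields S S') ?a
     ((piecewise_polynomials (mid S) T k1 \<times> piecewise_polynomials (mid S) T k2) \<times>
      (piecewise_polynomials (mid S') T' k1 \<times> piecewise_polynomials (mid S') T' k2))"
    unfolding L2_fields_def field_compliance_def
    by (intro finitely_spanned_Times finitely_spanned_L2_compliance fs zero_L2 poly_L2)
      (auto simp: zero_prod_def zero_L2)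
  \<comment> \<open>\<open>Sig_h\<close> is an arbitrary subspace of the finite element stresses, so
    its dimension bound is inherited from the full product of piecewise polynomial spaces.\<close>
  then have "finitely_spanned (L2_fields S S') ?a Sig_h"
    by (rule finitely_spanned_mono) (use SigFE fe_stress_subset in blast)
  from finitely_spanned_orthonormal_card[OF A.semi_inner_axioms SigU SigL2 this]
  obtain m where m: "\<And>Y. semi_inner.orthonormal Sig_h ?a Y \<Longrightarrow> card Y \<le> m" by blast

  \<comment> \<open>The coupling form is exactly linear although \<open>B_star\<close> is so only
    almost everywhere: the inner product does not see null sets.\<close>
  have \<beta>_lincomb: "\<beta> (r *\<^sub>R \<Phi> + s *\<^sub>R \<Psi>) \<psi> = r * \<beta> \<Phi> \<psi> + s * \<beta> \<Psi> \<psi>"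
    if "\<Phi> \<in> Sig_h" "\<Psi> \<in> Sig_h" "\<psi> \<in> Vh" for r s \<Phi> \<Psi> \<psi>
  proof -
    have sum: "r *\<^sub>R \<Phi> + s *\<^sub>R \<Psi> \<in> Sig_h"
      using that SigU by (intro subspace_add subspace_scale)
    note B = BL2[OF that(1)] BL2[OF that(2)]
    have \<psi>: "\<psi> \<in> L2_fields S S'" using that(3) VhL2 by blast
    have Hs: "\<Phi> \<in> Hs_space S S'" "\<Psi> \<in> Hs_space S S'" using that(1,2) SigHs by blast+
    have "\<beta> (r *\<^sub>R \<Phi> + s *\<^sub>R \<Psi>) \<psi> = ?b (r *\<^sub>R ?B \<Phi> + s *\<^sub>R ?B \<Psi>) \<psi>"
      unfolding \<beta>_def
      by (intro field_inner_cong_ae_eq B_star_lincomb D V.mem(2,3) B BL2[OF sum] \<psi> Hs)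
    also have "\<dots> = r * \<beta> \<Phi> \<psi> + s * \<beta> \<Psi> \<psi>"
      unfolding \<beta>_def V.add_left[OF V.mem(3)[OF B(1)] V.mem(3)[OF B(2)] \<psi>]
        V.scale_left[OF B(1) \<psi>] V.scale_left[OF B(2) \<psi>] ..
    finally show ?thesis .
  qed
  have onto: "\<exists>\<Phi>\<in>Sig_h. \<forall>z\<in>Vh. \<beta> \<Phi> z = ?b \<psi> z" if \<psi>: "\<psi> \<in> Vh" for \<psi>
  proof -
    obtain \<Phi> where \<Phi>: "\<Phi> \<in> Sig_t" "ae_eq S S' (?B \<Phi>) \<psi>" using A1[OF \<psi>] by blast
    have \<Phi>_Hs: "\<Phi> \<in> Hs_space S S'"
      using \<Phi>(1) A1_space(2) unfolding Sigma_space_def by blast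
    have "?b (?B (Pi_h \<Phi>)) z = ?b \<psi> z" if z: "z \<in> Vh" for z
    proof -
      have "?b (?B \<Phi>) z = ?b \<psi> z"
        by (rule field_inner_cong_ae_eq[OF B_star_mem[OF \<Phi>_Hs] _ _ \<Phi>(2)]) (use \<psi> z VhL2 in blast)+
      moreover have "?b (?B \<Phi>) z = ?b (?B (Pi_h \<Phi>)) z"
        using A2_commutes[OF \<Phi>(1)] z unfolding L2_projection_def by blast
      ultimately show ?thesis by simp
    qed
    then show ?thesis using A2_maps[OF \<Phi>(1)] unfolding \<beta>_def by blast
  qed
  interpret X: semi_inner Sig_h ?a by (rule A.semi_inner_subset[OF SigU SigL2])
  interpret Y: semi_inner Vh ?b by (rule V.semi_inner_subset[OF VhU VhL2])
  interpret P: saddle_point Sig_h ?a Vh ?b \<beta> m n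
  proof
    show "\<beta> (x + x') y = \<beta> x y + \<beta> x' y" if "x \<in> Sig_h" "x' \<in> Sig_h" "y \<in> Vh" for x x' y
      using \<beta>_lincomb[of x x' y 1 1] that by simp
    show "\<beta> (r *\<^sub>R x) y = r * \<beta> x y" if "x \<in> Sig_h" "y \<in> Vh" for r x y
      using \<beta>_lincomb[of x x y r 0] that by simp
    show "\<beta> x (y + y') = \<beta> x y + \<beta> x y'" if "x \<in> Sig_h" "y \<in> Vh" "y' \<in> Vh" for x y y'
      using that BVh unfolding \<beta>_def by (intro Y.add_right)
    show "\<beta> x (r *\<^sub>R y) = r * \<beta> x y" if "x \<in> Sig_h" "y \<in> Vh" for r x y
      using that BVh unfolding \<beta>_def by (intro Y.scale_right)
    \<comment> \<open>\<open>?B x\<close> lies in \<open>Vh\<close>, so Cauchy-Schwarz within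
      \<open>Vh\<close> makes it orthogonal to null vectors.\<close>
    show "\<beta> x y = 0" if "x \<in> Sig_h" "y \<in> Vh" "?b y y = 0" for x y
      using Y.null_left[OF that(2) BVh[OF that(1)] that(3)] Y.commute[OF that(2) BVh[OF that(1)]]
      by (simp add: \<beta>_def)
  qed (rule onto m n; assumption)+

  have sol: "discrete_solution S S' E e \<nu> Sig_h Vh F \<Phi> \<phi> \<longleftrightarrow> \<Phi> \<in> Sig_h \<and> \<phi> \<in> Vh \<and>
     (\<forall>\<Psi>\<in>Sig_h. ?a \<Phi> \<Psi> + \<beta> \<Psi> \<phi> = 0) \<and> (\<forall>\<psi>\<in>Vh. \<beta> \<Phi> \<psi> = - ?b F \<psi>)" for F \<Phi> \<phi>
  proof -
    have "compliance_form S S' E e \<nu> \<Phi> \<Psi> = ?a \<Phi> \<Psi>" if "\<Phi> \<in> Sig_h" "\<Psi> \<in> Sig_h" for \<Phi> \<Psi>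
      by (rule compliance_form_eq[OF material DL]) (use that SigVs in blast)+
    then show ?thesis by (simp add: discrete_solution_def \<beta>_def cong: conj_cong)
  qed
  have V: "V_space S S' = L2_fields S S'" by (simp add: V_space_def L2_fields_def)
  obtain \<alpha> where \<alpha>: "\<alpha> > 0"
    "\<And>\<Phi>. \<Phi> \<in> L2_fields S S' \<Longrightarrow> \<alpha> * field_inner S S' \<Phi> \<Phi> \<le> ?a \<Phi> \<Phi>"
    using field_compliance_coercive[OF material] by blast
  obtain c where c: "c \<ge> 0" "\<forall>x\<in>Sig_h. \<forall>y\<in>Vh. \<forall>M. (\<forall>z\<in>Sig_h. ?a x z + \<beta> z y = 0) \<and>
      (\<forall>z\<in>Vh. \<bar>\<beta> x z\<bar> \<le> M * sqrt (?b z z)) \<longrightarrow> sqrt (?a x x) \<le> c * M \<and> sqrt (?b y y) \<le> c * M"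
    using P.stability by blast
  \<comment> \<open>\<open>P.stability\<close> bounds the energy norm of the stress; the first
    factor converts it into the \<open>L2\<close> norm.\<close>
  define c' where "c' = sqrt (1 / \<alpha>) * c"
  \<comment> \<open>The difference of two solutions solves the problem with the difference of the
    data. This one estimate gives uniqueness, for equal data, as well as continuous
    dependence.\<close>
  have stable: "field_norm S S' (\<Phi> - \<Phi>') \<le> c' * field_norm S S' (F - F') \<and>
      field_norm S S' (?B (\<Phi> - \<Phi>')) \<le> field_norm S S' (F - F') \<and>
      field_norm S S' (\<phi> - \<phi>') \<le> c * field_norm S S' (F - F')"
    if F: "F \<in> L2_fields S S'" "F' \<in> L2_fields S S'"
      and 1: "discrete_solution S S' E e \<nu> Sig_h Vh F \<Phi> \<phi>"
      and 2: "discrete_solution S S' E e \<nu> Sig_h Vh F' \<Phi>' \<phi>'" for F F' \<Phi> \<phi> \<Phi>' \<phi>'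
  proof -
    let ?M = "field_norm S S' (F - F')"
    have mem: "\<Phi> \<in> Sig_h" "\<Phi>' \<in> Sig_h" "\<phi> \<in> Vh" "\<phi>' \<in> Vh" using 1 2 by (simp_all only: sol)
    have d: "\<Phi> - \<Phi>' \<in> Sig_h" "\<phi> - \<phi>' \<in> Vh"
      by (rule X.mem(4)[OF mem(1,2)], rule Y.mem(4)[OF mem(3,4)])
    have dF: "F - F' \<in> L2_fields S S'" using F by (rule V.mem(4))
    have first: "?a (\<Phi> - \<Phi>') z + \<beta> z (\<phi> - \<phi>') = 0" if z: "z \<in> Sig_h" for z
    proof -
      have "?a (\<Phi> - \<Phi>') z + \<beta> z (\<phi> - \<phi>') = (?a \<Phi> z + \<beta> z \<phi>) - (?a \<Phi>' z + \<beta> z \<phi>')"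
        using mem z BVh[OF z] by (simp add: X.diff_left \<beta>_def Y.diff_right)
      then show ?thesis using 1 2 z by (simp add: sol)
    qed
    have second: "\<beta> (\<Phi> - \<Phi>') z = - ?b (F - F') z" if z: "z \<in> Vh" for z
    proof -
      have "z \<in> L2_fields S S'" using z VhL2 by blast
      then show ?thesis using 1 2 z mem F by (simp add: sol P.beta_diff_left V.diff_left)
    qed
    have bound: "\<bar>\<beta> (\<Phi> - \<Phi>') z\<bar> \<le> ?M * sqrt (?b z z)" if z: "z \<in> Vh" for z
    proof -
      have "z \<in> L2_fields S S'" using z VhL2 by blast
      from V.Cauchy_Schwarz_abs[OF dF this] show ?thesis using second[OF z] by (simp add: field_norm_def)
    qed
    have st: "sqrt (?a (\<Phi> - \<Phi>') (\<Phi> - \<Phi>')) \<le> c * ?M" "field_norm S S' (\<phi> - \<phi>') \<le> c * ?M"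
      using bspec[OF bspec[OF c(2) d(1)] d(2), THEN spec, of ?M] first bound
      unfolding field_norm_def by blast+
    have "\<alpha> * field_inner S S' (\<Phi> - \<Phi>') (\<Phi> - \<Phi>') \<le> ?a (\<Phi> - \<Phi>') (\<Phi> - \<Phi>')"
      by (rule \<alpha>(2)) (use d(1) SigL2 in blast)
    then have "field_inner S S' (\<Phi> - \<Phi>') (\<Phi> - \<Phi>') \<le> (1 / \<alpha>) * ?a (\<Phi> - \<Phi>') (\<Phi> - \<Phi>')"
      using \<alpha>(1) by (simp add: field_simps)
    then have "field_norm S S' (\<Phi> - \<Phi>') \<le> sqrt (1 / \<alpha>) * sqrt (?a (\<Phi> - \<Phi>') (\<Phi> - \<Phi>'))"
      unfolding field_norm_def real_sqrt_mult[symmetric] by (rule real_sqrt_le_mono)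
    also have "\<dots> \<le> sqrt (1 / \<alpha>) * (c * ?M)" using st(1) \<alpha>(1) by (intro mult_left_mono) auto
    finally have *: "field_norm S S' (\<Phi> - \<Phi>') \<le> c' * ?M" by (simp add: c'_def mult.assoc)
    \<comment> \<open>The constraint is tested with \<open>?B\<close> of the stress difference
      itself, which is admissible because it lies in \<open>Vh\<close>. The resulting bound has
      constant 1.\<close>
    let ?z = "?B (\<Phi> - \<Phi>')"
    have z: "?z \<in> Vh" by (rule BVh[OF d(1)])
    have sq: "sqrt (?b ?z ?z) * sqrt (?b ?z ?z) \<le> ?M * sqrt (?b ?z ?z)"
      using bound[OF z] Y.nonneg[OF z] by (simp add: \<beta>_def)
    have "sqrt (?b ?z ?z) \<le> ?M"
    proof (cases "?b ?z ?z = 0")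
      case True
      then show ?thesis using V.nonneg[OF dF] by (simp add: field_norm_def)
    next
      case False
      then have "0 < sqrt (?b ?z ?z)" using Y.nonneg[OF z] by simp
      then show ?thesis by (rule mult_right_le_imp_le[OF sq])
    qed
    then show ?thesis using * st(2) by (simp add: field_norm_def)
  qed
  have norm0: "field_norm S S' (F - F) = 0" for F :: displacement
    using V.zero_left[OF V.mem(1)] by (simp add: field_norm_def)
  show ?thesis
  \<comment> \<open>The three terms of the constant bound, in this order, the stress, its image
    under \<open>B_star\<close> and the displacement.\<close>
  proof (intro conjI ballI exI[of _ "c' + 1 + c"] allI impI)
    fix F assume F: "F \<in> V_space S S'"
    have "\<exists>x\<in>Sig_h. \<exists>y\<in>Vh. (\<forall>z\<in>Sig_h. ?a x z + \<beta> z y = 0) \<and> (\<forall>z\<in>Vh. \<beta> x z = - ?b F z)"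
    proof (rule P.solution_exists)
      fix x y r assume x: "x \<in> Vh" and y: "y \<in> Vh"
      have "x \<in> L2_fields S S'" "y \<in> L2_fields S S'" using x y VhL2 by blast+
      then show "- ?b F (x + y) = - ?b F x + - ?b F y"
        using F by (simp add: V.add_right V)
    next
      fix x r assume x: "x \<in> Vh"
      then have "x \<in> L2_fields S S'" using VhL2 by blast
      then show "- ?b F (r *\<^sub>R x) = r * (- ?b F x)"
        using F by (simp add: V.scale_right V)
    next
      fix x assume x: "x \<in> Vh" "?b x x = 0"
      then have "x \<in> L2_fields S S'" using VhL2 by blast
      then show "- ?b F x = 0"
        using V.null_left[of x F] V.commute[of x F] F x(2) by (simp add: V)
    qed
    then obtain \<Phi> \<phi> where ex: "discrete_solution S S' E e \<nu> Sig_h Vh F \<Phi> \<phi>" unfolding sol by blast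
    have "ae_eq S S' \<Phi>' \<Phi> \<and> ae_eq S S' \<phi>' \<phi>"
      if s: "discrete_solution S S' E e \<nu> Sig_h Vh F \<Phi>' \<phi>'" for \<Phi>' \<phi>'
    proof -
      have mem: "\<Phi> \<in> L2_fields S S'" "\<Phi>' \<in> L2_fields S S'" "\<phi> \<in> L2_fields S S'" "\<phi>' \<in> L2_fields S S'"
        using ex s SigL2 VhL2 unfolding sol by blast+
      have "field_norm S S' (\<Phi>' - \<Phi>) \<le> 0 \<and> field_norm S S' (\<phi>' - \<phi>) \<le> 0"
        using stable[OF _ _ s ex] F unfolding norm0 V by simp
      then show ?thesis using ae_eq_of_field_norm_le_0[OF mem(2,1)] ae_eq_of_field_norm_le_0[OF mem(4,3)] by blast
    qed
    then show "\<exists>\<Phi> \<phi>. discrete_solution S S' E e \<nu> Sig_h Vh F \<Phi> \<phi> \<and>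
        (\<forall>\<Phi>' \<phi>'. discrete_solution S S' E e \<nu> Sig_h Vh F \<Phi>' \<phi>' \<longrightarrow>
           ae_eq S S' \<Phi>' \<Phi> \<and> ae_eq S S' \<phi>' \<phi>)" using ex by blast
  next
    fix F F' \<Phi> \<phi> \<Phi>' \<phi>'
    assume F: "F \<in> V_space S S'" "F' \<in> V_space S S'"
      and s: "discrete_solution S S' E e \<nu> Sig_h Vh F \<Phi> \<phi> \<and> discrete_solution S S' E e \<nu> Sig_h Vh F' \<Phi>' \<phi>'"
    have mem: "\<Phi> - \<Phi>' \<in> Sig_h" using s X.mem(4) unfolding sol by blast
    have "Sigma_norm S S' (\<Phi> - \<Phi>') \<le> field_norm S S' (\<Phi> - \<Phi>') + field_norm S S' (?B (\<Phi> - \<Phi>'))"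
      unfolding Sigma_norm_def
    proof (rule sqrt_sum_squares_le_sum)
      have "\<Phi> - \<Phi>' \<in> L2_fields S S'" using mem SigL2 by blast
      then show "0 \<le> field_norm S S' (\<Phi> - \<Phi>')" using Vs.nonneg by (simp add: field_norm_def)
      show "0 \<le> field_norm S S' (?B (\<Phi> - \<Phi>'))" using V.nonneg[OF BL2[OF mem]] by (simp add: field_norm_def)
    qed
    also have "\<dots> \<le> c' * field_norm S S' (F - F') + field_norm S S' (F - F')"
      using stable[of F F' \<Phi> \<phi> \<Phi>' \<phi>'] F s by (simp add: V)
    finally show "Sigma_norm S S' (field_diff \<Phi> \<Phi>') + field_norm S S' (field_diff \<phi> \<phi>')
          \<le> (c' + 1 + c) * field_norm S S' (field_diff F F')"
      using stable[of F F' \<Phi> \<phi> \<Phi>' \<phi>'] F s by (simp add: V field_diff_eq distrib_right)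
  qed
qed

end
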